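(* Suppose $\varphi(\ell)=e^{A\ell}$ (with a constant $A>0$) and $c(t,\theta)$, $0\le t\le1$, is a path connecting $C_1,C_2$. Assume that $|c_t^{\perp}|$ does not depend on $\theta$ and that $\ell(t)=\ell(c(t,\cdot))<1/A$ for all $t$. Then $$\mathrm{dist}_{G^{\varphi}}(C_1^{or},C_2^{or})=\sqrt{Ae}\;d^{\flat}(C_1^{or},C_2^{or}).$$ It follows that the path $c(t,\theta)$ is not minimal.
   Context: $Imm(S^1,\mathbb{R}^2)$ is the space of $C^\infty$ immersions $S^1\to\mathbb{R}^2$, and $B_i(S^1,\mathbb{R}^2)=Imm(S^1,\mathbb{R}^2)/Diff(S^1)$ is its quotient by reparametrization, with projection $\pi$. An oriented curve is a class of immersions modulo orientation-preserving diffeomorphisms of $S^1$. For an immersion $c$, put $c_\theta=dc/d\theta$, $n_c=ic_\theta/|c_\theta|$ (identifying $\mathbb{R}^2=\mathbb{C}$), $\ell(c)=\int_{S^1}|c_\theta|\,d\theta$, and for a positive function $\varphi$ of $\ell$ and $h,k\in C^\infty(S^1,\mathbb{R}^2)$, $$G^{\varphi}_c(h,k)=\varphi(\ell(c))\int_{S^1}(h\cdot k)\,|c_\theta|\,d\theta .$$ A path connecting $C_1,C_2\in B_i(S^1,\mathbb{R}^2)$ is a smooth path $t\mapsto c(t,\cdot)\in Imm(S^1,\mathbb{R}^2)$, $0\le t\le1$, with $\pi(c(0,\cdot))=C_1$ and $\pi(c(1,\cdot))=C_2$; $C_1^{or},C_2^{or}$ denote $C_1,C_2$ with the orientations given by $c(0,\cdot)$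 and $c(1,\cdot)$. Write $c_t=\partial c/\partial t$, $c_t^\perp=(c_t\cdot n_c)n_c$, and $$L_{G^{\varphi}}(c)=\int_0^1\sqrt{G^{\varphi}_c(c_t^{\perp},c_t^{\perp})}\,dt .$$ $\mathrm{dist}_{G^\varphi}(C_1^{or},C_2^{or})$ is the infimum of $L_{G^\varphi}$ over all smooth paths of immersions starting at a parametrization of $C_1^{or}$ and ending at a parametrization of $C_2^{or}$ compatible with the orientations. A path is minimal if its length $L_{G^\varphi}$ equals this distance between its endpoints. For an oriented curve $C$, $w_C(x,y)$ is the winding number of $C$ around $(x,y)\in\mathbb{R}^2$, and $$d^{\flat}(C_1^{or},C_2^{or})=\int_{\mathbb{R}^2}|w_{C_1}-w_{C_2}|\,dx\,dy .$$
   Formalization: Non-minimality is stated only for paths whose normal velocity c_t^⊥ is not identically zero; if c_t^⊥ vanishes identically (e.g. a constant path at a small circle), the length and the distance are both 0 and the path is minimal. *)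

theory Defs
  imports "HOL-Complex_Analysis.Complex_Analysis"
begin

text \<open>Smoothness on an open set, and, on an arbitrary set such as the manifold with boundary
  \<open>[0,1] \<times> \<real>\<close>, the existence of a smooth extension to an open neighbourhood.\<close>

fun differentiable_upto ::
  "nat \<Rightarrow> 'a::real_normed_vector set \<Rightarrow> ('a \<Rightarrow> 'b::real_normed_vector) \<Rightarrow> bool" where
  "differentiable_upto 0 U f \<longleftrightarrow> continuous_on U f"
| "differentiable_upto (Suc n) U f \<longleftrightarrow>
     (\<forall>x\<in>U. f differentiable (at x)) \<and>
     (\<forall>v. differentiable_upto n U (\<lambda>x. frechet_derivative f (at x) v))"

definition smooth_on ::
  "'a::real_normed_vector set \<Rightarrow> ('a \<Rightarrow> 'b::real_normed_vector) \<Rightarrow> bool" where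
  "smooth_on S f \<longleftrightarrow>
     (\<exists>U g. open U \<and> S \<subseteq> U \<and> (\<forall>x\<in>S. g x = f x) \<and> (\<forall>n. differentiable_upto n U g))"

text \<open>Maps on the circle \<open>\<real>/2\<pi>\<int>\<close> are \<open>2\<pi>\<close>-periodic functions of the angle, and \<open>\<real>\<^sup>2\<close> is
  \<^typ>\<open>complex\<close>. Diffeomorphisms of the circle are given by their lifts to the real line.\<close>

definition Imm :: "(real \<Rightarrow> complex) set" where
  "Imm = {c. smooth_on UNIV c \<and> (\<forall>\<theta>. c (\<theta> + 2 * pi) = c \<theta>) \<and>
             (\<forall>\<theta>. vector_derivative c (at \<theta>) \<noteq> 0)}"

definition circle_diffeos_pos :: "(real \<Rightarrow> real) set" where
  "circle_diffeos_pos = {\<psi>. smooth_on UNIV \<psi> \<and> (\<forall>\<theta>. deriv \<psi> \<theta> > 0) \<and>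
                            (\<forall>\<theta>. \<psi> (\<theta> + 2 * pi) = \<psi> \<theta> + 2 * pi)}"

definition circle_diffeos_neg :: "(real \<Rightarrow> real) set" where
  "circle_diffeos_neg = {\<psi>. smooth_on UNIV \<psi> \<and> (\<forall>\<theta>. deriv \<psi> \<theta> < 0) \<and>
                            (\<forall>\<theta>. \<psi> (\<theta> + 2 * pi) = \<psi> \<theta> - 2 * pi)}"

definition reparam :: "((real \<Rightarrow> complex) \<times> (real \<Rightarrow> complex)) set" where
  "reparam = {(c, d). c \<in> Imm \<and> d \<in> Imm \<and>
                      (\<exists>\<psi> \<in> circle_diffeos_pos \<union> circle_diffeos_neg. d = c \<circ> \<psi>)}"

definition oriented_reparam :: "((real \<Rightarrow> complex) \<times> (real \<Rightarrow> complex)) set" where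
  "oriented_reparam = {(c, d). c \<in> Imm \<and> d \<in> Imm \<and> (\<exists>\<psi> \<in> circle_diffeos_pos. d = c \<circ> \<psi>)}"

definition B_i :: "(real \<Rightarrow> complex) set set" where
  "B_i = Imm // reparam"

definition proj :: "(real \<Rightarrow> complex) \<Rightarrow> (real \<Rightarrow> complex) set" where
  "proj c = reparam `` {c}"

definition oriented_curve :: "(real \<Rightarrow> complex) \<Rightarrow> (real \<Rightarrow> complex) set" where
  "oriented_curve c = oriented_reparam `` {c}"

definition unit_normal :: "(real \<Rightarrow> complex) \<Rightarrow> real \<Rightarrow> complex" where
  "unit_normal c \<theta> =
     \<i> * vector_derivative c (at \<theta>) / of_real (norm (vector_derivative c (at \<theta>)))"

definition curve_length :: "(real \<Rightarrow> complex) \<Rightarrow> real" where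
  "curve_length c = integral {0..2 * pi} (\<lambda>\<theta>. norm (vector_derivative c (at \<theta>)))"

definition G ::
  "(real \<Rightarrow> real) \<Rightarrow> (real \<Rightarrow> complex) \<Rightarrow> (real \<Rightarrow> complex) \<Rightarrow> (real \<Rightarrow> complex) \<Rightarrow> real" where
  "G \<phi> c h k = \<phi> (curve_length c) *
     integral {0..2 * pi} (\<lambda>\<theta>. (h \<theta> \<bullet> k \<theta>) * norm (vector_derivative c (at \<theta>)))"

text \<open>A path is a function \<open>c t \<theta>\<close>; its values for \<open>t\<close> outside \<open>[0,1]\<close> are irrelevant.\<close>

definition imm_path :: "(real \<Rightarrow> real \<Rightarrow> complex) \<Rightarrow> bool" where
  "imm_path c \<longleftrightarrow> smooth_on ({0..1} \<times> UNIV) (\<lambda>(t, \<theta>). c t \<theta>) \<and> (\<forall>t\<in>{0..1}. c t \<in> Imm)"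

definition connects ::
  "(real \<Rightarrow> real \<Rightarrow> complex) \<Rightarrow> (real \<Rightarrow> complex) set \<Rightarrow> (real \<Rightarrow> complex) set \<Rightarrow> bool" where
  "connects c C1 C2 \<longleftrightarrow> imm_path c \<and> proj (c 0) = C1 \<and> proj (c 1) = C2"

definition normal_velocity :: "(real \<Rightarrow> real \<Rightarrow> complex) \<Rightarrow> real \<Rightarrow> real \<Rightarrow> complex" where
  "normal_velocity c t \<theta> =
     (vector_derivative (\<lambda>s. c s \<theta>) (at t within {0..1}) \<bullet> unit_normal (c t) \<theta>)
       *\<^sub>R unit_normal (c t) \<theta>"

definition path_cost :: "(real \<Rightarrow> real) \<Rightarrow> (real \<Rightarrow> real \<Rightarrow> complex) \<Rightarrow> real" where
  "path_cost \<phi> c =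
     integral {0..1} (\<lambda>t. sqrt (G \<phi> (c t) (normal_velocity c t) (normal_velocity c t)))"

text \<open>The real infimum below is the intended one only if some path joins the two oriented curves;
  this is so whenever they are the end points of a given path.\<close>

definition dist_G ::
  "(real \<Rightarrow> real) \<Rightarrow> (real \<Rightarrow> complex) set \<Rightarrow> (real \<Rightarrow> complex) set \<Rightarrow> real" where
  "dist_G \<phi> C1 C2 = Inf {path_cost \<phi> c |c. imm_path c \<and> c 0 \<in> C1 \<and> c 1 \<in> C2}"

definition minimal_path :: "(real \<Rightarrow> real) \<Rightarrow> (real \<Rightarrow> real \<Rightarrow> complex) \<Rightarrow> bool" where
  "minimal_path \<phi> c \<longleftrightarrow>
     path_cost \<phi> c = dist_G \<phi> (oriented_curve (c 0)) (oriented_curve (c 1))"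

text \<open>Off the curve, the winding number does not depend on the chosen parametrization. On the
  curve, which is a null set, it is unspecified; integrating against the completed measure
  \<^const>\<open>lebesgue\<close> makes these values irrelevant.\<close>

definition curve_winding :: "(real \<Rightarrow> complex) set \<Rightarrow> complex \<Rightarrow> complex" where
  "curve_winding C z = winding_number (\<lambda>s. (SOME c. c \<in> C) (2 * pi * s)) z"

definition d_flat :: "(real \<Rightarrow> complex) set \<Rightarrow> (real \<Rightarrow> complex) set \<Rightarrow> real" where
  "d_flat C1 C2 = (\<integral>z. norm (curve_winding C1 z - curve_winding C2 z) \<partial>lebesgue)"

end

theory Submission
  imports Defs
begin

text \<open>For a path of immersions \<open>p\<close> let \<open>J\<close> be its Jacobian determinant, so that \<open>\<bar>J\<bar>\<close> is the normal
  speed times the speed \<open>\<bar>p\<^sub>\<theta>\<bar>\<close> of the parametrization. By Cauchy-Schwarz the integrand of the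
  length of \<open>p\<close> is at least \<open>sqrt (\<phi> \<ell> / \<ell>)\<close> times \<open>\<integral> \<bar>J\<bar> d\<theta>\<close>, the rate at which the
  curve sweeps area, and \<open>exp (A * \<ell>) / \<ell>\<close> has its minimum \<open>A * exp 1\<close> at \<open>\<ell> = 1 / A\<close> and nowhere
  else. So \<open>p\<close> costs at least \<open>sqrt (A * exp 1)\<close> times the swept area, counted with multiplicity
  (\<open>path_cost_lower\<close>). The swept area in turn is at least the flat distance of the end curves, since
  the winding number around a point changes only when the curve passes over it
  (\<open>flat_le_swept_area\<close>). This gives one inequality for the distance. It also shows that the given path is
  not minimal: as long as it moves, its length stays below \<open>1 / A\<close>, where the first estimate is strict.

  For the other inequality both estimates have to be made nearly sharp. If the normal speed is constant
  along each curve, then the points that move in normal direction only travel on fixed straight lines,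
  so that the last curve is a parallel curve \<open>c + s n\<close> of the first one (\<open>characteristic\<close>,
  \<open>parallel_endpoint\<close>). The straight motion along the normals never turns back; it
  sweeps exactly the flat distance (\<open>swept_area_le_d_flat\<close>). Its curves are still shorter than
  \<open>1 / A\<close>. A superposed zigzag of high frequency, small amplitude and suitable slope stretches them
  to length \<open>1 / A\<close>; it hardly changes the swept area and hardly disturbs the constancy of the
  normal speed, which is the equality case of Cauchy-Schwarz. The cost then tends to
  \<open>sqrt (A * exp 1)\<close> times the flat distance (\<open>zigzag_paths\<close>, \<open>limit_cost_limit\<close>).

  Swept area and winding numbers are compared without degree theory. Around a disc that avoids both
  end curves there is a one-form that agrees with a multiple of \<open>dz / (z - a)\<close> outside the disc; Stokes'
  theorem on the parameter rectangle turns the change of its contour integral into the integral of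
  \<open>J\<close> over the preimage of the disc (\<open>disc_swept\<close>). By Vitali's theorem such discs fill the
  complement of the end curves.\<close>

section \<open>Calculus of smooth maps\<close>

lemma differentiable_upto_cong:
  assumes "open U" "\<And>x. x \<in> U \<Longrightarrow> f x = g x" "differentiable_upto n U f"
  shows "differentiable_upto n U g"
  using assms(2,3)
proof (induction n arbitrary: f g)
  case 0 then show ?case using continuous_on_eq[of U f g] by auto
next
  case (Suc n)
  have *: "(g has_derivative frechet_derivative f (at x)) (at x)" if "x \<in> U" for x
  proof -
    have "(f has_derivative frechet_derivative f (at x)) (at x)"
      using Suc.prems(2) that by (simp add: frechet_derivative_works)
    from has_derivative_transform_within_open[OF this assms(1) that Suc.prems(1)] show ?thesis by simp
  qed
  then have eq: "frechet_derivative g (at x) = frechet_derivative f (at x)" if "x \<in> U" for x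
    using frechet_derivative_at[OF *[OF that]] by simp
  have "differentiable_upto n U (\<lambda>x. frechet_derivative g (at x) v)" for v
    by (rule Suc.IH[of "\<lambda>x. frechet_derivative f (at x) v"]) (use Suc.prems(2) eq in auto)
  then show ?case using * by (auto simp: differentiable_def)
qed

lemma differentiable_upto_SucI:
  assumes "open U" "\<And>x. x \<in> U \<Longrightarrow> (f has_derivative F x) (at x)"
    "\<And>v. differentiable_upto n U (\<lambda>x. F x v)"
  shows "differentiable_upto (Suc n) U f"
proof -
  have "frechet_derivative f (at x) = F x" if "x \<in> U" for x
    using frechet_derivative_at[OF assms(2)[OF that]] by simp
  then have "differentiable_upto n U (\<lambda>x. frechet_derivative f (at x) v)" for v
    using differentiable_upto_cong[OF assms(1) _ assms(3)[of v]] by simp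
  then show ?thesis using assms(2) by (auto simp: differentiable_def)
qed

lemma differentiable_upto_Suc_has_derivative:
  "differentiable_upto (Suc n) U f \<Longrightarrow> x \<in> U \<Longrightarrow> (f has_derivative frechet_derivative f (at x)) (at x)"
  by (simp add: frechet_derivative_works)

lemma differentiable_upto_Suc_imp: "differentiable_upto (Suc n) U f \<Longrightarrow> differentiable_upto n U f"
proof (induction n arbitrary: f)
  case 0
  then have "continuous (at x) f" if "x \<in> U" for x
    using that differentiable_imp_continuous_within by auto
  then show ?case by (simp add: continuous_at_imp_continuous_on)
qed auto

lemma differentiable_upto_subset: "V \<subseteq> U \<Longrightarrow> differentiable_upto n U f \<Longrightarrow> differentiable_upto n V f"
  by (induction n arbitrary: f) (auto intro: continuous_on_subset)

lemma differentiable_upto_const: "open U \<Longrightarrow> differentiable_upto n U (\<lambda>x. c)"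
proof (induction n arbitrary: c)
  case (Suc n)
  show ?case by (rule differentiable_upto_SucI[where F="\<lambda>x v. 0"]) (use Suc in auto)
qed auto

lemma differentiable_upto_bounded_linear:
  assumes "open U" "bounded_linear L" "differentiable_upto n U f"
  shows "differentiable_upto n U (\<lambda>x. L (f x))"
  using assms(3)
proof (induction n arbitrary: f)
  case 0 then show ?case by (simp add: assms(2) bounded_linear.continuous_on)
next
  case (Suc n)
  show ?case
    by (rule differentiable_upto_SucI[where F="\<lambda>x v. L (frechet_derivative f (at x) v)"])
      (use Suc assms differentiable_upto_Suc_has_derivative[OF Suc.prems] in \<open>auto intro: bounded_linear.has_derivative\<close>)
qed

lemma differentiable_upto_linear:
  assumes "open U" "bounded_linear L"
  shows "differentiable_upto n U L"
proof (cases n)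
  case 0 then show ?thesis using linear_continuous_on[OF assms(2)] by simp
next
  case (Suc m)
  show ?thesis unfolding Suc
    by (rule differentiable_upto_SucI[where F="\<lambda>x. L"]) (use assms in \<open>auto intro: differentiable_upto_const bounded_linear_imp_has_derivative\<close>)
qed

lemma differentiable_upto_add:
  assumes "open U" "differentiable_upto n U f" "differentiable_upto n U g"
  shows "differentiable_upto n U (\<lambda>x. f x + g x)"
  using assms(2,3)
proof (induction n arbitrary: f g)
  case 0 then show ?case by (simp add: continuous_on_add)
next
  case (Suc n)
  show ?case
    by (rule differentiable_upto_SucI[where F="\<lambda>x v. frechet_derivative f (at x) v + frechet_derivative g (at x) v"])
      (use Suc assms differentiable_upto_Suc_has_derivative[OF Suc.prems(1)] differentiable_upto_Suc_has_derivative[OF Suc.prems(2)]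
        in \<open>auto intro: has_derivative_add\<close>)
qed

lemma differentiable_upto_bilinear:
  assumes "bounded_bilinear B" "open U" "differentiable_upto n U f" "differentiable_upto n U g"
  shows "differentiable_upto n U (\<lambda>x. B (f x) (g x))"
  using assms(3,4)
proof (induction n arbitrary: f g)
  case 0 then show ?case by (simp add: bounded_bilinear.continuous_on[OF assms(1)])
next
  case (Suc n)
  note d = differentiable_upto_Suc_has_derivative[OF Suc.prems(1)] differentiable_upto_Suc_has_derivative[OF Suc.prems(2)]
  show ?case
  proof (rule differentiable_upto_SucI[where F="\<lambda>x v. B (f x) (frechet_derivative g (at x) v) + B (frechet_derivative f (at x) v) (g x)"])
    fix v
    have "differentiable_upto n U f" "differentiable_upto n U g"
      using Suc.prems differentiable_upto_Suc_imp by auto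
    then show "differentiable_upto n U (\<lambda>x. B (f x) (frechet_derivative g (at x) v) + B (frechet_derivative f (at x) v) (g x))"
      using Suc by (intro differentiable_upto_add assms Suc.IH) auto
    fix x assume "x \<in> U"
    with d show "((\<lambda>x. B (f x) (g x)) has_derivative (\<lambda>v. B (f x) (frechet_derivative g (at x) v) + B (frechet_derivative f (at x) v) (g x))) (at x)"
      by (intro bounded_bilinear.FDERIV[OF assms(1)]) auto
  qed (fact assms)
qed

lemma differentiable_upto_compose_real:
  fixes f :: "'a::real_normed_vector \<Rightarrow> real" and g :: "real \<Rightarrow> 'b::real_normed_vector"
  assumes "open U" "open V" "\<And>x. x \<in> U \<Longrightarrow> f x \<in> V" "differentiable_upto n U f" "differentiable_upto n V g"
  shows "differentiable_upto n U (\<lambda>x. g (f x))"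
  using assms(4,5)
proof (induction n arbitrary: g)
  case 0
  then have "continuous_on U f" "continuous_on V g" by simp_all
  moreover have "f ` U \<subseteq> V" using assms(3) by blast
  ultimately show ?case unfolding differentiable_upto.simps by (auto intro: continuous_on_compose2)
next
  case (Suc n)
  let ?g' = "\<lambda>y. frechet_derivative g (at y) 1"
  have lin: "frechet_derivative g (at y) s = s *\<^sub>R ?g' y" if "y \<in> V" for y s
  proof -
    have "frechet_derivative g (at y) (s *\<^sub>R 1) = s *\<^sub>R ?g' y"
      by (rule linear_scale[OF has_derivative_linear[OF differentiable_upto_Suc_has_derivative[OF Suc.prems(2) that]]])
    then show ?thesis unfolding real_scaleR_def mult_1_right .
  qed
  show ?case
  proof (rule differentiable_upto_SucI[where F="\<lambda>x v. frechet_derivative f (at x) v *\<^sub>R ?g' (f x)"])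
    fix v
    show "differentiable_upto n U (\<lambda>x. frechet_derivative f (at x) v *\<^sub>R ?g' (f x))"
      using Suc.prems Suc.IH[of ?g'] differentiable_upto_Suc_imp[of n V g] differentiable_upto_Suc_imp[of n U f]
      by (intro differentiable_upto_bilinear[OF bounded_bilinear_scaleR assms(1)]) auto
  next
    fix x assume x: "x \<in> U"
    have "((\<lambda>x. g (f x)) has_derivative (\<lambda>v. frechet_derivative g (at (f x)) (frechet_derivative f (at x) v))) (at x)"
      by (rule has_derivative_compose[OF differentiable_upto_Suc_has_derivative[OF Suc.prems(1) x] 
            differentiable_upto_Suc_has_derivative[OF Suc.prems(2) assms(3)[OF x]]])
    then show "((\<lambda>x. g (f x)) has_derivative (\<lambda>v. frechet_derivative f (at x) v *\<^sub>R ?g' (f x))) (at x)"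
      by (subst (asm) lin[OF assms(3)[OF x]])
  qed (fact assms)
qed

lemma differentiable_upto_affine:
  assumes "bounded_linear L" "open U" "open V" "\<And>x. x \<in> U \<Longrightarrow> a + L x \<in> V" "differentiable_upto n V g"
  shows "differentiable_upto n U (\<lambda>x. g (a + L x))"
  using assms(5)
proof (induction n arbitrary: g)
  case 0
  have "continuous_on U (\<lambda>x. a + L x)"
    by (intro continuous_on_add continuous_on_const linear_continuous_on assms(1))
  moreover have "(\<lambda>x. a + L x) ` U \<subseteq> V" using assms(4) by blast
  moreover have "continuous_on V g" using 0 by simp
  ultimately show ?case unfolding differentiable_upto.simps by (auto intro: continuous_on_compose2)
next
  case (Suc n)
  show ?case
  proof (rule differentiable_upto_SucI[where F="\<lambda>x v. frechet_derivative g (at (a + L x)) (L v)"])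
    fix x assume x: "x \<in> U"
    have "((\<lambda>x. a + L x) has_derivative L) (at x)"
      using has_derivative_add[OF has_derivative_const bounded_linear_imp_has_derivative[OF assms(1)]] by simp
    from has_derivative_compose[OF this differentiable_upto_Suc_has_derivative[OF Suc.prems assms(4)[OF x]]]
    show "((\<lambda>x. g (a + L x)) has_derivative (\<lambda>v. frechet_derivative g (at (a + L x)) (L v))) (at x)" .
  next
    fix v show "differentiable_upto n U (\<lambda>x. frechet_derivative g (at (a + L x)) (L v))"
      by (rule Suc.IH) (use Suc.prems in auto)
  qed (fact assms)
qed

text \<open>Openness is part of the notion, so that the rules for composite maps carry this side condition along.\<close>

definition smooth_in :: "'a::real_normed_vector set \<Rightarrow> ('a \<Rightarrow> 'b::real_normed_vector) \<Rightarrow> bool" where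
  "smooth_in U f \<longleftrightarrow> open U \<and> (\<forall>n. differentiable_upto n U f)"

lemma smooth_on_UNIV_iff: "smooth_on UNIV f \<longleftrightarrow> smooth_in UNIV f"
  unfolding smooth_on_def smooth_in_def
  by (metis UNIV_I differentiable_upto_cong open_UNIV subset_UNIV top.extremum_unique)

lemma smooth_in_imp_smooth_on: "smooth_in U f \<Longrightarrow> S \<subseteq> U \<Longrightarrow> smooth_on S f"
  unfolding smooth_on_def smooth_in_def by auto

lemma smooth_in_cong: "smooth_in U f \<Longrightarrow> (\<And>x. x \<in> U \<Longrightarrow> f x = g x) \<Longrightarrow> smooth_in U g"
  unfolding smooth_in_def using differentiable_upto_cong by blast

lemma smooth_in_open: "smooth_in U f \<Longrightarrow> open U" by (simp add: smooth_in_def)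

lemma smooth_in_has_derivative:
  "smooth_in U f \<Longrightarrow> x \<in> U \<Longrightarrow> (f has_derivative frechet_derivative f (at x)) (at x)"
  unfolding smooth_in_def using differentiable_upto_Suc_has_derivative by blast

lemma smooth_in_frechet_derivative: "smooth_in U f \<Longrightarrow> smooth_in U (\<lambda>x. frechet_derivative f (at x) v)"
  unfolding smooth_in_def by (metis differentiable_upto.simps(2))

lemma smooth_in_continuous_on: "smooth_in U f \<Longrightarrow> continuous_on U f"
  unfolding smooth_in_def using differentiable_upto.simps(1) by blast

lemma smooth_in_const: "open U \<Longrightarrow> smooth_in U (\<lambda>x. c)"
  by (simp add: smooth_in_def differentiable_upto_const)

lemma smooth_in_linear: "open U \<Longrightarrow> bounded_linear L \<Longrightarrow> smooth_in U L"
  by (simp add: smooth_in_def differentiable_upto_linear)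

lemma smooth_in_bounded_linear: "bounded_linear L \<Longrightarrow> smooth_in U f \<Longrightarrow> smooth_in U (\<lambda>x. L (f x))"
  by (simp add: smooth_in_def differentiable_upto_bounded_linear)

lemma smooth_in_add: "smooth_in U f \<Longrightarrow> smooth_in U g \<Longrightarrow> smooth_in U (\<lambda>x. f x + g x)"
  by (simp add: smooth_in_def differentiable_upto_add)

lemma smooth_in_bilinear:
  "bounded_bilinear B \<Longrightarrow> smooth_in U f \<Longrightarrow> smooth_in U g \<Longrightarrow> smooth_in U (\<lambda>x. B (f x) (g x))"
  by (simp add: smooth_in_def differentiable_upto_bilinear)

lemmas smooth_in_mult = smooth_in_bilinear[OF bounded_bilinear_mult]
lemmas smooth_in_scaleR = smooth_in_bilinear[OF bounded_bilinear_scaleR]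
lemmas smooth_in_inner = smooth_in_bilinear[OF bounded_bilinear_inner]

lemma smooth_in_uminus: "smooth_in U f \<Longrightarrow> smooth_in U (\<lambda>x. - f x)"
  by (rule smooth_in_bounded_linear[OF bounded_linear_minus[OF bounded_linear_ident]])

lemma smooth_in_diff: "smooth_in U f \<Longrightarrow> smooth_in U g \<Longrightarrow> smooth_in U (\<lambda>x. f x - g x)"
  using smooth_in_add[OF _ smooth_in_uminus] by fastforce

lemma smooth_in_power: 
  fixes f :: "'a::real_normed_vector \<Rightarrow> 'b::{real_normed_algebra_1}"
  shows "smooth_in U f \<Longrightarrow> smooth_in U (\<lambda>x. f x ^ n)"
  by (induction n) (auto intro: smooth_in_mult smooth_in_const smooth_in_open)

lemma smooth_in_compose_real:
  fixes f :: "'a::real_normed_vector \<Rightarrow> real" and g :: "real \<Rightarrow> 'b::real_normed_vector"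
  shows "smooth_in V g \<Longrightarrow> smooth_in U f \<Longrightarrow> (\<And>x. x \<in> U \<Longrightarrow> f x \<in> V) \<Longrightarrow> smooth_in U (\<lambda>x. g (f x))"
  unfolding smooth_in_def by (auto intro: differentiable_upto_compose_real)

lemma smooth_in_fst: "open U \<Longrightarrow> smooth_in U fst"
  by (simp add: smooth_in_linear bounded_linear_fst)

lemma smooth_in_snd: "open U \<Longrightarrow> smooth_in U snd"
  by (simp add: smooth_in_linear bounded_linear_snd)

lemma smooth_in_ident: "open U \<Longrightarrow> smooth_in U (\<lambda>x. x)"
  by (simp add: smooth_in_linear bounded_linear_ident)

lemma smooth_in_slice:
  fixes g :: "'a::real_normed_vector \<times> 'c::real_normed_vector \<Rightarrow> 'b::real_normed_vector"
  assumes "smooth_in U g" "\<And>x. x \<in> V \<Longrightarrow> (t, x) \<in> U" "open V"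
  shows "smooth_in V (\<lambda>x. g (t, x))"
proof -
  have "bounded_linear (\<lambda>x::'c. (0::'a, x))"
    by (intro bounded_linear_Pair bounded_linear_zero bounded_linear_ident)
  then show ?thesis
  using differentiable_upto_affine[of "\<lambda>x. (0, x)" V U "(t, 0)"] assms
  unfolding smooth_in_def by auto
qed

lemma differentiable_upto_Suc_real:
  fixes f :: "real \<Rightarrow> 'b::real_normed_vector"
  assumes "open U" "\<And>x. x \<in> U \<Longrightarrow> (f has_vector_derivative f' x) (at x)" "differentiable_upto n U f'"
  shows "differentiable_upto (Suc n) U f"
  by (rule differentiable_upto_SucI[where F="\<lambda>x v. v *\<^sub>R f' x"])
    (use assms in \<open>auto simp: has_vector_derivative_def intro: differentiable_upto_bounded_linear bounded_linear_scaleR_right\<close>)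

lemma smooth_in_vector_derivative:
  fixes f :: "real \<Rightarrow> 'b::real_normed_vector"
  assumes "smooth_in U f"
  shows "x \<in> U \<Longrightarrow> (f has_vector_derivative vector_derivative f (at x)) (at x)"
    and "smooth_in U (\<lambda>x. vector_derivative f (at x))"
proof -
  have *: "(f has_vector_derivative frechet_derivative f (at x) 1) (at x)" if "x \<in> U" for x
  proof -
    have "linear (frechet_derivative f (at x))"
      using has_derivative_linear[OF smooth_in_has_derivative[OF assms that]] .
    then have "frechet_derivative f (at x) (s *\<^sub>R 1) = s *\<^sub>R frechet_derivative f (at x) 1" for s
      by (rule linear_scale)
    then have "frechet_derivative f (at x) = (\<lambda>s. s *\<^sub>R frechet_derivative f (at x) 1)"
      unfolding real_scaleR_def mult_1_right by (rule ext)
    with smooth_in_has_derivative[OF assms that]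
    have "(f has_derivative (\<lambda>s. s *\<^sub>R frechet_derivative f (at x) 1)) (at x)" by (rule subst[rotated])
    then show ?thesis unfolding has_vector_derivative_def .
  qed
  then have eq: "frechet_derivative f (at x) 1 = vector_derivative f (at x)" if "x \<in> U" for x
    using that vector_derivative_at by metis
  show "x \<in> U \<Longrightarrow> (f has_vector_derivative vector_derivative f (at x)) (at x)" using * eq by simp
  show "smooth_in U (\<lambda>x. vector_derivative f (at x))"
    by (rule smooth_in_cong[OF smooth_in_frechet_derivative[OF assms, of 1]]) (simp add: eq)
qed

lemma smooth_in_powr: "smooth_in {0<..} (\<lambda>x::real. x powr a)"
proof -
  have "differentiable_upto n {0<..} (\<lambda>x::real. x powr a)" for n
  proof (induction n arbitrary: a)
    case 0 show ?case by (auto intro!: continuous_intros)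
  next
    case (Suc n)
    show ?case
    proof (rule differentiable_upto_Suc_real[where f'="\<lambda>x. a * x powr (a - 1)"])
      show "differentiable_upto n {0<..} (\<lambda>x. a * x powr (a - 1))"
        by (intro differentiable_upto_bilinear[OF bounded_bilinear_mult] differentiable_upto_const Suc) auto
      fix x :: real assume "x \<in> {0<..}"
      then show "((\<lambda>x. x powr a) has_vector_derivative a * x powr (a - 1)) (at x)"
        using has_real_derivative_powr[of x a] by (simp add: has_real_derivative_iff_has_vector_derivative)
    qed auto
  qed
  then show ?thesis by (simp add: smooth_in_def)
qed

lemma smooth_in_sin_cos: "smooth_in UNIV (sin::real \<Rightarrow> real)" "smooth_in UNIV (cos::real \<Rightarrow> real)"
proof -
  have "differentiable_upto n UNIV (sin::real \<Rightarrow> real) \<and> differentiable_upto n UNIV (cos::real \<Rightarrow> real)" for n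
  proof (induction n)
    case 0 show ?case by (auto intro!: continuous_intros)
  next
    case (Suc n)
    have "differentiable_upto n UNIV (\<lambda>x::real. - sin x)"
      using Suc differentiable_upto_bounded_linear[OF _ bounded_linear_minus[OF bounded_linear_ident]] by auto
    moreover have "(sin has_vector_derivative cos x) (at x)" "(cos has_vector_derivative - sin x) (at x)" for x :: real
      using DERIV_sin[of x] DERIV_cos[of x] by (simp_all add: has_real_derivative_iff_has_vector_derivative)
    ultimately show ?case
      using Suc differentiable_upto_Suc_real[of UNIV sin cos n] differentiable_upto_Suc_real[of UNIV cos "\<lambda>x. - sin x" n] by blast
  qed
  then show "smooth_in UNIV (sin::real \<Rightarrow> real)" "smooth_in UNIV (cos::real \<Rightarrow> real)" by (auto simp: smooth_in_def)
qed

lemma smooth_in_realI: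
  fixes f :: "real \<Rightarrow> 'b::real_normed_vector"
  assumes "\<And>x. x \<in> U \<Longrightarrow> (f has_vector_derivative f' x) (at x)" "smooth_in U f'"
  shows "smooth_in U f"
proof -
  have "differentiable_upto n U f" for n
    using differentiable_upto_Suc_imp[OF differentiable_upto_Suc_real[of U f f' n]] assms unfolding smooth_in_def by blast
  then show ?thesis using assms(2) unfolding smooth_in_def by blast
qed

lemma smooth_in_arcsin: "smooth_in {-1<..<1} arcsin"
proof (rule smooth_in_realI[where f'="\<lambda>x. (1 - x^2) powr (-1/2)"])
  fix x :: real assume x: "x \<in> {-1<..<1}"
  then have "x^2 < 1" by (auto simp: abs_square_less_1)
  moreover have "(arcsin has_real_derivative inverse (sqrt (1 - x^2))) (at x)"
    using x by (intro DERIV_arcsin) auto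
  ultimately show "(arcsin has_vector_derivative (1 - x^2) powr (-1/2)) (at x)"
    by (simp add: powr_minus powr_half_sqrt has_real_derivative_iff_has_vector_derivative)
next
  show "smooth_in {-1<..<1} (\<lambda>x::real. (1 - x^2) powr (-1/2))"
    by (rule smooth_in_compose_real[OF smooth_in_powr])
      (auto intro!: smooth_in_diff smooth_in_const smooth_in_power smooth_in_ident simp: abs_square_less_1)
qed

section \<open>Paths of immersions in coordinates\<close>

lemma smooth_in_partial_derivative:
  fixes g :: "real \<times> real \<Rightarrow> 'b::real_normed_vector"
  assumes "smooth_in U g" "(t, x) \<in> U"
  shows "((\<lambda>s. g (s, x)) has_vector_derivative frechet_derivative g (at (t, x)) (1, 0)) (at t)"
    and "((\<lambda>y. g (t, y)) has_vector_derivative frechet_derivative g (at (t, x)) (0, 1)) (at x)"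
proof -
  let ?D = "frechet_derivative g (at (t, x))"
  have D: "(g has_derivative ?D) (at (t, x))"
    using smooth_in_has_derivative[OF assms] .
  have lin: "linear ?D" using has_derivative_linear[OF D] .
  have "((\<lambda>s. (s, x)) has_derivative (\<lambda>s. (s, 0))) (at t)"
    by (auto intro!: derivative_eq_intros)
  from has_derivative_compose[OF this D]
  have "((\<lambda>s. g (s, x)) has_derivative (\<lambda>s. ?D (s, 0))) (at t)" .
  moreover have "(\<lambda>s. ?D (s, 0)) = (\<lambda>s. s *\<^sub>R ?D (1, 0))"
  proof
    fix s show "?D (s, 0) = s *\<^sub>R ?D (1, 0)" using linear_scale[OF lin, of s "(1, 0)"] unfolding scaleR_Pair by simp
  qed
  ultimately show "((\<lambda>s. g (s, x)) has_vector_derivative ?D (1, 0)) (at t)"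
    unfolding has_vector_derivative_def by argo
  have "((\<lambda>s. (t, s)) has_derivative (\<lambda>s. (0, s))) (at x)"
    by (auto intro!: derivative_eq_intros)
  from has_derivative_compose[OF this D]
  have "((\<lambda>s. g (t, s)) has_derivative (\<lambda>s. ?D (0, s))) (at x)" .
  moreover have "(\<lambda>s. ?D (0, s)) = (\<lambda>s. s *\<^sub>R ?D (0, 1))"
  proof
    fix s show "?D (0, s) = s *\<^sub>R ?D (0, 1)" using linear_scale[OF lin, of s "(0, 1)"] unfolding scaleR_Pair by simp
  qed
  ultimately show "((\<lambda>s. g (t, s)) has_vector_derivative ?D (0, 1)) (at x)"
    unfolding has_vector_derivative_def by argo
qed

text \<open>Recover \<open>g\<close> from its second partial derivative by integration and differentiate under the integral
  sign: the first partial derivative is then an integral whose derivative in the second variable can be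
  read off.\<close>

lemma mixed_partials_commute:
  fixes g :: "real \<times> real \<Rightarrow> 'b::banach"
  assumes g: "smooth_in U g" and U: "(t0, x0) \<in> U"
  shows "frechet_derivative (\<lambda>z. frechet_derivative g (at z) (0, 1)) (at (t0, x0)) (1, 0) =
         frechet_derivative (\<lambda>z. frechet_derivative g (at z) (1, 0)) (at (t0, x0)) (0, 1)"
proof -
  define D1 where "D1 = (\<lambda>z. frechet_derivative g (at z) (1, 0))"
  define D2 where "D2 = (\<lambda>z. frechet_derivative g (at z) (0, 1))"
  define D12 where "D12 = (\<lambda>z. frechet_derivative D2 (at z) (1, 0))"
  define D21 where "D21 = (\<lambda>z. frechet_derivative D1 (at z) (0, 1))"
  have D1: "smooth_in U D1" and D2: "smooth_in U D2"
    unfolding D1_def D2_def using smooth_in_frechet_derivative[OF g] by auto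
  have D12: "smooth_in U D12" 
    unfolding D12_def using smooth_in_frechet_derivative[OF D2] by auto
  have g_part: "((\<lambda>s. g (s, x)) has_vector_derivative D1 (t, x)) (at t)"
    "((\<lambda>y. g (t, y)) has_vector_derivative D2 (t, x)) (at x)" if "(t, x) \<in> U" for t x
    using smooth_in_partial_derivative[OF g that] by (simp_all add: D1_def D2_def)
  obtain A B where AB: "open A" "open B" "t0 \<in> A" "x0 \<in> B" "A \<times> B \<subseteq> U"
    using open_prod_elim[OF smooth_in_open[OF g] U] by (metis mem_Sigma_iff)
  obtain d1 where d1: "d1 > 0" "cball t0 d1 \<subseteq> A" using AB open_contains_cball by blast
  obtain d2 where d2: "d2 > 0" "cball x0 d2 \<subseteq> B" using AB open_contains_cball by blast
  define I where "I = {t0 - d1..t0 + d1}"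
  define J where "J = {x0 - d2..x0 + d2}"
  have IJ: "I \<times> J \<subseteq> U" using d1 d2 AB(5) unfolding I_def J_def
    by (auto simp: cball_eq_atLeastAtMost)
  have t0: "t0 \<in> I" using d1 by (simp add: I_def)
  have x0: "x0 \<in> J" using d2 by (simp add: J_def)
  have int_eq: "D1 (t0, y) = D1 (t0, x0 - d2) + integral {x0 - d2..y} (\<lambda>x. D12 (t0, x))"
    if y: "y \<in> J" for y
  proof -
    have sub: "{x0 - d2..y} \<subseteq> J" using y by (auto simp: J_def)
    have low: "x0 - d2 \<le> y" "x0 - d2 \<in> J" using y d2 by (auto simp: J_def)
    have 1: "g (t, y) = g (t, x0 - d2) + integral {x0 - d2..y} (\<lambda>x. D2 (t, x))" if t: "t \<in> I" for t
    proof -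
      have "((\<lambda>x. D2 (t, x)) has_integral (g (t, y) - g (t, x0 - d2))) {x0 - d2..y}"
      proof (rule fundamental_theorem_of_calculus)
        fix x assume "x \<in> {x0 - d2..y}"
        then have "(t, x) \<in> U" using sub IJ t by auto
        from g_part(2)[OF this] show "((\<lambda>x. g (t, x)) has_vector_derivative D2 (t, x)) (at x within {x0 - d2..y})"
          by (rule has_vector_derivative_at_within)
      qed (use low in auto)
      then show ?thesis by (simp add: integral_unique)
    qed
    have cD12: "continuous_on (I \<times> {x0 - d2..y}) D12"
      by (rule continuous_on_subset[OF smooth_in_continuous_on[OF D12]]) (use IJ sub in auto)
    have "((\<lambda>t. integral (cbox (x0 - d2) y) (\<lambda>x. D2 (t, x))) has_vector_derivative
        integral (cbox (x0 - d2) y) (\<lambda>x. D12 (t0, x))) (at t0 within I)"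
    proof (rule leibniz_rule_vector_derivative)
      fix t x assume "t \<in> I" "x \<in> cbox (x0 - d2) y"
      then have "(t, x) \<in> U" using IJ sub by auto
      from smooth_in_partial_derivative(1)[OF D2 this]
      show "((\<lambda>t. D2 (t, x)) has_vector_derivative D12 (t, x)) (at t within I)"
        unfolding D12_def by (rule has_vector_derivative_at_within)
    next
      fix t assume "t \<in> I"
      then have "(\<lambda>x. (t, x)) ` {x0 - d2..y} \<subseteq> U" using IJ sub by auto
      then have "continuous_on {x0 - d2..y} (\<lambda>x. D2 (t, x))"
        by (intro continuous_on_compose2[OF smooth_in_continuous_on[OF D2], of _ "\<lambda>x. (t, x)"])
          (auto intro!: continuous_intros)
      then show "(\<lambda>x. D2 (t, x)) integrable_on cbox (x0 - d2) y"
        by (simp add: integrable_continuous_real)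
    qed (use cD12 t0 in \<open>auto simp: I_def case_prod_unfold\<close>)
    moreover have "(t0, x0 - d2) \<in> U" using IJ t0 low by auto
    note has_vector_derivative_at_within[OF g_part(1)[OF this], of I]
    ultimately have "((\<lambda>t. g (t, x0 - d2) + integral {x0 - d2..y} (\<lambda>x. D2 (t, x))) has_vector_derivative
        D1 (t0, x0 - d2) + integral {x0 - d2..y} (\<lambda>x. D12 (t0, x))) (at t0 within I)"
      by (simp only: cbox_interval) (rule has_vector_derivative_add; assumption)
    then have "((\<lambda>t. g (t, y)) has_vector_derivative
        D1 (t0, x0 - d2) + integral {x0 - d2..y} (\<lambda>x. D12 (t0, x))) (at t0 within I)"
      using has_vector_derivative_transform[of t0 I "\<lambda>t. g (t, y)"
        "\<lambda>t. g (t, x0 - d2) + integral {x0 - d2..y} (\<lambda>x. D2 (t, x))", OF t0 1] by blast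
    then have 2: "((\<lambda>t. g (t, y)) has_vector_derivative
        D1 (t0, x0 - d2) + integral {x0 - d2..y} (\<lambda>x. D12 (t0, x))) (at t0)"
      using d1 by (simp add: I_def at_within_Icc_at)
    have "(t0, y) \<in> U" using IJ t0 y by auto
    from vector_derivative_unique_at[OF 2 g_part(1)[OF this]] show ?thesis by simp
  qed
  have "continuous_on J (\<lambda>x. D12 (t0, x))"
    by (intro continuous_on_compose2[OF smooth_in_continuous_on[OF D12], of _ "\<lambda>x. (t0, x)"])
      (use IJ t0 in \<open>auto intro!: continuous_intros\<close>)
  then have "((\<lambda>y. integral {x0 - d2..y} (\<lambda>x. D12 (t0, x))) has_vector_derivative D12 (t0, x0)) (at x0 within J)"
    unfolding J_def by (rule integral_has_vector_derivative) (use d2 in auto)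
  then have "((\<lambda>y. D1 (t0, x0 - d2) + integral {x0 - d2..y} (\<lambda>x. D12 (t0, x))) has_vector_derivative 
      0 + D12 (t0, x0)) (at x0 within J)"
    by (intro has_vector_derivative_add has_vector_derivative_const)
  then have "((\<lambda>y. D1 (t0, y)) has_vector_derivative 0 + D12 (t0, x0)) (at x0 within J)"
    using has_vector_derivative_transform[of x0 J "\<lambda>y. D1 (t0, y)"
        "\<lambda>y. D1 (t0, x0 - d2) + integral {x0 - d2..y} (\<lambda>x. D12 (t0, x))", OF x0 int_eq] by blast
  then have "((\<lambda>y. D1 (t0, y)) has_vector_derivative D12 (t0, x0)) (at x0)"
    using d2 by (simp add: J_def at_within_Icc_at)
  from vector_derivative_unique_at[OF this smooth_in_partial_derivative(2)[OF D1 U]]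
  show ?thesis by (simp add: D12_def D1_def D2_def)
qed

text \<open>The data of a path of immersions \<open>p\<close> up to second order; \<open>pt\<close> and \<open>px\<close> are the partial
  derivatives in time and angle, \<open>ptx\<close> and \<open>pxx\<close> those of \<open>px\<close>. Derivatives in time are one-sided at
  \<open>0\<close> and \<open>1\<close>. Total derivatives are recorded as well, because \<open>p\<close> and \<open>px\<close> are followed along moving
  points and null sets are pulled back by \<open>p\<close>.\<close>

locale loop_homotopy =
  fixes p pt px ptx pxx :: "real \<Rightarrow> real \<Rightarrow> complex"
  assumes deriv_t: "\<And>t x. t \<in> {0..1} \<Longrightarrow> ((\<lambda>s. p s x) has_vector_derivative pt t x) (at t within {0..1})"
    and deriv_x: "\<And>t x. t \<in> {0..1} \<Longrightarrow> (p t has_vector_derivative px t x) (at x)"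
    and deriv_x_t: "\<And>t x. t \<in> {0..1} \<Longrightarrow> ((\<lambda>s. px s x) has_vector_derivative ptx t x) (at t within {0..1})"
    and deriv_t_x: "\<And>t x. t \<in> {0..1} \<Longrightarrow> (pt t has_vector_derivative ptx t x) (at x)"
    and deriv_x_x: "\<And>t x. t \<in> {0..1} \<Longrightarrow> (px t has_vector_derivative pxx t x) (at x)"
    and deriv_total: "\<And>t x. t \<in> {0..1} \<Longrightarrow> ((\<lambda>z. p (fst z) (snd z)) has_derivative
        (\<lambda>v. fst v *\<^sub>R pt t x + snd v *\<^sub>R px t x)) (at (t, x) within {0..1} \<times> UNIV)"
    and deriv_total_x: "\<And>t x. t \<in> {0..1} \<Longrightarrow> ((\<lambda>z. px (fst z) (snd z)) has_derivative
        (\<lambda>v. fst v *\<^sub>R ptx t x + snd v *\<^sub>R pxx t x)) (at (t, x) within {0..1} \<times> UNIV)"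
    and cont: "continuous_on ({0..1} \<times> UNIV) (\<lambda>z. p (fst z) (snd z))"
      "continuous_on ({0..1} \<times> UNIV) (\<lambda>z. pt (fst z) (snd z))"
      "continuous_on ({0..1} \<times> UNIV) (\<lambda>z. px (fst z) (snd z))"
      "continuous_on ({0..1} \<times> UNIV) (\<lambda>z. ptx (fst z) (snd z))"
      "continuous_on ({0..1} \<times> UNIV) (\<lambda>z. pxx (fst z) (snd z))"
    and periodic: "\<And>t x. t \<in> {0..1} \<Longrightarrow> p t (x + 2 * pi) = p t x"
    and immersed: "\<And>t x. t \<in> {0..1} \<Longrightarrow> px t x \<noteq> 0"

lemma imm_path_loop_homotopy:
  assumes "imm_path p"
  obtains pt px ptx pxx where "loop_homotopy p pt px ptx pxx"
proof -
  have "smooth_on ({0..1} \<times> UNIV) (\<lambda>(t, x). p t x)" using assms unfolding imm_path_def by (rule conjunct1)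
  then obtain U g where 0: "open U \<and> {0..1} \<times> UNIV \<subseteq> U \<and>
      (\<forall>z\<in>{0..1} \<times> UNIV. g z = (case z of (t, x) \<Rightarrow> p t x)) \<and> (\<forall>n. differentiable_upto n U g)"
    unfolding smooth_on_def by (elim exE)
  note 1 = conjunct1[OF 0] conjunct1[OF conjunct2[OF 0]] conjunct1[OF conjunct2[OF conjunct2[OF 0]]]
    conjunct2[OF conjunct2[OF conjunct2[OF 0]]]
  have gp: "g (t, x) = p t x" if "t \<in> {0..1}" for t x
  proof -
    have "(t, x) \<in> {0..1} \<times> UNIV" using that by blast
    from bspec[OF 1(3) this] show "g (t, x) = p t x" unfolding prod.case .
  qed
  note U = 1(1,2) gp
  have g: "smooth_in U g" unfolding smooth_in_def by (intro conjI 1)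
  define D1 where "D1 = (\<lambda>z. frechet_derivative g (at z) (1, 0))"
  define D2 where "D2 = (\<lambda>z. frechet_derivative g (at z) (0, 1))"
  define D12 where "D12 = (\<lambda>z. frechet_derivative D2 (at z) (1, 0))"
  define D22 where "D22 = (\<lambda>z. frechet_derivative D2 (at z) (0, 1))"
  have D1: "smooth_in U D1" and D2: "smooth_in U D2"
    unfolding D1_def D2_def using smooth_in_frechet_derivative[OF g] by auto
  have D12: "smooth_in U D12" and D22: "smooth_in U D22"
    unfolding D12_def D22_def using smooth_in_frechet_derivative[OF D2] by auto
  have cont: "continuous_on ({0..1} \<times> UNIV) f" if "smooth_in U f" for f :: "real \<times> real \<Rightarrow> complex"
    using continuous_on_subset[OF smooth_in_continuous_on[OF that] U(2)] .
  have UI: "(t, x) \<in> U" if "t \<in> {0..1}" for t x using U(2) that by auto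
  have "loop_homotopy p (\<lambda>t x. D1 (t, x)) (\<lambda>t x. D2 (t, x)) (\<lambda>t x. D12 (t, x)) (\<lambda>t x. D22 (t, x))"
  proof
    fix t x :: real assume t: "t \<in> {0..1}"
    note u = UI[OF t]
    have "((\<lambda>s. g (s, x)) has_vector_derivative D1 (t, x)) (at t within {0..1})"
      unfolding D1_def by (rule has_vector_derivative_at_within[OF smooth_in_partial_derivative(1)[OF g u]])
    then show "((\<lambda>s. p s x) has_vector_derivative D1 (t, x)) (at t within {0..1})"
      by (rule has_vector_derivative_transform[OF t, rotated]) (use U(3) in simp)
    have pt: "p t = (\<lambda>x. g (t, x))" using U(3)[OF t] by auto
    show px: "(p t has_vector_derivative D2 (t, x)) (at x)"
      unfolding D2_def pt by (rule smooth_in_partial_derivative(2)[OF g u])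
    show "((\<lambda>s. D2 (s, x)) has_vector_derivative D12 (t, x)) (at t within {0..1})"
      unfolding D12_def by (rule has_vector_derivative_at_within[OF smooth_in_partial_derivative(1)[OF D2 u]])
    show "((\<lambda>x. D1 (t, x)) has_vector_derivative D12 (t, x)) (at x)"
      using smooth_in_partial_derivative(2)[OF D1 u] mixed_partials_commute[OF g u]
      by (simp add: D12_def D1_def D2_def)
    show "((\<lambda>x. D2 (t, x)) has_vector_derivative D22 (t, x)) (at x)"
      unfolding D22_def by (rule smooth_in_partial_derivative(2)[OF D2 u])
    have total: "(f has_derivative (\<lambda>v. fst v *\<^sub>R frechet_derivative f (at (t, x)) (1, 0) +
        snd v *\<^sub>R frechet_derivative f (at (t, x)) (0, 1))) (at (t, x) within {0..1} \<times> UNIV)"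
      if "smooth_in U f" for f :: "real \<times> real \<Rightarrow> complex"
    proof -
      have D: "(f has_derivative frechet_derivative f (at (t, x))) (at (t, x))"
        by (rule smooth_in_has_derivative[OF that u])
      have "frechet_derivative f (at (t, x)) v = fst v *\<^sub>R frechet_derivative f (at (t, x)) (1, 0) +
        snd v *\<^sub>R frechet_derivative f (at (t, x)) (0, 1)" for v
      proof -
        have "frechet_derivative f (at (t, x)) (fst v *\<^sub>R (1, 0) + snd v *\<^sub>R (0, 1)) =
          fst v *\<^sub>R frechet_derivative f (at (t, x)) (1, 0) + snd v *\<^sub>R frechet_derivative f (at (t, x)) (0, 1)"
          unfolding linear_add[OF has_derivative_linear[OF D]] linear_scale[OF has_derivative_linear[OF D]] ..
        then show ?thesis by simp
      qed
      then have "frechet_derivative f (at (t, x)) = (\<lambda>v. fst v *\<^sub>R frechet_derivative f (at (t, x)) (1, 0) +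
        snd v *\<^sub>R frechet_derivative f (at (t, x)) (0, 1))" by (rule ext)
      with has_derivative_at_withinI[OF D, of "{0..1} \<times> UNIV"] show ?thesis by (rule subst[rotated])
    qed
    have "(g has_derivative (\<lambda>v. fst v *\<^sub>R D1 (t, x) + snd v *\<^sub>R D2 (t, x))) (at (t, x) within {0..1} \<times> UNIV)"
      using total[OF g] unfolding D1_def D2_def .
    then show "((\<lambda>z. p (fst z) (snd z)) has_derivative (\<lambda>v. fst v *\<^sub>R D1 (t, x) + snd v *\<^sub>R D2 (t, x)))
        (at (t, x) within {0..1} \<times> UNIV)"
      by (rule has_derivative_transform[rotated 2]) (use t U(3) in auto)
    show "((\<lambda>z. D2 (fst z, snd z)) has_derivative (\<lambda>v. fst v *\<^sub>R D12 (t, x) + snd v *\<^sub>R D22 (t, x)))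
        (at (t, x) within {0..1} \<times> UNIV)"
      using total[OF D2] unfolding D12_def D22_def by simp
    have imm: "p t \<in> Imm" using assms t by (auto simp: imm_path_def)
    then show "p t (x + 2 * pi) = p t x" by (simp add: Imm_def)
    show "D2 (t, x) \<noteq> 0" using imm vector_derivative_at[OF px] by (auto simp: Imm_def)
  next
    show "continuous_on ({0..1} \<times> UNIV) (\<lambda>z. p (fst z) (snd z))"
      by (rule continuous_on_eq[OF cont[OF g]]) (use U(3) in auto)
  qed (use cont[OF D1] cont[OF D2] cont[OF D12] cont[OF D22] in simp_all)
  then show ?thesis by (rule that)
qed

section \<open>Stokes' theorem for the homotopy and winding numbers\<close>

context loop_homotopy
begin

definition J :: "real \<Rightarrow> real \<Rightarrow> real" where
  "J t x = Im (cnj (pt t x) * px t x)"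

lemma periodic_derivs:
  assumes t: "t \<in> {0..1}"
  shows "pt t (x + 2 * pi) = pt t x" and "px t (x + 2 * pi) = px t x"
    and "ptx t (x + 2 * pi) = ptx t x" and "pxx t (x + 2 * pi) = pxx t x"
proof -
  have uniq: "a = b" if "(f has_vector_derivative a) (at s within {0..1})"
    "(f has_vector_derivative b) (at s within {0..1})" "s \<in> {0..1}" for f :: "real \<Rightarrow> complex" and a b s
  proof (rule vector_derivative_unique_within[OF _ that(1,2)])
    show "at s within {0..1} \<noteq> bot" using that(3) by (auto simp: trivial_limit_within islimpt_Icc)
  qed
  have *: "f (x + 2 * pi) = f x" if "\<And>x. (F has_vector_derivative f x) (at x)" "\<And>x. F (x + 2 * pi) = F x"
    for f F :: "real \<Rightarrow> complex" and x
  proof -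
    have "((\<lambda>x. F (x + 2 * pi)) has_vector_derivative 1 *\<^sub>R f (x + 2 * pi)) (at x)"
      by (rule vector_diff_chain_at[of "\<lambda>x. x + 2 * pi" 1 x F, unfolded o_def])
        (auto intro!: derivative_eq_intros that(1))
    then have "(F has_vector_derivative f (x + 2 * pi)) (at x)" by (simp add: that(2))
    from vector_derivative_unique_at[OF this that(1)] show ?thesis .
  qed
  have pt: "pt t (x + 2 * pi) = pt t x" if t: "t \<in> {0..1}" for t x
  proof (rule uniq[OF _ deriv_t[OF t] t])
    show "((\<lambda>s. p s x) has_vector_derivative pt t (x + 2 * pi)) (at t within {0..1})"
      by (rule has_vector_derivative_transform[OF t _ deriv_t[OF t]]) (simp add: periodic)
  qed
  then show "pt t (x + 2 * pi) = pt t x" using t .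
  have px: "px t (x + 2 * pi) = px t x" if t: "t \<in> {0..1}" for t x
    using *[where F="p t" and f="px t", OF deriv_x[OF t] periodic[OF t]] .
  show "px t (x + 2 * pi) = px t x" by (rule px[OF t])
  show "ptx t (x + 2 * pi) = ptx t x" using *[where F="pt t" and f="ptx t", OF deriv_t_x[OF t] pt[OF t]] .
  show "pxx t (x + 2 * pi) = pxx t x" using *[where F="px t" and f="pxx t", OF deriv_x_x[OF t] px[OF t]] .
qed

lemma continuous_slices:
  assumes t: "t \<in> {0..1}"
  shows "continuous_on X (p t)" "continuous_on X (pt t)" "continuous_on X (px t)"
    "continuous_on X (ptx t)" "continuous_on X (pxx t)"
proof -
  have *: "continuous_on X (f t)" if "continuous_on ({0..1} \<times> UNIV) (\<lambda>z. f (fst z) (snd z))"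
    for f :: "real \<Rightarrow> real \<Rightarrow> complex"
  proof -
    have "continuous_on X (\<lambda>x. (\<lambda>z. f (fst z) (snd z)) (t, x))"
      by (rule continuous_on_compose2[OF that]) (use t in \<open>auto intro!: continuous_intros\<close>)
    then show ?thesis by simp
  qed
  show "continuous_on X (p t)" "continuous_on X (pt t)" "continuous_on X (px t)"
    "continuous_on X (ptx t)" "continuous_on X (pxx t)" by (rule * cont)+
qed

lemma continuous_box:
  "continuous_on ({0..1} \<times> X) (\<lambda>z. p (fst z) (snd z))"
  "continuous_on ({0..1} \<times> X) (\<lambda>z. pt (fst z) (snd z))"
  "continuous_on ({0..1} \<times> X) (\<lambda>z. px (fst z) (snd z))"
  "continuous_on ({0..1} \<times> X) (\<lambda>z. ptx (fst z) (snd z))"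
  "continuous_on ({0..1} \<times> X) (\<lambda>z. pxx (fst z) (snd z))"
  by (rule continuous_on_subset[OF cont(1)] continuous_on_subset[OF cont(2)] continuous_on_subset[OF cont(3)]
      continuous_on_subset[OF cont(4)] continuous_on_subset[OF cont(5)], force)+

lemma continuous_box_J: "continuous_on ({0..1} \<times> X) (\<lambda>z. J (fst z) (snd z))"
  unfolding J_def by (intro continuous_intros continuous_box)

lemma continuous_slice_J: "t \<in> {0..1} \<Longrightarrow> continuous_on X (J t)"
  unfolding J_def by (intro continuous_intros continuous_slices)

text \<open>Differentiate the contour integral of \<open>h dz\<close> in \<open>t\<close> and subtract the angular derivative of
  \<open>h (p t x) * pt t x\<close>, whose integral over a period vanishes. The holomorphic part \<open>\<alpha>\<close> of the derivative of
  \<open>h\<close> cancels; \<open>\<beta>\<close> remains, multiplied by \<open>2 * \<i> * J\<close>.\<close>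

lemma stokes:
  assumes h: "\<And>z. (h has_derivative (\<lambda>v. \<alpha> z * v + \<beta> z * cnj v)) (at z)"
    and c: "continuous_on UNIV \<alpha>" "continuous_on UNIV \<beta>"
  shows "((\<lambda>t. integral {0..2 * pi} (\<lambda>x. 2 * \<i> * \<beta> (p t x) * of_real (J t x))) has_integral
    integral {0..2 * pi} (\<lambda>x. h (p 1 x) * px 1 x) - integral {0..2 * pi} (\<lambda>x. h (p 0 x) * px 0 x)) {0..1}"
proof (rule fundamental_theorem_of_calculus)
  have ch: "continuous_on UNIV h"
    by (rule continuous_at_imp_continuous_on) (use has_derivative_continuous[OF h] in simp)
  have cc: "continuous_on X (\<lambda>z. k (f z))" if "continuous_on UNIV k" "continuous_on X f" 
    for k :: "complex \<Rightarrow> complex" and f :: "'z::topological_space \<Rightarrow> complex" and X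
    by (rule continuous_on_compose2[OF that]) simp
  fix t :: real assume t: "t \<in> {0..1}"
  define D where "D = (\<lambda>t x. h (p t x) * ptx t x + (\<alpha> (p t x) * pt t x + \<beta> (p t x) * cnj (pt t x)) * px t x)"
  define E where "E = (\<lambda>x. h (p t x) * ptx t x + (\<alpha> (p t x) * px t x + \<beta> (p t x) * cnj (px t x)) * pt t x)"
  have deriv: "((\<lambda>t. integral (cbox 0 (2 * pi)) (\<lambda>x. h (p t x) * px t x)) has_vector_derivative
      integral (cbox 0 (2 * pi)) (D t)) (at t within {0..1})"
  proof (rule leibniz_rule_vector_derivative)
    fix t x :: real assume t: "t \<in> {0..1}"
    have "((\<lambda>t. h (p t x)) has_derivative (\<lambda>s. \<alpha> (p t x) * (s *\<^sub>R pt t x) + \<beta> (p t x) * cnj (s *\<^sub>R pt t x))) (at t within {0..1})"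
      by (rule has_derivative_compose[OF deriv_t[OF t, unfolded has_vector_derivative_def] h])
    then have "((\<lambda>t. h (p t x)) has_vector_derivative \<alpha> (p t x) * pt t x + \<beta> (p t x) * cnj (pt t x)) (at t within {0..1})"
      unfolding has_vector_derivative_def by (rule back_subst[where P="\<lambda>F. (_ has_derivative F) _"])
        (auto simp: algebra_simps)
    from has_vector_derivative_mult[OF this deriv_x_t[OF t]]
    show "((\<lambda>t. h (p t x) * px t x) has_vector_derivative D t x) (at t within {0..1})"
      unfolding D_def .
  next
    fix t :: real assume "t \<in> {0..1}"
    then show "(\<lambda>x. h (p t x) * px t x) integrable_on cbox 0 (2 * pi)"
      unfolding cbox_interval by (intro integrable_continuous_real continuous_intros cc[OF ch] continuous_slices)
  next
    show "continuous_on ({0..1} \<times> cbox 0 (2 * pi)) (\<lambda>(t, x). D t x)"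
      unfolding D_def case_prod_unfold
      by (intro continuous_intros cc[OF ch] cc[OF c(1)] cc[OF c(2)] continuous_box)
  qed (use t in auto)
  have "(E has_integral h (p t (2 * pi)) * pt t (2 * pi) - h (p t 0) * pt t 0) {0..2 * pi}"
  proof (rule fundamental_theorem_of_calculus)
    fix x :: real
    have "((\<lambda>x. h (p t x)) has_derivative (\<lambda>s. \<alpha> (p t x) * (s *\<^sub>R px t x) + \<beta> (p t x) * cnj (s *\<^sub>R px t x))) (at x)"
      by (rule has_derivative_compose[OF deriv_x[OF t, unfolded has_vector_derivative_def] h])
    then have "((\<lambda>x. h (p t x)) has_vector_derivative \<alpha> (p t x) * px t x + \<beta> (p t x) * cnj (px t x)) (at x)"
      unfolding has_vector_derivative_def by (rule back_subst[where P="\<lambda>F. (_ has_derivative F) _"])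
        (auto simp: algebra_simps)
    from has_vector_derivative_mult[OF this deriv_t_x[OF t]]
    have "((\<lambda>x. h (p t x) * pt t x) has_vector_derivative E x) (at x)"
      unfolding E_def .
    then show "((\<lambda>x. h (p t x) * pt t x) has_vector_derivative E x) (at x within {0..2*pi})"
      by (rule has_vector_derivative_at_within)
  qed simp
  then have E0: "(E has_integral 0) {0..2 * pi}"
    using periodic[OF t, of 0] periodic_derivs(1)[OF t, of 0] by simp
  have "continuous_on {0..2 * pi} (D t)"
    unfolding D_def by (intro continuous_intros cc[OF ch] cc[OF c(1)] cc[OF c(2)] continuous_slices t)
  then have "(D t has_integral integral {0..2 * pi} (D t)) {0..2 * pi}"
    by (simp add: integrable_continuous_real integrable_integral)
  from has_integral_diff[OF this E0]
  have "((\<lambda>x. D t x - E x) has_integral integral {0..2 * pi} (D t)) {0..2 * pi}" by simp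
  moreover have "D t x - E x = 2 * \<i> * \<beta> (p t x) * of_real (J t x)" for x
    unfolding D_def E_def J_def by (simp add: complex_eq_iff algebra_simps)
  ultimately have "integral {0..2 * pi} (D t) = integral {0..2 * pi} (\<lambda>x. 2 * \<i> * \<beta> (p t x) * of_real (J t x))"
    by (simp add: integral_unique)
  with deriv show "((\<lambda>t. integral {0..2 * pi} (\<lambda>x. h (p t x) * px t x)) has_vector_derivative
      integral {0..2 * pi} (\<lambda>x. 2 * \<i> * \<beta> (p t x) * of_real (J t x))) (at t within {0..1})"
    by simp
qed simp

end

text \<open>The kernel of a disc with centre \<open>a\<close> and radius \<open>sqrt R\<close>. Its antiholomorphic derivative is
  \<open>disc_density\<close> as a function of \<open>s = \<bar>z - a\<bar>\<^sup>2\<close>, which vanishes outside the disc and increases to \<open>1\<close>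
  inside it as \<open>n\<close> grows; outside the disc the kernel is a multiple of \<open>1 / (z - a)\<close>. Hence \<open>disc_profile\<close>
  has to be the mean of the density over \<open>[0, s]\<close>, and \<open>disc_mass\<close> is the fraction of the area of the disc that the
  density retains. The density is continuous across the circle, which makes the kernel continuously
  differentiable.\<close>

definition disc_mass :: "nat \<Rightarrow> real" where
  "disc_mass n = 1 - 1 / (real n + 2)"

definition disc_profile :: "nat \<Rightarrow> real \<Rightarrow> real \<Rightarrow> real" where
  "disc_profile n R s = (if s \<le> R then 1 - (1 - disc_mass n) * (s / R) ^ Suc n else disc_mass n * R / s)"

definition disc_profile' :: "nat \<Rightarrow> real \<Rightarrow> real \<Rightarrow> real" where
  "disc_profile' n R s = (if s \<le> R then - disc_mass n * (s / R) ^ n / R else - disc_mass n * R / s\<^sup>2)"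

definition disc_density :: "nat \<Rightarrow> real \<Rightarrow> real \<Rightarrow> real" where
  "disc_density n R s = (if s \<le> R then 1 - (s / R) ^ Suc n else 0)"

definition disc_kernel :: "nat \<Rightarrow> complex \<Rightarrow> real \<Rightarrow> complex \<Rightarrow> complex" where
  "disc_kernel n a R z = cnj (z - a) * of_real (disc_profile n R ((cmod (z - a))\<^sup>2))"

lemma disc_mass_eq: "(1 - disc_mass n) * (real n + 1) = disc_mass n"
  by (simp add: disc_mass_def field_simps)

lemma disc_mass_bounds: "0 < disc_mass n" "disc_mass n < 1"
  by (simp_all add: disc_mass_def)

lemma disc_profile_deriv:
  assumes "R > 0"
  shows "(disc_profile n R has_real_derivative disc_profile' n R s) (at s)"
proof -
  define q where "q = disc_mass n"
  have q: "(1 - q) * (real n + 1) = q" unfolding q_def by (rule disc_mass_eq)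
  let ?f = "\<lambda>s::real. 1 - (1 - q) * (s / R) ^ Suc n" and ?g = "\<lambda>s::real. q * R / s"
  have f: "(?f has_real_derivative - q * (s / R) ^ n / R) (at s)" for s
  proof -
    have "(?f has_real_derivative - ((1 - q) * (real (Suc n) * (1 / R * (s / R) ^ n)))) (at s)"
      using assms by (auto intro!: derivative_eq_intros simp del: power_Suc)
    also have "- ((1 - q) * (real (Suc n) * (1 / R * (s / R) ^ n))) = - ((1 - q) * (real n + 1)) * (s / R) ^ n / R"
      by simp
    finally show ?thesis unfolding q .
  qed
  have g: "(?g has_real_derivative - q * R / s\<^sup>2) (at s)" if "s > 0" for s
    using that by (auto intro!: derivative_eq_intros simp: power2_eq_square)
  have prof: "disc_profile n R s = (if s \<le> R then ?f s else ?g s)" for s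
    unfolding disc_profile_def q_def ..
  have prof': "disc_profile' n R s = (if s \<le> R then - q * (s / R) ^ n / R else - q * R / s\<^sup>2)" for s
    unfolding disc_profile'_def q_def ..
  consider "s < R" | "s > R" | "s = R" by linarith
  then show ?thesis
  proof cases
    case 1
    have "(disc_profile n R has_real_derivative - q * (s / R) ^ n / R) (at s)"
      by (rule has_field_derivative_transform_within_open[OF f, where S="{..<R}"]) (use 1 in \<open>auto simp: prof simp del: power_Suc\<close>)
    then show ?thesis using 1 by (simp add: prof')
  next
    case 2
    have "(disc_profile n R has_real_derivative - q * R / s\<^sup>2) (at s)"
      by (rule has_field_derivative_transform_within_open[OF g, where S="{R<..}"]) (use 2 assms in \<open>auto simp: prof\<close>)
    then show ?thesis using 2 by (simp add: prof')
  next
    case 3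
    let ?d = "- q / R"
    have "(?f has_real_derivative ?d) (at R within {..R})"
      using has_field_derivative_at_within[OF f[of R], of "{..R}"] assms by simp
    then have 1: "(disc_profile n R has_real_derivative ?d) (at R within {..R})"
      by (rule has_field_derivative_transform_within[of _ _ _ _ 1]) (auto simp: prof)
    have "(?g has_real_derivative ?d) (at R within {R..})"
      using has_field_derivative_at_within[OF g[of R], of "{R..}"] assms by (simp add: power2_eq_square)
    then have 2: "(disc_profile n R has_real_derivative ?d) (at R within {R..})"
      by (rule has_field_derivative_transform_within[of _ _ _ _ 1]) (use assms in \<open>auto simp: prof\<close>)
    have "(disc_profile n R has_real_derivative ?d) (at R within {..R} \<union> {R..})"
      using 1 2 unfolding has_field_derivative_iff Lim_within_Un by simp
    moreover have "{..R} \<union> {R..} = UNIV" by auto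
    ultimately show ?thesis using 3 assms by (simp add: prof')
  qed
qed

text \<open>This says that \<open>s * disc_profile n R s\<close> is a primitive of the density.\<close>

lemma disc_profile_identity:
  assumes "R > 0"
  shows "disc_profile n R s + s * disc_profile' n R s = disc_density n R s"
proof (cases "s \<le> R")
  case True
  have "s * (- disc_mass n * (s / R) ^ n / R) = - disc_mass n * (s / R) ^ Suc n" by simp
  moreover have "1 - (1 - disc_mass n) * P + - disc_mass n * P = 1 - P" for P by algebra
  ultimately show ?thesis using True
    unfolding disc_profile_def disc_profile'_def disc_density_def by presburger
next
  case False
  then show ?thesis using assms
    unfolding disc_profile_def disc_profile'_def disc_density_def by (simp add: power2_eq_square)
qed

lemma continuous_disc:
  assumes "R > 0"
  shows "continuous_on UNIV (disc_profile' n R)" "continuous_on UNIV (disc_density n R)"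
proof -
  show c: "continuous_on UNIV (disc_profile' n R)"
  proof -
    have "continuous_on ({..R} \<union> {R..}) (disc_profile' n R)"
      unfolding disc_profile'_def
      by (rule continuous_on_cases) (use assms in \<open>auto intro!: continuous_intros simp: power2_eq_square\<close>)
    moreover have "{..R} \<union> {R..} = UNIV" by auto
    ultimately show ?thesis by simp
  qed
  have "continuous_on UNIV (disc_profile n R)"
    using disc_profile_deriv[OF assms] by (meson DERIV_isCont continuous_at_imp_continuous_on)
  then have "continuous_on UNIV (\<lambda>s. disc_profile n R s + s * disc_profile' n R s)"
    using c by (intro continuous_intros)
  then show "continuous_on UNIV (disc_density n R)"
    by (simp add: disc_profile_identity[OF assms])
qed

lemma disc_kernel_deriv:
  assumes "R > 0"
  shows "(disc_kernel n a R has_derivative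
    (\<lambda>v. (cnj (z - a))\<^sup>2 * of_real (disc_profile' n R ((cmod (z - a))\<^sup>2)) * v +
         of_real (disc_density n R ((cmod (z - a))\<^sup>2)) * cnj v)) (at z)"
proof -
  let ?s = "\<lambda>z. (cmod (z - a))\<^sup>2" and ?w = "z - a"
  have "((\<lambda>z. (z - a) \<bullet> (z - a)) has_derivative (\<lambda>v. 2 * (?w \<bullet> v))) (at z)"
    by (auto intro!: derivative_eq_intros simp: inner_commute)
  then have s: "(?s has_derivative (\<lambda>v. 2 * (?w \<bullet> v))) (at z)"
    by (simp add: power2_norm_eq_inner)
  have "((\<lambda>z. disc_profile n R (?s z)) has_derivative (\<lambda>v. disc_profile' n R (?s z) * (2 * (?w \<bullet> v)))) (at z)"
    using has_derivative_compose[OF s disc_profile_deriv[OF assms, unfolded has_field_derivative_def]] .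
  then have u: "((\<lambda>z. complex_of_real (disc_profile n R (?s z))) has_derivative
      (\<lambda>v. of_real (disc_profile' n R (?s z) * (2 * (?w \<bullet> v))))) (at z)"
    by (rule has_derivative_of_real)
  have c: "((\<lambda>z. cnj (z - a)) has_derivative cnj) (at z)"
    using bounded_linear.has_derivative[OF bounded_linear_cnj has_derivative_diff[OF has_derivative_ident has_derivative_const]]
    by simp
  have eq: "cnj ?w * of_real (disc_profile' n R (?s z) * (2 * (?w \<bullet> v))) + cnj v * of_real (disc_profile n R (?s z))
     = (cnj ?w)\<^sup>2 * of_real (disc_profile' n R (?s z)) * v + of_real (disc_density n R (?s z)) * cnj v" for v
  proof -
    have 1: "of_real (2 * (?w \<bullet> v)) = cnj ?w * v + ?w * cnj v"
      by (simp add: complex_eq_iff inner_complex_def algebra_simps)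
    have 2: "?w * cnj ?w = of_real (?s z)" by (rule complex_norm_square[symmetric])
    have "cnj ?w * of_real (disc_profile' n R (?s z) * (2 * (?w \<bullet> v))) + cnj v * of_real (disc_profile n R (?s z))
       = cnj ?w * of_real (disc_profile' n R (?s z)) * (cnj ?w * v + ?w * cnj v) + cnj v * of_real (disc_profile n R (?s z))"
      by (simp only: of_real_mult 1[symmetric] mult.assoc)
    also have "\<dots> = (cnj ?w)\<^sup>2 * of_real (disc_profile' n R (?s z)) * v +
        cnj v * (of_real (disc_profile n R (?s z)) + (?w * cnj ?w) * of_real (disc_profile' n R (?s z)))"
      by (simp only: power2_eq_square ring_distribs mult_ac add_ac)
    also have "of_real (disc_profile n R (?s z)) + (?w * cnj ?w) * of_real (disc_profile' n R (?s z)) =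
       complex_of_real (disc_density n R (?s z))"
      unfolding 2 disc_profile_identity[OF assms, symmetric] by simp
    finally show ?thesis by (simp only: mult.commute)
  qed
  show ?thesis
    using has_derivative_mult[OF c u] unfolding disc_kernel_def eq .
qed

lemma disc_kernel_outside:
  assumes "r > 0" "r \<le> cmod (z - a)"
  shows "disc_kernel n a (r\<^sup>2) z = of_real (disc_mass n * r\<^sup>2) / (z - a)"
proof -
  have w: "z - a \<noteq> 0" "cmod (z - a) > 0" using assms by auto
  have le: "r\<^sup>2 \<le> (cmod (z - a))\<^sup>2" using assms by (intro power_mono) auto
  have "disc_profile n (r\<^sup>2) ((cmod (z - a))\<^sup>2) = disc_mass n * r\<^sup>2 / (cmod (z - a))\<^sup>2"
  proof (cases "(cmod (z - a))\<^sup>2 = r\<^sup>2")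
    case True
    with assms show ?thesis by (simp add: disc_profile_def)
  next
    case False
    with le show ?thesis by (simp add: disc_profile_def)
  qed
  then have "disc_kernel n a (r\<^sup>2) z = cnj (z - a) * (of_real (disc_mass n * r\<^sup>2) / of_real ((cmod (z - a))\<^sup>2))"
    unfolding disc_kernel_def by simp
  also have "\<dots> = of_real (disc_mass n * r\<^sup>2) / (z - a)"
    unfolding complex_norm_square using w(1) by (simp del: complex_cnj_diff)
  finally show ?thesis .
qed

lemma disc_density_bounds:
  assumes "R > 0" "s \<ge> 0"
  shows "0 \<le> disc_density n R s" "disc_density n R s \<le> 1" "R \<le> s \<Longrightarrow> disc_density n R s = 0"
proof -
  have "(s / R) ^ Suc n \<le> 1" if "s \<le> R" using assms that by (intro power_le_one) auto
  then show "0 \<le> disc_density n R s" by (auto simp: disc_density_def simp del: power_Suc)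
  show "disc_density n R s \<le> 1" using assms by (auto simp: disc_density_def simp del: power_Suc)
  show "R \<le> s \<Longrightarrow> disc_density n R s = 0" using assms by (auto simp: disc_density_def)
qed

lemma disc_density_limit:
  assumes "0 \<le> s" "s < R"
  shows "(\<lambda>n. disc_density n R s) \<longlonglongrightarrow> 1"
proof -
  have "(\<lambda>n. 1 - (s / R) ^ Suc n) \<longlonglongrightarrow> 1 - 0"
    using assms by (intro tendsto_diff tendsto_const LIMSEQ_Suc[OF LIMSEQ_power_zero]) auto
  then show ?thesis using assms by (simp add: disc_density_def)
qed

text \<open>Closed curves are parametrized over \<open>[0, 2\<pi>]\<close>, but the paths of contour integration over \<open>[0, 1]\<close>.\<close>

definition loop_winding :: "(real \<Rightarrow> complex) \<Rightarrow> complex \<Rightarrow> complex" where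
  "loop_winding \<gamma> z = winding_number (\<lambda>s. \<gamma> (2 * pi * s)) z"

lemma loop_winding_integral:
  assumes d: "\<And>x. (\<gamma> has_vector_derivative \<gamma>' x) (at x)" and c: "continuous_on UNIV \<gamma>'"
    and z: "z \<notin> range \<gamma>"
  shows "loop_winding \<gamma> z = 1 / (2 * pi * \<i>) * integral {0..2 * pi} (\<lambda>x. \<gamma>' x / (\<gamma> x - z))"
proof -
  let ?g = "\<lambda>s. \<gamma> (2 * pi * s)" and ?g' = "\<lambda>s. (2 * pi) *\<^sub>R \<gamma>' (2 * pi * s)"
  have g': "(?g has_vector_derivative ?g' s) (at s)" for s
  proof -
    have "((\<lambda>s. 2 * pi * s) has_vector_derivative 2 * pi) (at s)"
      using DERIV_cmult_Id[of "2 * pi"] by (simp add: has_real_derivative_iff_has_vector_derivative)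
    from vector_diff_chain_at[OF this d[of "2 * pi * s"]] show ?thesis by (simp add: o_def)
  qed
  have c\<gamma>': "continuous_on X (\<lambda>s. \<gamma>' (f s))" if "continuous_on X f" for f :: "real \<Rightarrow> real" and X
    by (rule continuous_on_compose2[OF c that]) simp
  have "continuous_on {0..1} ?g'" by (intro continuous_intros c\<gamma>')
  then have "?g C1_differentiable_on {0..1}"
    unfolding C1_differentiable_on_def using g' by (intro exI[of _ ?g']) simp
  then have vp: "valid_path ?g"
    unfolding valid_path_def by (rule C1_differentiable_imp_piecewise)
  have "z \<notin> path_image ?g" using z by (auto simp: path_image_def)
  then have "winding_number ?g z = 1 / (2 * pi * \<i>) * contour_integral ?g (\<lambda>w. 1 / (w - z))"
    by (rule winding_number_valid_path[OF vp])
  also have "contour_integral ?g (\<lambda>w. 1 / (w - z)) = integral {0..1} (\<lambda>s. 1 / (?g s - z) * ?g' s)"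
    unfolding contour_integral_integral vector_derivative_at[OF g'] ..
  also have "\<dots> = (2 * pi) *\<^sub>R integral {0..1} (\<lambda>s. \<gamma>' (2 * pi * s) / (\<gamma> (2 * pi * s) - z))"
    unfolding integral_cmul[symmetric] by (simp add: field_simps)
  also have "integral {0..1} (\<lambda>s. \<gamma>' (2 * pi * s) / (\<gamma> (2 * pi * s) - z)) = 
      (1 / \<bar>2 * pi\<bar>) *\<^sub>R integral {0..2 * pi} (\<lambda>x. \<gamma>' x / (\<gamma> x - z))"
  proof -
    have "(\<lambda>x. x / (2 * pi)) ` {0..2 * pi} = {0..1}"
      using image_divide_atLeastAtMost[of "2 * pi" 0 "2 * pi"] by simp
    then show ?thesis
      using integral_stretch_real[of "2 * pi" 0 "2 * pi" "\<lambda>x. \<gamma>' x / (\<gamma> x - z)"] by simp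
  qed
  finally show ?thesis by (simp add: loop_winding_def)
qed

lemma loop_winding_regular:
  assumes d: "\<And>x. (\<gamma> has_vector_derivative \<gamma>' x) (at x)" and per: "\<And>x. \<gamma> (x + 2 * pi) = \<gamma> x"
  shows "path (\<lambda>s. \<gamma> (2 * pi * s))" "pathfinish (\<lambda>s. \<gamma> (2 * pi * s)) = pathstart (\<lambda>s. \<gamma> (2 * pi * s))"
    "path_image (\<lambda>s. \<gamma> (2 * pi * s)) \<subseteq> range \<gamma>"
proof -
  have "continuous_on UNIV \<gamma>"
    by (rule continuous_at_imp_continuous_on) (use has_vector_derivative_continuous[OF d] in simp)
  then have "continuous_on {0..1} (\<lambda>s. \<gamma> (2 * pi * s))"
    by (rule continuous_on_compose2) (auto intro!: continuous_intros)
  then show "path (\<lambda>s. \<gamma> (2 * pi * s))" by (simp add: path_def)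
  show "pathfinish (\<lambda>s. \<gamma> (2 * pi * s)) = pathstart (\<lambda>s. \<gamma> (2 * pi * s))"
    using per[of 0] by (simp add: pathfinish_def pathstart_def)
  show "path_image (\<lambda>s. \<gamma> (2 * pi * s)) \<subseteq> range \<gamma>" by (auto simp: path_image_def)
qed

lemma loop_winding_constant_on_ball:
  assumes d: "\<And>x. (\<gamma> has_vector_derivative \<gamma>' x) (at x)" and per: "\<And>x. \<gamma> (x + 2 * pi) = \<gamma> x"
    and disj: "ball a r \<inter> range \<gamma> = {}" and z: "z \<in> ball a r"
  shows "loop_winding \<gamma> z = loop_winding \<gamma> a"
proof -
  note reg = loop_winding_regular[OF d per]
  have "a \<in> ball a r" using z by (metis centre_in_ball dist_not_less_zero linorder_not_less mem_ball order_le_less_trans)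
  then show ?thesis unfolding loop_winding_def
    by (intro winding_number_eq[OF reg(1,2) z _ connected_ball]) (use reg(3) disj in auto)
qed

context loop_homotopy
begin

text \<open>Apply Stokes' theorem to the kernel of the disc. Both end curves lie where the kernel is a multiple of
  \<open>1 / (z - a)\<close>, so their contour integrals are winding numbers.\<close>

lemma disc_swept:
  assumes r: "r > 0" and disj: "\<And>x. r \<le> cmod (p 0 x - a)" "\<And>x. r \<le> cmod (p 1 x - a)"
  shows "of_real (disc_mass n * (pi * r\<^sup>2)) * (loop_winding (p 1) a - loop_winding (p 0) a) =
    complex_of_real (integral {0..1} (\<lambda>t. integral {0..2 * pi} (\<lambda>x. disc_density n (r\<^sup>2) ((cmod (p t x - a))\<^sup>2) * J t x)))"
proof -
  have r2: "r\<^sup>2 > 0" using r by simp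
  let ?h = "disc_kernel n a (r\<^sup>2)"
  let ?\<rho> = "\<lambda>z. disc_density n (r\<^sup>2) ((cmod (z - a))\<^sup>2)"
  let ?\<alpha> = "\<lambda>z. (cnj (z - a))\<^sup>2 * of_real (disc_profile' n (r\<^sup>2) ((cmod (z - a))\<^sup>2))"
  let ?I = "\<lambda>t. integral {0..2 * pi} (\<lambda>x. ?\<rho> (p t x) * J t x)"
  have c\<rho>: "continuous_on UNIV (\<lambda>z::complex. ?\<rho> z)" and cp: "continuous_on UNIV (\<lambda>z::complex. disc_profile' n (r\<^sup>2) ((cmod (z - a))\<^sup>2))"
    by (rule continuous_on_compose2[OF continuous_disc(2)[OF r2]] continuous_on_compose2[OF continuous_disc(1)[OF r2]];
        auto intro!: continuous_intros)+
  have c\<rho>': "continuous_on X (\<lambda>z. ?\<rho> (f z))" if "continuous_on X f" for f :: "'z::topological_space \<Rightarrow> complex" and X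
    by (rule continuous_on_compose2[OF c\<rho> that]) simp
  have st: "((\<lambda>t. integral {0..2 * pi} (\<lambda>x. 2 * \<i> * of_real (?\<rho> (p t x)) * of_real (J t x))) has_integral
    integral {0..2 * pi} (\<lambda>x. ?h (p 1 x) * px 1 x) - integral {0..2 * pi} (\<lambda>x. ?h (p 0 x) * px 0 x)) {0..1}"
    by (rule stokes[OF disc_kernel_deriv[OF r2]]) (intro continuous_intros c\<rho> cp)+
  have end_int: "integral {0..2 * pi} (\<lambda>x. ?h (p t x) * px t x) = 
      of_real (disc_mass n * r\<^sup>2) * (2 * pi * \<i> * loop_winding (p t) a)"
    if t: "t \<in> {0..1}" and dj: "\<And>x. r \<le> cmod (p t x - a)" for t
  proof -
    have "a \<notin> range (p t)"
    proof
      assume "a \<in> range (p t)"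
      then obtain x where "a = p t x" by auto
      with dj[of x] r show False by simp
    qed
    note lw = loop_winding_integral[OF deriv_x[OF t] continuous_slices(3)[OF t] this]
    have "integral {0..2 * pi} (\<lambda>x. ?h (p t x) * px t x) =
        integral {0..2 * pi} (\<lambda>x. of_real (disc_mass n * r\<^sup>2) * (px t x / (p t x - a)))"
      unfolding disc_kernel_outside[OF r dj] by simp
    also have "\<dots> = of_real (disc_mass n * r\<^sup>2) * integral {0..2 * pi} (\<lambda>x. px t x / (p t x - a))"
      by (rule integral_mult_right)
    also have "integral {0..2 * pi} (\<lambda>x. px t x / (p t x - a)) = 2 * pi * \<i> * loop_winding (p t) a"
      unfolding lw by simp
    finally show ?thesis .
  qed
  have inner: "integral {0..2 * pi} (\<lambda>x. 2 * \<i> * of_real (?\<rho> (p t x)) * of_real (J t x)) = 2 * \<i> * of_real (?I t)"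
    if t: "t \<in> {0..1}" for t
  proof -
    have "continuous_on {0..2 * pi} (\<lambda>x. ?\<rho> (p t x) * J t x)"
      by (intro continuous_intros c\<rho>' continuous_slices continuous_slice_J t)
    then have "((\<lambda>x. ?\<rho> (p t x) * J t x) has_integral ?I t) {0..2 * pi}"
      by (simp add: integrable_continuous_real integrable_integral)
    from has_integral_mult_right[OF has_integral_of_real[OF this, where 'b=complex], of "2 * \<i>"]
    show ?thesis by (intro integral_unique) (simp add: mult_ac)
  qed
  have cI: "continuous_on {0..1} ?I"
  proof -
    have "continuous_on {0..1} (\<lambda>t. integral (cbox 0 (2 * pi)) (\<lambda>x. ?\<rho> (p t x) * J t x))"
      by (rule integral_continuous_on_param)
        (simp only: case_prod_unfold, intro continuous_intros c\<rho>' continuous_box continuous_box_J)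
    then show ?thesis by simp
  qed
  then have "(?I has_integral integral {0..1} ?I) {0..1}"
    by (simp add: integrable_continuous_real integrable_integral)
  from has_integral_mult_right[OF has_integral_of_real[OF this, where 'b=complex], of "2 * \<i>"]
  have "((\<lambda>t. integral {0..2 * pi} (\<lambda>x. 2 * \<i> * of_real (?\<rho> (p t x)) * of_real (J t x))) has_integral
      2 * \<i> * of_real (integral {0..1} ?I)) {0..1}"
    by (rule has_integral_eq[rotated]) (simp only: inner)
  from has_integral_unique[OF this st]
  have "2 * \<i> * of_real (integral {0..1} ?I) = of_real (disc_mass n * r\<^sup>2) * (2 * pi * \<i> * loop_winding (p 1) a)
      - of_real (disc_mass n * r\<^sup>2) * (2 * pi * \<i> * loop_winding (p 0) a)"
    using end_int[of 1] end_int[of 0] disj by simp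
  also have "\<dots> = 2 * \<i> * (of_real (disc_mass n * (pi * r\<^sup>2)) * (loop_winding (p 1) a - loop_winding (p 0) a))"
    by (simp add: algebra_simps)
  finally show ?thesis by simp
qed

end

section \<open>Area swept and flat distance\<close>

text \<open>Vitali's covering theorem. The balls are enumerated by the natural numbers, with empty balls filling
  up the sequence, so that they can be summed as a series.\<close>

lemma open_set_ball_packing:
  fixes S :: "'a::euclidean_space set"
  assumes S: "open S"
  shows "\<exists>(a :: nat \<Rightarrow> 'a) r. (\<forall>n. 0 \<le> r n) \<and> disjoint_family (\<lambda>n. ball (a n) (r n)) \<and>
    (\<forall>n. ball (a n) (r n) \<subseteq> S) \<and> negligible (S - (\<Union>n. ball (a n) (r n)))"
proof -
  define K where "K = {i :: 'a \<times> real. 0 < snd i \<and> ball (fst i) (snd i) \<subseteq> S}"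
  have "\<exists>i. i \<in> K \<and> x \<in> ball (fst i) (snd i) \<and> snd i < d" if x: "x \<in> S" "0 < d" for x d
  proof -
    obtain e where e: "e > 0" "ball x e \<subseteq> S" using openE[OF S x(1)] .
    have "ball x (min e (d / 2)) \<subseteq> S" using e(2) by auto
    then show ?thesis using e x by (intro exI[of _ "(x, min e (d / 2))"]) (auto simp: K_def)
  qed
  note cov = this
  obtain C where C: "countable C" "C \<subseteq> K"
    "pairwise (\<lambda>i j. disjnt (ball (fst i) (snd i)) (ball (fst j) (snd j))) C"
    "negligible (S - (\<Union>i\<in>C. ball (fst i) (snd i)))"
    by (rule Vitali_covering_theorem_balls[of S K fst snd, OF cov])
  define i where "i = (\<lambda>n. if n \<in> to_nat_on C ` C then from_nat_into C n else (0, 0))"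
  have iC: "i n \<in> C" if "n \<in> to_nat_on C ` C" for n
    using that C(1) by (auto simp: i_def)
  have i0: "i n = (0, 0)" if "n \<notin> to_nat_on C ` C" for n using that by (simp add: i_def)
  have i_onto: "\<exists>n. i n = c" if "c \<in> C" for c
    using that C(1) by (intro exI[of _ "to_nat_on C c"]) (auto simp: i_def)
  have i_inj: "i m \<noteq> i n" if "m \<in> to_nat_on C ` C" "n \<in> to_nat_on C ` C" "m \<noteq> n" for m n
    using that C(1) by (auto simp: i_def)
  have 1: "0 \<le> snd (i n)" for n
    using iC[of n] i0[of n] C(2) by (cases "n \<in> to_nat_on C ` C") (auto simp: K_def)
  have 2: "disjoint_family (\<lambda>n. ball (fst (i n)) (snd (i n)))"
    unfolding disjoint_family_on_def
  proof (intro ballI impI)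
    fix m n :: nat assume "m \<noteq> n"
    show "ball (fst (i m)) (snd (i m)) \<inter> ball (fst (i n)) (snd (i n)) = {}"
    proof (cases "m \<in> to_nat_on C ` C \<and> n \<in> to_nat_on C ` C")
      case True
      then show ?thesis
        using pairwiseD[OF C(3) iC iC i_inj[OF _ _ \<open>m \<noteq> n\<close>]] by (auto simp: disjnt_def)
    next
      case False
      then show ?thesis using i0 by auto
    qed
  qed
  have 3: "ball (fst (i n)) (snd (i n)) \<subseteq> S" for n
    using iC[of n] i0[of n] C(2) by (cases "n \<in> to_nat_on C ` C") (auto simp: K_def)
  have "(\<Union>c\<in>C. ball (fst c) (snd c)) \<subseteq> (\<Union>n. ball (fst (i n)) (snd (i n)))"
  proof
    fix z assume "z \<in> (\<Union>c\<in>C. ball (fst c) (snd c))"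
    then obtain c where "c \<in> C" "z \<in> ball (fst c) (snd c)" by auto
    moreover obtain n where "i n = c" using i_onto[OF \<open>c \<in> C\<close>] by auto
    ultimately show "z \<in> (\<Union>n. ball (fst (i n)) (snd (i n)))" by auto
  qed
  then have 4: "negligible (S - (\<Union>n. ball (fst (i n)) (snd (i n))))"
    by (intro negligible_subset[OF C(4)]) auto
  show ?thesis
    by (intro exI[of _ "\<lambda>n. fst (i n)"] exI[of _ "\<lambda>n. snd (i n)"] conjI allI 1 2 3 4)
qed

text \<open>Off the balls \<open>f\<close> is an arbitrary function; it is measurable all the same because Lebesgue measure is
  complete.\<close>

lemma integral_constant_on_balls:
  fixes f :: "complex \<Rightarrow> real" and a :: "nat \<Rightarrow> complex"
  assumes r: "\<And>n. 0 \<le> r n" and disj: "disjoint_family (\<lambda>n. ball (a n) (r n))"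
    and neg: "negligible (- (\<Union>n. ball (a n) (r n)))"
    and f0: "\<And>z. 0 \<le> f z" and const: "\<And>n z. z \<in> ball (a n) (r n) \<Longrightarrow> f z = f (a n)"
    and sum: "summable (\<lambda>n. f (a n) * (pi * (r n)\<^sup>2))"
  shows "integral\<^sup>L lebesgue f = (\<Sum>n. f (a n) * (pi * (r n)\<^sup>2))"
proof -
  let ?B = "\<lambda>n. ball (a n) (r n)"
  have neg_sets: "X \<in> sets lebesgue" if "X \<subseteq> - (\<Union>n. ?B n)" for X
    by (rule negligible_imp_sets[OF negligible_subset[OF neg that]])
  have meas: "f \<in> borel_measurable lebesgue"
  proof (rule measurableI)
    fix X :: "real set"
    have 1: "f -` X = (\<Union>n\<in>{n. f (a n) \<in> X}. ?B n) \<union> (f -` X - (\<Union>n. ?B n))" (is "_ = ?U \<union> ?V")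
    proof (intro set_eqI iffI)
      fix z assume z: "z \<in> f -` X"
      show "z \<in> ?U \<union> ?V"
      proof (cases "z \<in> (\<Union>n. ?B n)")
        case True
        then obtain n where n: "z \<in> ?B n" by auto
        with z const[OF n] have "f (a n) \<in> X" by simp
        with n show ?thesis by auto
      qed (use z in auto)
    next
      fix z assume "z \<in> ?U \<union> ?V"
      then show "z \<in> f -` X"
      proof
        assume "z \<in> ?U"
        then obtain n where "f (a n) \<in> X" "z \<in> ?B n" by auto
        with const[OF this(2)] show ?thesis by simp
      qed auto
    qed
    have "?U \<in> sets lebesgue" by (intro sets.countable_UN' countableI_type) auto
    moreover have "?V \<in> sets lebesgue" by (intro neg_sets) auto
    ultimately show "f -` X \<inter> space lebesgue \<in> sets lebesgue" by (subst 1) auto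
  qed simp
  have AEB: "AE z in lebesgue. z \<in> (\<Union>n. ?B n)"
    by (rule AE_I'[of "- (\<Union>n. ?B n)"]) (use neg in \<open>auto simp: negligible_iff_null_sets\<close>)
  have "(\<integral>\<^sup>+z. ennreal (f z) \<partial>lebesgue) = (\<integral>\<^sup>+z. (\<Sum>n. ennreal (f (a n)) * indicator (?B n) z) \<partial>lebesgue)"
  proof (rule nn_integral_cong_AE)
    show "AE z in lebesgue. ennreal (f z) = (\<Sum>n. ennreal (f (a n)) * indicator (?B n) z)"
      using AEB
    proof eventually_elim
      case (elim z)
      then obtain n where n: "z \<in> ?B n" by auto
      have "z \<notin> ?B m" if "m \<noteq> n" for m
        using disjoint_family_onD[OF disj, of m n] that n by auto
      then have "(\<Sum>n. ennreal (f (a n)) * indicator (?B n) z) = (\<Sum>m\<in>{n}. ennreal (f (a m)) * indicator (?B m) z)"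
        by (intro suminf_finite) (auto simp del: mem_ball)
      then show ?case using n const[OF n] by (simp del: mem_ball)
    qed
  qed
  also have "\<dots> = (\<Sum>n. \<integral>\<^sup>+z. ennreal (f (a n)) * indicator (?B n) z \<partial>lebesgue)"
    by (rule nn_integral_suminf) (intro borel_measurable_times_ennreal borel_measurable_const borel_measurable_indicator; simp)
  also have "\<dots> = (\<Sum>n. ennreal (f (a n) * (pi * (r n)\<^sup>2)))"
  proof (rule suminf_cong)
    fix n
    have "emeasure lebesgue (?B n) = ennreal (pi * (r n)\<^sup>2)"
      using emeasure_ball[OF r, of "a n" n] by (simp add: unit_ball_vol_2)
    then show "(\<integral>\<^sup>+z. ennreal (f (a n)) * indicator (?B n) z \<partial>lebesgue) = ennreal (f (a n) * (pi * (r n)\<^sup>2))"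
      by (simp add: nn_integral_cmult_indicator ennreal_mult f0 del: ennreal_mult')
  qed
  also have "\<dots> = ennreal (\<Sum>n. f (a n) * (pi * (r n)\<^sup>2))"
    by (rule suminf_ennreal2[OF _ sum]) (simp add: f0)
  finally have "has_bochner_integral lebesgue f (\<Sum>n. f (a n) * (pi * (r n)\<^sup>2))"
    by (intro has_bochner_integral_nn_integral meas) (auto intro!: suminf_nonneg sum simp: f0)
  then show ?thesis by (rule has_bochner_integral_integral_eq)
qed

lemma range_periodic:
  fixes f :: "real \<Rightarrow> 'a"
  assumes "\<And>x. f (x + 2 * pi) = f x"
  shows "range f = f ` {0..2 * pi}"
proof -
  interpret periodic_fun_simple f "2 * pi" by unfold_locales (rule assms)
  have "f x \<in> f ` {0..2 * pi}" for x
  proof (rule image_eqI[where x="x - of_int \<lfloor>x / (2 * pi)\<rfloor> * (2 * pi)"])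
    show "f x = f (x - of_int \<lfloor>x / (2 * pi)\<rfloor> * (2 * pi))" by (simp add: minus_of_int)
    have "of_int \<lfloor>x / (2 * pi)\<rfloor> * (2 * pi) \<le> x" "x \<le> (of_int \<lfloor>x / (2 * pi)\<rfloor> + 1) * (2 * pi)"
      using floor_divide_lower[of "2 * pi" x] floor_divide_upper[of "2 * pi" x] by simp_all
    then show "x - of_int \<lfloor>x / (2 * pi)\<rfloor> * (2 * pi) \<in> {0..2 * pi}" by (simp add: algebra_simps)
  qed
  then show ?thesis by auto
qed

text \<open>The condition on \<open>A\<close> and \<open>B\<close> says that the derivative is invertible. The complex plane is identified
  with \<open>\<real> \<times> \<real>\<close> so that \<open>f\<close> maps a Euclidean space to itself.\<close>

lemma negligible_vimage_immersion:
  fixes f :: "real \<times> real \<Rightarrow> complex"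
  assumes N: "negligible N" and d: "\<And>z. z \<in> S \<Longrightarrow> (f has_derivative (\<lambda>v. fst v *\<^sub>R A z + snd v *\<^sub>R B z)) (at z within S)"
    and J: "\<And>z. z \<in> S \<Longrightarrow> Im (cnj (A z) * B z) \<noteq> 0"
  shows "negligible {z \<in> S. f z \<in> N}"
proof -
  define \<phi> where "\<phi> = (\<lambda>w. (Re w, Im w))"
  have \<phi>: "(\<phi> has_derivative \<phi>) F" for F
    unfolding \<phi>_def
    by (rule bounded_linear_imp_has_derivative[OF bounded_linear_Pair[OF bounded_linear_Re bounded_linear_Im]])
  have "negligible (\<phi> ` N)"
  proof (rule negligible_differentiable_image_negligible[OF _ N])
    show "\<phi> differentiable_on N" unfolding differentiable_on_def differentiable_def using \<phi> by blast
  qed simp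
  then have "negligible {z \<in> S. \<phi> (f z) \<in> \<phi> ` N}"
  proof (rule negligible_differentiable_vimage)
    fix z assume z: "z \<in> S"
    show "((\<lambda>z. \<phi> (f z)) has_derivative (\<lambda>v. \<phi> (fst v *\<^sub>R A z + snd v *\<^sub>R B z))) (at z within S)"
      by (rule has_derivative_compose[OF d[OF z] \<phi>])
    show "inj (\<lambda>v. \<phi> (fst v *\<^sub>R A z + snd v *\<^sub>R B z))"
    proof (rule injI)
      fix v w :: "real \<times> real"
      let ?a = "fst v - fst w" and ?b = "snd v - snd w"
      assume "\<phi> (fst v *\<^sub>R A z + snd v *\<^sub>R B z) = \<phi> (fst w *\<^sub>R A z + snd w *\<^sub>R B z)"
      then have e: "?a * Re (A z) + ?b * Re (B z) = 0" "?a * Im (A z) + ?b * Im (B z) = 0"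
        by (auto simp: \<phi>_def algebra_simps)
      have j: "Re (A z) * Im (B z) - Im (A z) * Re (B z) \<noteq> 0" using J[OF z] by simp
      have "?a * (Re (A z) * Im (B z) - Im (A z) * Re (B z)) = 0"
        "?b * (Re (A z) * Im (B z) - Im (A z) * Re (B z)) = 0"
        using e by algebra+
      then show "v = w" using j by (auto simp: prod_eq_iff)
    qed
  qed
  moreover have "\<phi> x \<in> \<phi> ` N \<longleftrightarrow> x \<in> N" for x
    by (rule inj_image_mem_iff) (auto intro!: injI complex_eqI simp: \<phi>_def)
  ultimately show ?thesis by simp
qed

context loop_homotopy
begin

definition swept_area :: real where
  "swept_area = integral {0..1} (\<lambda>t. integral {0..2 * pi} (\<lambda>x. \<bar>J t x\<bar>))"

definition winding_change :: "complex \<Rightarrow> real" where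
  "winding_change z = cmod (loop_winding (p 1) z - loop_winding (p 0) z)"

lemma box_integral:
  fixes F :: "real \<Rightarrow> real \<Rightarrow> real"
  assumes "continuous_on ({0..1} \<times> {0..2 * pi}) (\<lambda>z. F (fst z) (snd z))"
  shows "integral {0..1} (\<lambda>t. integral {0..2 * pi} (F t)) = integral ({0..1} \<times> {0..2 * pi}) (\<lambda>z. F (fst z) (snd z))"
  using integral_prod_continuous[of 0 0 1 "2 * pi" "\<lambda>z. F (fst z) (snd z)"] assms
  by (simp add: cbox_Pair_eq)

lemma box_integrable:
  fixes F :: "real \<times> real \<Rightarrow> real"
  assumes "continuous_on ({0..1} \<times> {0..2 * pi}) F"
  shows "F integrable_on {0..1} \<times> {0..2 * pi}"
  using integrable_continuous[of "(0, 0)" "(1, 2 * pi)" F] assms by (simp add: cbox_Pair_eq)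

lemma trace_closed_negligible:
  assumes t: "t \<in> {0..1}"
  shows "closed (range (p t))" "negligible (range (p t))"
proof -
  have "compact (p t ` {0..2 * pi})"
    by (intro compact_continuous_image continuous_slices t compact_Icc)
  then show "closed (range (p t))"
    using range_periodic[of "p t", OF periodic[OF t]] compact_imp_closed by simp
  have "p t differentiable_on UNIV"
    unfolding differentiable_on_def differentiable_def
    using deriv_x[OF t] unfolding has_vector_derivative_def by (intro ballI exI) 
  then show "negligible (range (p t))"
    by (rule negligible_differentiable_image_lowdim[rotated]) simp
qed

text \<open>Pack the complement of the two end curves with disjoint discs, up to a null set. On each disc the winding
  numbers are constant and \<open>disc_swept\<close> applies; since the densities of disjoint discs add up to at most \<open>1\<close>, the
  sum over all discs is at most the swept area. If \<open>J\<close> keeps the sign \<open>\<sigma>\<close>, then nothing cancels, and the points that are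
  moved outside all discs form a null set because \<open>p\<close> is a local diffeomorphism. The function \<open>f\<close> leaves the
  value on the end curves open, where winding numbers are not defined.\<close>

lemma
  assumes f0: "\<And>z. 0 \<le> f z" and f: "\<And>z. z \<notin> range (p 0) \<union> range (p 1) \<Longrightarrow> f z = winding_change z"
  shows flat_le_swept_area: "integral\<^sup>L lebesgue f \<le> swept_area"
    and flat_eq_swept_area: "(\<And>t x. t \<in> {0..1} \<Longrightarrow> 0 < \<sigma> * J t x) \<Longrightarrow> \<bar>\<sigma>\<bar> = 1 \<Longrightarrow>
      integral\<^sup>L lebesgue f = swept_area"
proof -
  define T where "T = range (p 0) \<union> range (p 1)"
  have T: "closed T" "negligible T"
    unfolding T_def using trace_closed_negligible[of 0] trace_closed_negligible[of 1] by auto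
  define Q :: "(real \<times> real) set" where "Q = {0..1} \<times> {0..2 * pi}"
  let ?P = "\<lambda>z. p (fst z) (snd z)" and ?J = "\<lambda>z. J (fst z) (snd z)"
  have open_T: "open (- T)" using T(1) by (simp add: open_Compl)
  obtain a :: "nat \<Rightarrow> complex" and r :: "nat \<Rightarrow> real" where r: "\<And>n. 0 \<le> r n" and disj: "disjoint_family (\<lambda>n. ball (a n) (r n))"
    and off: "\<And>n. ball (a n) (r n) \<subseteq> - T" and neg: "negligible (- T - (\<Union>n. ball (a n) (r n)))"
    using open_set_ball_packing[OF open_T] by blast
  let ?B = "\<lambda>n. ball (a n) (r n)"
  have neg': "negligible (- (\<Union>n. ?B n))"
    by (rule negligible_subset[OF negligible_Un[OF neg T(2)]]) auto
  have const': "winding_change z = winding_change (a n)" if "z \<in> ?B n" for n z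
  proof -
    have "?B n \<inter> range (p 0) = {}" "?B n \<inter> range (p 1) = {}" using off[of n] unfolding T_def by blast+
    then have "loop_winding (p 0) z = loop_winding (p 0) (a n)" "loop_winding (p 1) z = loop_winding (p 1) (a n)"
      using loop_winding_constant_on_ball[OF deriv_x[of 0] periodic[of 0] _ that]
        loop_winding_constant_on_ball[OF deriv_x[of 1] periodic[of 1] _ that] by simp_all
    then show ?thesis by (simp add: winding_change_def)
  qed
  have fB: "f z = winding_change z" if "z \<in> ?B n" for n z
  proof (rule f)
    show "z \<notin> range (p 0) \<union> range (p 1)" using off[of n] that unfolding T_def by blast
  qed
  have const: "f z = f (a n)" if z: "z \<in> ?B n" for n z
  proof -
    have "0 < r n" using z zero_le_dist[of "a n" z] by (simp del: zero_le_dist)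
    then have "a n \<in> ?B n" by simp
    then show ?thesis using fB[OF z] fB[of "a n" n] const'[OF z] by simp
  qed
  define D where "D = (\<lambda>n. winding_change (a n) * (pi * (r n)\<^sup>2))"
  have D0: "0 \<le> D n" for n by (simp add: D_def winding_change_def)
  define \<rho> where "\<rho> = (\<lambda>n k z. if 0 < r n then disc_density k ((r n)\<^sup>2) ((cmod (z - a n))\<^sup>2) else 0)"
  have \<rho>0: "0 \<le> \<rho> n k z" and \<rho>1: "\<rho> n k z \<le> 1" for n k z
    using disc_density_bounds(1,2)[of "(r n)\<^sup>2" "(cmod (z - a n))\<^sup>2" k] by (simp_all add: \<rho>_def)
  have \<rho>out: "\<rho> n k z = 0" if "z \<notin> ?B n" for n k z
  proof (cases "0 < r n")
    case True
    have "(r n)\<^sup>2 \<le> (cmod (z - a n))\<^sup>2"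
      using that True by (intro power_mono) (auto simp: dist_norm norm_minus_commute)
    then show ?thesis using disc_density_bounds(3)[of "(r n)\<^sup>2" "(cmod (z - a n))\<^sup>2" k] True by (simp add: \<rho>_def)
  qed (simp add: \<rho>_def)
  have c\<rho>: "continuous_on X (\<lambda>z. \<rho> n k (f z))" if "continuous_on X f" for f :: "real \<times> real \<Rightarrow> complex" and X n k
  proof (cases "0 < r n")
    case True
    then have "(r n)\<^sup>2 > 0" by simp
    then have "continuous_on X (\<lambda>z. disc_density k ((r n)\<^sup>2) ((cmod (f z - a n))\<^sup>2))"
      by (rule continuous_on_compose2[OF continuous_disc(2)]) (auto intro!: continuous_intros that)
    then show ?thesis using True by (simp add: \<rho>_def)
  qed (simp add: \<rho>_def)
  have cP: "continuous_on Q ?P" and cJ: "continuous_on Q ?J"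
    unfolding Q_def by (rule continuous_box continuous_box_J)+
  have int: "F integrable_on Q" if "continuous_on Q F" for F :: "real \<times> real \<Rightarrow> real"
    using box_integrable that unfolding Q_def .
  have area: "swept_area = integral Q (\<lambda>z. \<bar>?J z\<bar>)"
    unfolding swept_area_def Q_def by (rule box_integral) (intro continuous_intros continuous_box_J)
  have mass: "disc_mass k * D n = \<bar>integral Q (\<lambda>z. \<rho> n k (?P z) * ?J z)\<bar>" for n k
  proof (cases "0 < r n")
    case True
    have out: "r n \<le> cmod (w - a n)" if "w \<in> T" for w
    proof -
      have "w \<notin> ?B n" using off[of n] that by blast
      then show ?thesis by (simp add: dist_norm norm_minus_commute)
    qed
    have "of_real (disc_mass k * (pi * (r n)\<^sup>2)) * (loop_winding (p 1) (a n) - loop_winding (p 0) (a n)) =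
      complex_of_real (integral {0..1} (\<lambda>t. integral {0..2 * pi} (\<lambda>x. \<rho> n k (p t x) * J t x)))"
      using disc_swept[OF True, of "a n" k] out True by (simp add: T_def \<rho>_def)
    also have "integral {0..1} (\<lambda>t. integral {0..2 * pi} (\<lambda>x. \<rho> n k (p t x) * J t x)) =
        integral Q (\<lambda>z. \<rho> n k (?P z) * ?J z)"
      unfolding Q_def by (rule box_integral) (intro continuous_intros c\<rho> continuous_box continuous_box_J)
    finally have "cmod (of_real (disc_mass k * (pi * (r n)\<^sup>2)) * (loop_winding (p 1) (a n) - loop_winding (p 0) (a n)))
       = \<bar>integral Q (\<lambda>z. \<rho> n k (?P z) * ?J z)\<bar>" by simp
    moreover have "cmod (of_real (disc_mass k * (pi * (r n)\<^sup>2)) * (loop_winding (p 1) (a n) - loop_winding (p 0) (a n)))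
       = disc_mass k * D n"
      unfolding norm_mult[of "of_real _"] norm_of_real D_def winding_change_def
      using disc_mass_bounds(1)[of k] by (simp add: abs_mult)
    ultimately show ?thesis by simp
  next
    case False
    then show ?thesis using r[of n] by (simp add: D_def \<rho>_def)
  qed
  have \<rho>sum: "(\<Sum>n<K. \<rho> n k z) = (if m < K then \<rho> m k z else 0)" if "z \<in> ?B m" for m K k z
  proof -
    have "z \<notin> ?B n" if "n \<noteq> m" for n
      using disjoint_family_onD[OF disj UNIV_I UNIV_I that] \<open>z \<in> ?B m\<close> by blast
    then have "\<rho> n k z = (if n = m then \<rho> m k z else 0)" for n
      by (cases "n = m") (simp_all add: \<rho>out del: mem_ball)
    then have "(\<Sum>n<K. \<rho> n k z) = (\<Sum>n<K. if n = m then \<rho> m k z else 0)" by (intro sum.cong) auto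
    then show ?thesis by (simp add: sum.delta)
  qed
  have \<rho>sum0: "0 \<le> (\<Sum>n<K. \<rho> n k z)" for K k z by (intro sum_nonneg \<rho>0)
  have \<rho>sum1: "(\<Sum>n<K. \<rho> n k z) \<le> 1" for K k z
  proof (cases "\<exists>m. z \<in> ?B m")
    case True
    then obtain m where "z \<in> ?B m" ..
    from \<rho>sum[OF this, of k K] \<rho>1 show ?thesis by simp
  next
    case False
    then have "\<rho> n k z = 0" for n using \<rho>out by blast
    then show ?thesis by simp
  qed
  \<comment> \<open>At every point at most one of the densities is nonzero, so together they are bounded by 1.\<close>
  have part: "(\<Sum>n<K. disc_mass k * D n) \<le> swept_area" for K k
  proof -
    have "(\<Sum>n<K. disc_mass k * D n) \<le> (\<Sum>n<K. integral Q (\<lambda>z. \<rho> n k (?P z) * \<bar>?J z\<bar>))"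
    proof (rule sum_mono)
      fix n
      have "\<bar>integral Q (\<lambda>z. \<rho> n k (?P z) * ?J z)\<bar> \<le> integral Q (\<lambda>z. \<rho> n k (?P z) * \<bar>?J z\<bar>)"
        using integral_norm_bound_integral[of "\<lambda>z. \<rho> n k (?P z) * ?J z" Q "\<lambda>z. \<rho> n k (?P z) * \<bar>?J z\<bar>"] \<rho>0
        by (simp add: abs_mult int continuous_on_mult c\<rho> cP cJ continuous_on_rabs)
      then show "disc_mass k * D n \<le> integral Q (\<lambda>z. \<rho> n k (?P z) * \<bar>?J z\<bar>)" by (simp add: mass)
    qed
    also have "\<dots> = integral Q (\<lambda>z. \<Sum>n<K. \<rho> n k (?P z) * \<bar>?J z\<bar>)"
      by (rule integral_sum[symmetric]) (auto intro!: int continuous_intros c\<rho> cP cJ)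
    also have "\<dots> = integral Q (\<lambda>z. (\<Sum>n<K. \<rho> n k (?P z)) * \<bar>?J z\<bar>)"
      by (simp add: sum_distrib_right)
    also have "\<dots> \<le> integral Q (\<lambda>z. \<bar>?J z\<bar>)"
    proof (rule integral_le)
      fix z
      show "(\<Sum>n<K. \<rho> n k (?P z)) * \<bar>?J z\<bar> \<le> \<bar>?J z\<bar>"
        using mult_right_mono[OF \<rho>sum1[of k "?P z" K], of "\<bar>?J z\<bar>"] by simp
    qed (auto intro!: int continuous_intros c\<rho> cP cJ)
    finally show ?thesis using area by simp
  qed
  have mass_lim: "disc_mass \<longlonglongrightarrow> 1"
  proof -
    have "(\<lambda>n. 1 / (real n + 2)) \<longlonglongrightarrow> 0"
      using LIMSEQ_inverse_real_of_nat_add[of 0] LIMSEQ_ignore_initial_segment[OF lim_inverse_n', of 2] by (simp add: inverse_eq_divide add.commute)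
    from tendsto_diff[OF tendsto_const[of 1] this] show ?thesis unfolding disc_mass_def by simp
  qed
  have sumD: "(\<Sum>n<K. D n) \<le> swept_area" for K
  proof (rule LIMSEQ_le_const2)
    show "(\<lambda>k. disc_mass k * (\<Sum>n<K. D n)) \<longlonglongrightarrow> (\<Sum>n<K. D n)"
      using tendsto_mult_right[OF mass_lim, of "\<Sum>n<K. D n"] by simp
    show "\<exists>N. \<forall>k\<ge>N. disc_mass k * (\<Sum>n<K. D n) \<le> swept_area"
      using part by (simp add: sum_distrib_left)
  qed
  have sm: "summable D" by (rule summableI_nonneg_bounded[OF D0 sumD])
  have flat: "integral\<^sup>L lebesgue f = (\<Sum>n. D n)"
  proof -
    have "D n = f (a n) * (pi * (r n)\<^sup>2)" for n
      using r[of n] fB[of "a n" n] by (cases "r n = 0") (auto simp: D_def)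
    then have eq: "D = (\<lambda>n. f (a n) * (pi * (r n)\<^sup>2))" by (rule ext)
    show ?thesis using integral_constant_on_balls[of r a f, OF r disj neg' f0 const sm[unfolded eq]] unfolding eq .
  qed
  show le: "integral\<^sup>L lebesgue f \<le> swept_area"
    unfolding flat by (rule suminf_le_const[OF sm sumD])
  show "integral\<^sup>L lebesgue f = swept_area"
    if \<sigma>: "\<And>t x. t \<in> {0..1} \<Longrightarrow> 0 < \<sigma> * J t x" "\<bar>\<sigma>\<bar> = 1"
  proof (rule antisym[OF le])
    have J\<sigma>: "\<bar>?J z\<bar> = \<sigma> * ?J z" if "z \<in> Q" for z
    proof -
      have "\<bar>?J z\<bar> = \<bar>\<sigma> * ?J z\<bar>" using \<sigma>(2) by (simp add: abs_mult)
      also have "\<dots> = \<sigma> * ?J z" using \<sigma>(1)[of "fst z" "snd z"] that by (auto simp: Q_def mem_Times_iff)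
      finally show ?thesis .
    qed
    \<comment> \<open>The Jacobian does not vanish, so the points that are moved outside all discs form a null set.\<close>
    define N where "N = {z \<in> Q. ?P z \<in> - (\<Union>n. ?B n)}"
    have "negligible N"
      unfolding N_def
    proof (rule negligible_vimage_immersion[OF neg'])
      fix z assume z: "z \<in> Q"
      then have t: "fst z \<in> {0..1}" by (auto simp: Q_def)
      have "Q \<subseteq> {0..1} \<times> UNIV" by (auto simp: Q_def)
      from has_derivative_subset[OF deriv_total[OF t, of "snd z"] this]
      show "(?P has_derivative (\<lambda>v. fst v *\<^sub>R pt (fst z) (snd z) + snd v *\<^sub>R px (fst z) (snd z))) (at z within Q)"
        by simp
      show "Im (cnj (pt (fst z) (snd z)) * px (fst z) (snd z)) \<noteq> 0"
        using \<sigma>(1)[OF t, of "snd z"] unfolding J_def by auto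
    qed
    let ?f = "\<lambda>k z. (\<Sum>n<k. \<rho> n k (?P z)) * \<bar>?J z\<bar>"
    have fk: "integral Q (?f k) \<le> (\<Sum>n. D n)" for k
    proof -
      have "integral Q (?f k) = integral Q (\<lambda>z. \<Sum>n<k. \<rho> n k (?P z) * \<bar>?J z\<bar>)"
        by (simp add: sum_distrib_right)
      also have "\<dots> = (\<Sum>n<k. integral Q (\<lambda>z. \<rho> n k (?P z) * \<bar>?J z\<bar>))"
        by (rule integral_sum) (auto intro!: int continuous_intros c\<rho> cP cJ)
      also have "\<dots> \<le> (\<Sum>n<k. D n)"
      proof (rule sum_mono)
        fix n
        have "integral Q (\<lambda>z. \<rho> n k (?P z) * \<bar>?J z\<bar>) = integral Q (\<lambda>z. \<sigma> * (\<rho> n k (?P z) * ?J z))"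
          by (rule integral_cong) (simp add: J\<sigma>)
        also have "\<dots> = \<sigma> * integral Q (\<lambda>z. \<rho> n k (?P z) * ?J z)" by (rule integral_mult_right)
        also have "\<dots> \<le> \<bar>\<sigma> * integral Q (\<lambda>z. \<rho> n k (?P z) * ?J z)\<bar>" by (rule abs_ge_self)
        also have "\<dots> = disc_mass k * D n" using \<sigma>(2) by (simp add: mass abs_mult)
        also have "\<dots> \<le> 1 * D n" using disc_mass_bounds(2)[of k] D0[of n] by (intro mult_right_mono) auto
        finally show "integral Q (\<lambda>z. \<rho> n k (?P z) * \<bar>?J z\<bar>) \<le> D n" by simp
      qed
      also have "\<dots> \<le> (\<Sum>n. D n)" by (rule sum_le_suminf[OF sm]) (auto simp: D0)
      finally show ?thesis .
    qed
    let ?g = "\<lambda>k z. if z \<in> N then 0 else ?f k z" and ?h = "\<lambda>z. if z \<in> N then 0 else \<bar>?J z\<bar>"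
    have cf: "continuous_on Q (?f k)" for k by (intro continuous_intros c\<rho> cP cJ)
    \<comment> \<open>Number of discs and sharpness of their densities grow together; off the null set the sum of the
    densities tends to 1.\<close>
    have "(\<lambda>k. integral Q (?g k)) \<longlonglongrightarrow> integral Q ?h"
    proof (rule dominated_convergence(2))
      show "?g k integrable_on Q" for k
        by (rule integrable_spike[OF int[OF cf[of k]] \<open>negligible N\<close>]) auto
      show "(\<lambda>z. \<bar>?J z\<bar>) integrable_on Q" by (intro int continuous_intros cJ)
      show "norm (?g k z) \<le> \<bar>?J z\<bar>" for k z
        using mult_right_mono[OF \<rho>sum1[of k "?P z" k], of "\<bar>?J z\<bar>"] \<rho>sum0[of k "?P z" k] by (simp add: abs_mult)
      fix z assume z: "z \<in> Q"
      show "(\<lambda>k. ?g k z) \<longlonglongrightarrow> ?h z"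
      proof (cases "z \<in> N")
        case False
        then obtain m where m: "?P z \<in> ?B m" using z by (auto simp: N_def)
        have lt: "cmod (?P z - a m) < r m" using m by (simp add: dist_norm norm_minus_commute)
        then have rm: "0 < r m" using norm_ge_zero[of "?P z - a m"] by linarith
        have "(cmod (?P z - a m))\<^sup>2 < (r m)\<^sup>2" using lt by (intro power_strict_mono) auto
        then have "(\<lambda>k. \<rho> m k (?P z)) \<longlonglongrightarrow> 1"
          using disc_density_limit[of "(cmod (?P z - a m))\<^sup>2" "(r m)\<^sup>2"] rm by (simp add: \<rho>_def)
        moreover have "\<forall>\<^sub>F k in sequentially. \<rho> m k (?P z) = (\<Sum>n<k. \<rho> n k (?P z))"
          using eventually_gt_at_top[of m] by eventually_elim (simp add: \<rho>sum[OF m])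
        ultimately have "(\<lambda>k. \<Sum>n<k. \<rho> n k (?P z)) \<longlonglongrightarrow> 1" by (rule Lim_transform_eventually)
        from tendsto_mult[OF this tendsto_const[of "\<bar>?J z\<bar>"]] show ?thesis using False by simp
      qed simp
    qed
    moreover have "integral Q (?g k) = integral Q (?f k)" for k
      by (rule integral_spike[OF \<open>negligible N\<close>]) simp
    moreover have "integral Q ?h = swept_area"
      unfolding area by (rule integral_spike[OF \<open>negligible N\<close>]) simp
    ultimately have "(\<lambda>k. integral Q (?f k)) \<longlonglongrightarrow> swept_area" by simp
    then show "swept_area \<le> integral\<^sup>L lebesgue f"
      unfolding flat by (rule LIMSEQ_le_const2) (use fk in auto)
  qed
qed

end

section \<open>Invariance under reparametrization\<close>

lemma integral_period_shift:
  fixes f :: "real \<Rightarrow> 'b::banach"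
  assumes c: "continuous_on UNIV f" and per: "\<And>x. f (x + 2 * pi) = f x"
  shows "integral {a..a + 2 * pi} f = integral {0..2 * pi} f"
proof -
  interpret periodic_fun_simple f "2 * pi" by unfold_locales (rule per)
  define k where "k = of_int \<lfloor>a / (2 * pi)\<rfloor> * (2 * pi)"
  define b where "b = a - k"
  have b: "0 \<le> b" "b \<le> 2 * pi"
    using floor_divide_lower[of "2 * pi" a] floor_divide_upper[of "2 * pi" a]
    unfolding b_def k_def by (simp_all add: algebra_simps)
  have int: "f integrable_on {x..y}" for x y
    by (intro integrable_continuous_real continuous_on_subset[OF c]) simp
  have fk: "f (k + x) = f x" for x unfolding k_def by (metis add.commute plus_of_int)
  have "integral {a..a + 2 * pi} f = integral {b..b + 2 * pi} (f \<circ> (+) k)"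
    unfolding integral_shift_Icc_real b_def by (simp add: algebra_simps)
  also have "f \<circ> (+) k = f" by (auto simp: fk)
  also have "integral {b..b + 2 * pi} f = integral {b..2 * pi} f + integral {2 * pi..b + 2 * pi} f"
    using b by (intro Henstock_Kurzweil_Integration.integral_combine[symmetric] int) auto
  also have "integral {2 * pi..b + 2 * pi} f = integral {0..b} (f \<circ> (+) (2 * pi))"
    unfolding integral_shift_Icc_real by simp
  also have "f \<circ> (+) (2 * pi) = f" using per by (auto simp: add.commute)
  also have "integral {b..2 * pi} f + integral {0..b} f = integral {0..2 * pi} f"
    using b Henstock_Kurzweil_Integration.integral_combine[of 0 b "2 * pi" f] int by (simp add: add.commute)
  finally show ?thesis .
qed

lemma circle_diffeos_posD:
  assumes "\<psi> \<in> circle_diffeos_pos"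
  shows "(\<psi> has_real_derivative deriv \<psi> x) (at x)" "0 < deriv \<psi> x" "\<psi> (x + 2 * pi) = \<psi> x + 2 * pi"
    and "continuous_on UNIV (deriv \<psi>)"
proof -
  have sm: "smooth_in UNIV \<psi>" using assms by (simp add: circle_diffeos_pos_def smooth_on_UNIV_iff)
  have d: "(\<psi> has_real_derivative vector_derivative \<psi> (at x)) (at x)" for x
    using smooth_in_vector_derivative(1)[OF sm, of x] by (simp add: has_real_derivative_iff_has_vector_derivative)
  then have eq: "deriv \<psi> = (\<lambda>x. vector_derivative \<psi> (at x))" by (auto intro: DERIV_imp_deriv)
  show "(\<psi> has_real_derivative deriv \<psi> x) (at x)" unfolding eq by (rule d)
  show "0 < deriv \<psi> x" "\<psi> (x + 2 * pi) = \<psi> x + 2 * pi" using assms by (simp_all add: circle_diffeos_pos_def)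
  show "continuous_on UNIV (deriv \<psi>)"
    unfolding eq by (rule smooth_in_continuous_on[OF smooth_in_vector_derivative(2)[OF sm]])
qed

lemma circle_diffeo_continuous: "\<psi> \<in> circle_diffeos_pos \<Longrightarrow> continuous_on X \<psi>"
  by (rule continuous_at_imp_continuous_on) (use DERIV_isCont[OF circle_diffeos_posD(1)] in simp)

lemma integral_circle_diffeo:
  fixes f :: "real \<Rightarrow> 'b::euclidean_space"
  assumes c: "continuous_on UNIV f" and per: "\<And>x. f (x + 2 * pi) = f x" and \<psi>: "\<psi> \<in> circle_diffeos_pos"
  shows "integral {0..2 * pi} (\<lambda>x. deriv \<psi> x *\<^sub>R f (\<psi> x)) = integral {0..2 * pi} f"
proof -
  have "compact (\<psi> ` {0..2 * pi})"
    by (intro compact_continuous_image circle_diffeo_continuous[OF \<psi>] compact_Icc)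
  from bounded_subset_cbox_symmetric[OF compact_imp_bounded[OF this]]
  obtain u where lu: "\<psi> ` {0..2 * pi} \<subseteq> {- u..u}" unfolding cbox_interval .
  have "((\<lambda>x. deriv \<psi> x *\<^sub>R f (\<psi> x)) has_integral integral {\<psi> 0..\<psi> (2 * pi)} f) {0..2 * pi}"
  proof (rule has_integral_substitution[OF _ _ lu])
    show "\<psi> 0 \<le> \<psi> (2 * pi)" using circle_diffeos_posD(3)[OF \<psi>, of 0] by simp
    show "continuous_on {- u..u} f" by (rule continuous_on_subset[OF c]) simp
    show "(\<psi> has_real_derivative deriv \<psi> x) (at x within {0..2 * pi})" for x
      by (rule has_field_derivative_at_within[OF circle_diffeos_posD(1)[OF \<psi>]])
  qed simp
  then show ?thesis
    using integral_period_shift[OF c per, of "\<psi> 0"] circle_diffeos_posD(3)[OF \<psi>, of 0]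
    by (simp add: integral_unique)
qed

lemma circle_diffeo_surj:
  assumes \<psi>: "\<psi> \<in> circle_diffeos_pos"
  shows "surj \<psi>"
proof -
  interpret periodic_fun_simple "\<lambda>x. \<psi> x - x" "2 * pi"
    by unfold_locales (simp add: circle_diffeos_posD(3)[OF \<psi>])
  have k: "\<psi> (of_int k * (2 * pi)) = \<psi> 0 + of_int k * (2 * pi)" for k :: int
    using plus_of_int[of 0 k] by (simp add: algebra_simps)
  have "\<exists>x. \<psi> x = y" for y
  proof -
    define k where "k = \<lfloor>(y - \<psi> 0) / (2 * pi)\<rfloor>"
    have le: "\<psi> (of_int k * (2 * pi)) \<le> y" "y \<le> \<psi> (of_int (k + 1) * (2 * pi))"
      using floor_divide_lower[of "2 * pi" "y - \<psi> 0"] floor_divide_upper[of "2 * pi" "y - \<psi> 0"]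
      unfolding k k_def by (simp_all add: algebra_simps)
    have "of_int k * (2 * pi) \<le> of_int (k + 1) * (2 * pi)" by (intro mult_right_mono) auto
    from IVT'[OF le this circle_diffeo_continuous[OF \<psi>]] show ?thesis by blast
  qed
  then show ?thesis by (metis surjI)
qed

lemma ImmD:
  assumes "c \<in> Imm"
  shows "smooth_in UNIV c" "(c has_vector_derivative vector_derivative c (at x)) (at x)"
    "c (x + 2 * pi) = c x" "vector_derivative c (at x) \<noteq> 0"
    "continuous_on UNIV (\<lambda>x. vector_derivative c (at x))"
    "vector_derivative c (at (x + 2 * pi)) = vector_derivative c (at x)"
proof -
  show sm: "smooth_in UNIV c" using assms by (simp add: Imm_def smooth_on_UNIV_iff)
  show d: "(c has_vector_derivative vector_derivative c (at x)) (at x)" for x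
    by (rule smooth_in_vector_derivative(1)[OF sm]) simp
  show p: "c (x + 2 * pi) = c x" for x using assms by (simp add: Imm_def)
  show "vector_derivative c (at x) \<noteq> 0" using assms by (simp add: Imm_def)
  show "continuous_on UNIV (\<lambda>x. vector_derivative c (at x))"
    by (rule smooth_in_continuous_on[OF smooth_in_vector_derivative(2)[OF sm]])
  have "((\<lambda>x. x + 2 * pi) has_vector_derivative 1) (at x)"
    by (auto intro!: derivative_eq_intros)
  from vector_diff_chain_at[OF this d[of "x + 2 * pi"]]
  have "(c has_vector_derivative vector_derivative c (at (x + 2 * pi))) (at x)"
    by (simp add: o_def p)
  from vector_derivative_unique_at[OF this d]
  show "vector_derivative c (at (x + 2 * pi)) = vector_derivative c (at x)" .
qed

lemma vector_derivative_reparam: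
  assumes c: "c \<in> Imm" and \<psi>: "\<psi> \<in> circle_diffeos_pos"
  shows "((c \<circ> \<psi>) has_vector_derivative deriv \<psi> x *\<^sub>R vector_derivative c (at (\<psi> x))) (at x)"
proof (rule vector_diff_chain_at)
  show "(\<psi> has_vector_derivative deriv \<psi> x) (at x)"
    using circle_diffeos_posD(1)[OF \<psi>] by (simp add: has_real_derivative_iff_has_vector_derivative)
qed (rule ImmD(2)[OF c])

lemma range_reparam: "\<psi> \<in> circle_diffeos_pos \<Longrightarrow> range (c \<circ> \<psi>) = range c"
  unfolding image_comp[symmetric] by (simp only: circle_diffeo_surj)

lemma curve_length_reparam:
  assumes c: "c \<in> Imm" and \<psi>: "\<psi> \<in> circle_diffeos_pos"
  shows "curve_length (c \<circ> \<psi>) = curve_length c"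
proof -
  have "curve_length (c \<circ> \<psi>) = integral {0..2 * pi} (\<lambda>x. deriv \<psi> x *\<^sub>R norm (vector_derivative c (at (\<psi> x))))"
    unfolding curve_length_def vector_derivative_at[OF vector_derivative_reparam[OF assms]]
    using circle_diffeos_posD(2)[OF \<psi>] by (simp add: less_imp_le)
  also have "\<dots> = curve_length c"
    unfolding curve_length_def
    by (rule integral_circle_diffeo[OF _ _ \<psi>]) (auto intro!: continuous_on_norm ImmD(5)[OF c] simp: ImmD(6)[OF c])
  finally show ?thesis .
qed

lemma loop_winding_reparam:
  assumes c: "c \<in> Imm" and \<psi>: "\<psi> \<in> circle_diffeos_pos" and z: "z \<notin> range c"
  shows "loop_winding (c \<circ> \<psi>) z = loop_winding c z"
proof -
  let ?c' = "\<lambda>x. vector_derivative c (at x)"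
  have cc: "continuous_on UNIV (\<lambda>x. deriv \<psi> x *\<^sub>R ?c' (\<psi> x))"
    by (intro continuous_on_scaleR circle_diffeos_posD(4)[OF \<psi>] continuous_on_compose2[OF ImmD(5)[OF c] circle_diffeo_continuous[OF \<psi>]]) simp
  have "z \<notin> range (c \<circ> \<psi>)" using z by auto
  then have "loop_winding (c \<circ> \<psi>) z = 1 / (2 * pi * \<i>) * integral {0..2 * pi} (\<lambda>x. (deriv \<psi> x *\<^sub>R ?c' (\<psi> x)) / ((c \<circ> \<psi>) x - z))"
    by (rule loop_winding_integral[OF vector_derivative_reparam[OF c \<psi>] cc])
  also have "integral {0..2 * pi} (\<lambda>x. (deriv \<psi> x *\<^sub>R ?c' (\<psi> x)) / ((c \<circ> \<psi>) x - z)) =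
      integral {0..2 * pi} (\<lambda>x. deriv \<psi> x *\<^sub>R (?c' (\<psi> x) / (c (\<psi> x) - z)))"
    by (simp only: scaleR_conv_of_real o_def times_divide_eq_right)
  also have "\<dots> = integral {0..2 * pi} (\<lambda>x. ?c' x / (c x - z))"
  proof (rule integral_circle_diffeo[OF _ _ \<psi>])
    show "continuous_on UNIV (\<lambda>x. ?c' x / (c x - z))"
      using z by (intro continuous_on_divide ImmD(5)[OF c] continuous_on_diff smooth_in_continuous_on[OF ImmD(1)[OF c]] continuous_on_const) auto
  qed (simp add: ImmD(3,6)[OF c])
  finally show ?thesis unfolding loop_winding_integral[OF ImmD(2)[OF c] ImmD(5)[OF c] z] .
qed

lemma id_circle_diffeo: "(\<lambda>x. x) \<in> circle_diffeos_pos"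
  by (simp add: circle_diffeos_pos_def smooth_on_UNIV_iff smooth_in_ident)

lemma oriented_curveE:
  assumes "q \<in> oriented_curve c"
  obtains \<psi> where "c \<in> Imm" "q \<in> Imm" "\<psi> \<in> circle_diffeos_pos" "q = c \<circ> \<psi>"
  using assms by (auto simp: oriented_curve_def oriented_reparam_def)

lemma oriented_curveI:
  assumes "c \<in> Imm" "q \<in> Imm" "\<psi> \<in> circle_diffeos_pos" "q = c \<circ> \<psi>"
  shows "q \<in> oriented_curve c"
  using assms by (auto simp: oriented_curve_def oriented_reparam_def)

lemma oriented_curve_self: "c \<in> Imm \<Longrightarrow> c \<in> oriented_curve c"
  by (rule oriented_curveI[OF _ _ id_circle_diffeo]) auto

lemma oriented_curve_range_winding:
  assumes "q \<in> oriented_curve c"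
  shows "range q = range c" "z \<notin> range c \<Longrightarrow> loop_winding q z = loop_winding c z"
proof -
  obtain \<psi> where *: "c \<in> Imm" "q \<in> Imm" "\<psi> \<in> circle_diffeos_pos" "q = c \<circ> \<psi>"
    using oriented_curveE[OF assms] .
  show "range q = range c" unfolding *(4) by (rule range_reparam[OF *(3)])
  show "z \<notin> range c \<Longrightarrow> loop_winding q z = loop_winding c z"
    unfolding *(4) by (rule loop_winding_reparam[OF *(1,3)])
qed

text \<open>The representative that \<open>curve_winding\<close> selects is some parametrization of the same oriented curve.\<close>

lemma curve_winding_loop_winding:
  assumes q: "q \<in> oriented_curve c" and z: "z \<notin> range q"
  shows "curve_winding (oriented_curve c) z = loop_winding q z"
proof -
  define s where "s = (SOME c'. c' \<in> oriented_curve c)"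
  have s: "s \<in> oriented_curve c" unfolding s_def by (rule someI[of "\<lambda>c'. c' \<in> oriented_curve c", OF q])
  have zc: "z \<notin> range c" using z oriented_curve_range_winding(1)[OF q] by simp
  show ?thesis
    using oriented_curve_range_winding(2)[OF s zc] oriented_curve_range_winding(2)[OF q zc]
    unfolding curve_winding_def s_def[symmetric] loop_winding_def by simp
qed

context loop_homotopy
begin

lemma
  assumes "p 0 \<in> oriented_curve c0" "p 1 \<in> oriented_curve c1"
  shows d_flat_le_swept_area: "d_flat (oriented_curve c0) (oriented_curve c1) \<le> swept_area"
    and d_flat_eq_swept_area: "(\<And>t x. t \<in> {0..1} \<Longrightarrow> 0 < \<sigma> * J t x) \<Longrightarrow> \<bar>\<sigma>\<bar> = 1 \<Longrightarrow>
      d_flat (oriented_curve c0) (oriented_curve c1) = swept_area"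
proof -
  let ?f = "\<lambda>z. cmod (curve_winding (oriented_curve c0) z - curve_winding (oriented_curve c1) z)"
  have f: "?f z = winding_change z" if "z \<notin> range (p 0) \<union> range (p 1)" for z
    using that curve_winding_loop_winding[OF assms(1)] curve_winding_loop_winding[OF assms(2)]
    by (simp add: winding_change_def norm_minus_commute)
  show "d_flat (oriented_curve c0) (oriented_curve c1) \<le> swept_area"
    unfolding d_flat_def by (rule flat_le_swept_area[of ?f]) (use f in simp_all)
  show "d_flat (oriented_curve c0) (oriented_curve c1) = swept_area"
    if "\<And>t x. t \<in> {0..1} \<Longrightarrow> 0 < \<sigma> * J t x" "\<bar>\<sigma>\<bar> = 1"
    unfolding d_flat_def by (rule flat_eq_swept_area[of ?f, OF _ _ that]) (use f in simp_all)
qed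

end

section \<open>The cost of a path\<close>

lemma one_plus_less_exp:
  fixes y :: real
  assumes "y \<noteq> 0"
  shows "1 + y < exp y"
proof (cases "0 \<le> 1 + y / 2")
  case True
  have "(1 + y / 2)\<^sup>2 \<le> (exp (y / 2))\<^sup>2" using True exp_ge_add_one_self[of "y / 2"] by (intro power_mono) auto
  also have "(exp (y / 2))\<^sup>2 = exp y" by (simp add: exp_double[symmetric])
  finally have "(1 + y / 2)\<^sup>2 \<le> exp y" .
  moreover have "(1 + y / 2)\<^sup>2 = 1 + y + (y / 2)\<^sup>2" by (simp add: power2_eq_square algebra_simps)
  moreover have "0 < (y / 2)\<^sup>2" using assms by simp
  ultimately show ?thesis by linarith
next
  case False
  then have "1 + y < 0" by simp
  then show ?thesis using exp_gt_zero[of y] by linarith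
qed

context loop_homotopy
begin

definition len :: "real \<Rightarrow> real" where
  "len t = integral {0..2 * pi} (\<lambda>x. cmod (px t x))"

definition energy :: "real \<Rightarrow> real" where
  "energy t = integral {0..2 * pi} (\<lambda>x. (J t x)\<^sup>2 / cmod (px t x))"

definition sweep_rate :: "real \<Rightarrow> real" where
  "sweep_rate t = integral {0..2 * pi} (\<lambda>x. \<bar>J t x\<bar>)"

lemma normal_velocity_eq:
  assumes t: "t \<in> {0..1}"
  shows "normal_velocity p t x = (- J t x / cmod (px t x)) *\<^sub>R unit_normal (p t) x"
    and "norm (unit_normal (p t) x) = 1"
    and "norm (normal_velocity p t x) = \<bar>J t x\<bar> / cmod (px t x)"
proof -
  have vt: "vector_derivative (\<lambda>s. p s x) (at t within {0..1}) = pt t x"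
    by (rule vector_derivative_within_cbox[of 0 1, unfolded cbox_interval]) (use t deriv_t[OF t] in simp_all)
  have vx: "vector_derivative (p t) (at x) = px t x" by (rule vector_derivative_at[OF deriv_x[OF t]])
  have n: "unit_normal (p t) x = (1 / cmod (px t x)) *\<^sub>R (\<i> * px t x)"
    unfolding unit_normal_def vx by (simp add: scaleR_conv_of_real)
  have i: "pt t x \<bullet> unit_normal (p t) x = - J t x / cmod (px t x)"
    unfolding n inner_scaleR_right by (simp add: inner_complex_def J_def algebra_simps diff_divide_distrib)
  show 1: "normal_velocity p t x = (- J t x / cmod (px t x)) *\<^sub>R unit_normal (p t) x"
    unfolding normal_velocity_def vt i ..
  show 2: "norm (unit_normal (p t) x) = 1"
    using immersed[OF t, of x] by (simp add: n norm_mult)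
  show "norm (normal_velocity p t x) = \<bar>J t x\<bar> / cmod (px t x)"
    unfolding 1 norm_scaleR 2 by simp
qed

lemma curve_length_eq: "t \<in> {0..1} \<Longrightarrow> curve_length (p t) = len t"
  unfolding curve_length_def len_def by (simp add: vector_derivative_at[OF deriv_x])

lemma G_eq:
  assumes t: "t \<in> {0..1}"
  shows "G \<phi> (p t) (normal_velocity p t) (normal_velocity p t) = \<phi> (len t) * energy t"
proof -
  have "(normal_velocity p t x \<bullet> normal_velocity p t x) * norm (vector_derivative (p t) (at x)) =
      (J t x)\<^sup>2 / cmod (px t x)" for x
    using immersed[OF t, of x] unfolding dot_square_norm normal_velocity_eq(3)[OF t] vector_derivative_at[OF deriv_x[OF t]]
    by (simp add: power2_eq_square)
  then show ?thesis unfolding G_def curve_length_eq[OF t] energy_def by simp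
qed

lemma continuous_len_energy_sweep:
  "continuous_on {0..1} len" "continuous_on {0..1} energy" "continuous_on {0..1} sweep_rate"
proof -
  have *: "continuous_on {0..1} (\<lambda>t. integral {0..2 * pi} (F t))"
    if "continuous_on ({0..1} \<times> {0..2 * pi}) (\<lambda>z. F (fst z) (snd z))" for F :: "real \<Rightarrow> real \<Rightarrow> real"
    using integral_continuous_on_param[of "{0..1}" 0 "2 * pi" F] that by (simp add: case_prod_unfold)
  show "continuous_on {0..1} len"
    unfolding len_def[abs_def] by (intro * continuous_intros continuous_box)
  show "continuous_on {0..1} energy"
    unfolding energy_def[abs_def] 
    by (intro * continuous_intros continuous_box continuous_box_J) (use immersed in \<open>auto simp: mem_Times_iff\<close>)
  show "continuous_on {0..1} sweep_rate"
    unfolding sweep_rate_def[abs_def] by (intro * continuous_intros continuous_box_J)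
qed

lemma path_cost_eq: "path_cost \<phi> p = integral {0..1} (\<lambda>t. sqrt (\<phi> (len t) * energy t))"
  unfolding path_cost_def by (rule integral_cong) (simp add: G_eq)

lemma len_pos:
  assumes t: "t \<in> {0..1}"
  shows "0 < len t"
proof -
  have c: "continuous_on {0..2 * pi} (\<lambda>x. cmod (px t x))" by (intro continuous_intros continuous_slices t)
  have "len t \<noteq> 0"
    using integral_eq_0_iff[OF c] immersed[OF t, of 0] unfolding len_def by fastforce
  moreover have "0 \<le> len t" unfolding len_def by (rule integral_nonneg) (use c in \<open>auto intro: integrable_continuous_real\<close>)
  ultimately show ?thesis by simp
qed

lemma sweep_rate_nonneg: "t \<in> {0..1} \<Longrightarrow> 0 \<le> sweep_rate t"
  unfolding sweep_rate_def
  by (rule integral_nonneg) (auto intro!: integrable_continuous_real continuous_on_rabs continuous_slice_J)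

lemma sweep_rate_pos:
  assumes t: "t \<in> {0..1}" and x: "J t x \<noteq> 0"
  shows "0 < sweep_rate t"
proof -
  have c: "continuous_on {0..2 * pi} (\<lambda>x. \<bar>J t x\<bar>)" by (intro continuous_on_rabs continuous_slice_J t)
  have "J t (x + 2 * pi) = J t x" for x unfolding J_def by (simp add: periodic_derivs[OF t])
  from range_periodic[of "J t", OF this] obtain y where y: "y \<in> {0..2 * pi}" "J t y = J t x"
    by (metis image_iff rangeI)
  have "sweep_rate t \<noteq> 0"
  proof
    assume "sweep_rate t = 0"
    then have "\<forall>x\<in>{0..2 * pi}. \<bar>J t x\<bar> = 0" using integral_eq_0_iff[OF c] unfolding sweep_rate_def by simp
    then show False using y x by simp
  qed
  then show ?thesis using sweep_rate_nonneg[OF t] by simp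
qed

text \<open>The Cauchy-Schwarz inequality for \<open>\<bar>J\<bar> / sqrt \<bar>px\<bar>\<close> and \<open>sqrt \<bar>px\<bar>\<close>, from the nonnegative integral of
  \<open>(\<bar>J\<bar> - k * \<bar>px\<bar>)\<^sup>2 / \<bar>px\<bar>\<close> at the minimizing \<open>k\<close>.\<close>

lemma sweep_rate_le:
  assumes t: "t \<in> {0..1}"
  shows "(sweep_rate t)\<^sup>2 \<le> len t * energy t"
proof -
  define k where "k = sweep_rate t / len t"
  have int: "(f has_integral integral {0..2 * pi} f) {0..2 * pi}" if "continuous_on {0..2 * pi} f" for f :: "real \<Rightarrow> real"
    using integrable_continuous_real[OF that] by (rule integrable_integral)
  have 1: "((\<lambda>x. cmod (px t x)) has_integral len t) {0..2 * pi}"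
    unfolding len_def by (rule int) (intro continuous_intros continuous_slices t)
  have 2: "((\<lambda>x. \<bar>J t x\<bar>) has_integral sweep_rate t) {0..2 * pi}"
    unfolding sweep_rate_def by (rule int) (intro continuous_intros continuous_slice_J t)
  have 3: "((\<lambda>x. (J t x)\<^sup>2 / cmod (px t x)) has_integral energy t) {0..2 * pi}"
    unfolding energy_def
    by (rule int) (intro continuous_intros continuous_slice_J continuous_slices t, use immersed[OF t] in simp)
  have "((\<lambda>x. (J t x)\<^sup>2 / cmod (px t x) - 2 * k * \<bar>J t x\<bar> + k\<^sup>2 * cmod (px t x)) has_integral
      energy t - 2 * k * sweep_rate t + k\<^sup>2 * len t) {0..2 * pi}"
    by (intro has_integral_add has_integral_diff has_integral_mult_right 1 2 3)
  then have "0 \<le> energy t - 2 * k * sweep_rate t + k\<^sup>2 * len t"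
  proof (rule has_integral_nonneg)
    fix x
    have "(J t x)\<^sup>2 / cmod (px t x) - 2 * k * \<bar>J t x\<bar> + k\<^sup>2 * cmod (px t x) =
        (\<bar>J t x\<bar> - k * cmod (px t x))\<^sup>2 / cmod (px t x)"
      using immersed[OF t, of x] by (simp add: power2_diff power2_eq_square field_simps)
    then show "0 \<le> (J t x)\<^sup>2 / cmod (px t x) - 2 * k * \<bar>J t x\<bar> + k\<^sup>2 * cmod (px t x)" by simp
  qed
  also have "energy t - 2 * k * sweep_rate t + k\<^sup>2 * len t = energy t - (sweep_rate t)\<^sup>2 / len t"
    using len_pos[OF t] by (simp add: k_def power2_eq_square field_simps)
  finally show ?thesis using len_pos[OF t] by (simp add: field_simps)
qed

text \<open>The bound \<open>x \<le> exp (x - 1)\<close> at \<open>x = A * len t\<close>, with equality for \<open>x = 1\<close> only, compares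
  \<open>exp (A * len t) / len t\<close> with \<open>A * exp 1\<close>.\<close>

lemma cost_rate_lower:
  assumes t: "t \<in> {0..1}" and A: "A > 0"
  shows "sqrt (A * exp 1) * sweep_rate t \<le> sqrt (exp (A * len t) * energy t)"
    and "len t < 1 / A \<Longrightarrow> 0 < sweep_rate t \<Longrightarrow> sqrt (A * exp 1) * sweep_rate t < sqrt (exp (A * len t) * energy t)"
proof -
  have e: "exp (A * len t) = exp 1 * exp (A * len t - 1)" by (simp add: exp_diff)
  have ge: "A * len t \<le> exp (A * len t - 1)" using exp_ge_add_one_self[of "A * len t - 1"] by simp
  have le: "(sweep_rate t)\<^sup>2 \<le> len t * energy t" by (rule sweep_rate_le[OF t])
  have en: "0 \<le> energy t"
    unfolding energy_def
    by (rule integral_nonneg) (auto intro!: integrable_continuous_real continuous_intros continuous_slice_J continuous_slices t simp: immersed[OF t])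
  have s: "sqrt (A * exp 1) * sweep_rate t = sqrt (A * exp 1 * (sweep_rate t)\<^sup>2)"
    using sweep_rate_nonneg[OF t] by (simp add: real_sqrt_mult)
  have m: "A * exp 1 * (sweep_rate t)\<^sup>2 \<le> A * exp 1 * (len t * energy t)"
    using A le by (intro mult_left_mono) auto
  also have m2: "A * exp 1 * (len t * energy t) = (exp 1 * (A * len t)) * energy t" by simp
  also have "\<dots> \<le> (exp 1 * exp (A * len t - 1)) * energy t"
    using ge en by (intro mult_right_mono mult_left_mono) auto
  finally show "sqrt (A * exp 1) * sweep_rate t \<le> sqrt (exp (A * len t) * energy t)"
    unfolding s e by (rule real_sqrt_le_mono)
  assume short: "len t < 1 / A" and pos: "0 < sweep_rate t"
  have "A * len t < 1" using short A by (simp add: field_simps)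
  then have "A * len t < exp (A * len t - 1)"
    using one_plus_less_exp[of "A * len t - 1"] by simp
  moreover have "0 < energy t"
  proof -
    have "0 < (sweep_rate t)\<^sup>2" using pos by simp
    then have "0 < len t * energy t" using le by linarith
    then show ?thesis using len_pos[OF t] by (simp add: zero_less_mult_iff)
  qed
  ultimately have "(exp 1 * (A * len t)) * energy t < (exp 1 * exp (A * len t - 1)) * energy t"
    by (intro mult_strict_right_mono mult_strict_left_mono) auto
  with m m2 show "sqrt (A * exp 1) * sweep_rate t < sqrt (exp (A * len t) * energy t)"
    unfolding s e by (intro real_sqrt_less_mono) linarith
qed

lemma path_cost_lower:
  assumes A: "A > 0" and \<phi>: "\<And>l. \<phi> l = exp (A * l)"
  shows "sqrt (A * exp 1) * swept_area \<le> path_cost \<phi> p"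
    and "\<lbrakk>t \<in> {0..1}; len t < 1 / A; J t x \<noteq> 0\<rbrakk> \<Longrightarrow> sqrt (A * exp 1) * swept_area < path_cost \<phi> p"
proof -
  let ?f = "\<lambda>t. sqrt (exp (A * len t) * energy t)" and ?g = "\<lambda>t. sqrt (A * exp 1) * sweep_rate t"
  have c: "continuous_on {0..1} ?f" "continuous_on {0..1} ?g"
    by (intro continuous_intros continuous_len_energy_sweep)+
  have cost: "path_cost \<phi> p = integral {0..1} ?f" by (simp add: path_cost_eq \<phi>)
  have area: "sqrt (A * exp 1) * swept_area = integral {0..1} ?g"
    unfolding swept_area_def sweep_rate_def[symmetric] by simp
  have diff: "integral {0..1} (\<lambda>t. ?f t - ?g t) = path_cost \<phi> p - sqrt (A * exp 1) * swept_area"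
    unfolding cost area by (rule Henstock_Kurzweil_Integration.integral_diff) (rule integrable_continuous_real[OF c(1)] integrable_continuous_real[OF c(2)])+
  have cd: "continuous_on {0..1} (\<lambda>t. ?f t - ?g t)" by (intro continuous_on_diff c)
  have nn: "0 \<le> ?f t - ?g t" if "t \<in> {0..1}" for t using cost_rate_lower(1)[OF that A] by simp
  have ge: "0 \<le> integral {0..1} (\<lambda>t. ?f t - ?g t)"
    by (rule integral_nonneg[OF integrable_continuous_real[OF cd] nn])
  then show "sqrt (A * exp 1) * swept_area \<le> path_cost \<phi> p" unfolding diff by simp
  assume t: "t \<in> {0..1}" "len t < 1 / A" "J t x \<noteq> 0"
  have "?f t - ?g t \<noteq> 0" using cost_rate_lower(2)[OF t(1) A t(2) sweep_rate_pos[OF t(1,3)]] by simp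
  then have "integral {0..1} (\<lambda>t. ?f t - ?g t) \<noteq> 0"
    using integral_eq_0_iff[OF cd _ nn] t(1) by auto
  with ge show "sqrt (A * exp 1) * swept_area < path_cost \<phi> p" unfolding diff by simp
qed

end

section \<open>Global solutions of Lipschitz differential equations\<close>

text \<open>Picard iteration. With respect to the weight \<open>exp (2 * K * t)\<close> the iteration contracts by the factor \<open>1 / 2\<close>
  on the whole interval at once.\<close>

lemma ode_global_solution:
  fixes f :: "real \<Rightarrow> real \<Rightarrow> real"
  assumes cont: "continuous_on ({0..1} \<times> UNIV) (\<lambda>z. f (fst z) (snd z))"
    and lip: "\<And>t x y. t \<in> {0..1} \<Longrightarrow> \<bar>f t x - f t y\<bar> \<le> K * \<bar>x - y\<bar>" and K: "K > 0"
  shows "\<exists>x. x 0 = x0 \<and> (\<forall>t\<in>{0..1}. (x has_vector_derivative f t (x t)) (at t within {0..1}))"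
proof -
  define X where "X = rec_nat (\<lambda>t. x0) (\<lambda>n x t. x0 + integral {0..t} (\<lambda>s. f s (x s)))"
  have X0: "X 0 = (\<lambda>t. x0)" and XS: "X (Suc n) = (\<lambda>t. x0 + integral {0..t} (\<lambda>s. f s (X n s)))" for n
    by (simp_all add: X_def)
  have cf: "continuous_on {0..1} (\<lambda>s. f s (x s))" if "continuous_on {0..1} x" for x
  proof -
    have "continuous_on {0..1} (\<lambda>s. (\<lambda>z. f (fst z) (snd z)) (s, x s))"
      by (rule continuous_on_compose2[OF cont]) (auto intro!: continuous_intros that)
    then show ?thesis by simp
  qed
  have cX: "continuous_on {0..1} (X n)" for n
  proof (induction n)
    case (Suc n)
    then show ?case unfolding XS
      by (intro continuous_intros indefinite_integral_continuous_1 integrable_continuous_real cf)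
  qed (simp add: X0)
  have int: "(\<lambda>s. f s (x s)) integrable_on {0..t}" if "continuous_on {0..1} x" "t \<in> {0..1}" for x t
    by (rule integrable_continuous_real[OF continuous_on_subset[OF cf[OF that(1)]]]) (use that in auto)
  have exp_int: "((\<lambda>s. K * exp (2 * K * s)) has_integral exp (2 * K * t) / 2 - 1 / 2) {0..t}" if "0 \<le> t" for t
  proof -
    have "((\<lambda>s. K * exp (2 * K * s)) has_integral exp (2 * K * t) / 2 - exp (2 * K * 0) / 2) {0..t}"
    proof (rule fundamental_theorem_of_calculus[OF that])
      fix s
      have "((\<lambda>s. exp (2 * K * s) / 2) has_real_derivative K * exp (2 * K * s)) (at s)"
        by (auto intro!: derivative_eq_intros)
      then show "((\<lambda>s. exp (2 * K * s) / 2) has_vector_derivative K * exp (2 * K * s)) (at s within {0..t})"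
        by (simp add: has_real_derivative_iff_has_vector_derivative has_vector_derivative_at_within)
    qed
    then show ?thesis by simp
  qed
  have "bounded (X 1 ` {0..1})"
    by (rule compact_imp_bounded) (intro compact_continuous_image cX compact_Icc)
  then obtain M0 where M0': "\<forall>t\<in>{0..1}. \<bar>X 1 t\<bar> \<le> M0"
    unfolding bounded_iff by auto
  have M0: "\<bar>X (Suc 0) t\<bar> \<le> M0" if "t \<in> {0..1}" for t using bspec[OF M0' that] by simp
  define M where "M = \<bar>M0\<bar> + \<bar>x0\<bar>"
  have step: "\<bar>X (Suc n) t - X n t\<bar> \<le> M * (1 / 2) ^ n * exp (2 * K * t)" if "t \<in> {0..1}" for n t
    using that
  proof (induction n arbitrary: t)
    case 0
    have "\<bar>X (Suc 0) t - X 0 t\<bar> \<le> M * 1" using M0[OF 0] by (simp add: X0 M_def)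
    also have "\<dots> \<le> M * exp (2 * K * t)" using 0 K by (intro mult_left_mono) (auto simp: M_def)
    finally show ?case by simp
  next
    case (Suc n)
    have "X (Suc (Suc n)) t - X (Suc n) t = integral {0..t} (\<lambda>s. f s (X (Suc n) s)) - integral {0..t} (\<lambda>s. f s (X n s))"
      by (simp only: XS)
    also have "\<dots> = integral {0..t} (\<lambda>s. f s (X (Suc n) s) - f s (X n s))"
      by (rule Henstock_Kurzweil_Integration.integral_diff[symmetric]) (intro int cX Suc.prems)+
    finally have eq: "X (Suc (Suc n)) t - X (Suc n) t = integral {0..t} (\<lambda>s. f s (X (Suc n) s) - f s (X n s))" .
    have ei: "((\<lambda>s. M * (1 / 2) ^ n * (K * exp (2 * K * s))) has_integral
        M * (1 / 2) ^ n * (exp (2 * K * t) / 2 - 1 / 2)) {0..t}"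
      by (intro has_integral_mult_right exp_int) (use Suc.prems in auto)
    have "norm (integral {0..t} (\<lambda>s. f s (X (Suc n) s) - f s (X n s))) \<le>
        integral {0..t} (\<lambda>s. M * (1 / 2) ^ n * (K * exp (2 * K * s)))"
    proof (rule integral_norm_bound_integral)
      show "(\<lambda>s. f s (X (Suc n) s) - f s (X n s)) integrable_on {0..t}"
        by (intro integrable_diff int cX Suc.prems)
      show "(\<lambda>s. M * (1 / 2) ^ n * (K * exp (2 * K * s))) integrable_on {0..t}" using ei by (rule has_integral_integrable)
      fix s assume "s \<in> {0..t}"
      then have s: "s \<in> {0..1}" using Suc.prems by auto
      have "\<bar>f s (X (Suc n) s) - f s (X n s)\<bar> \<le> K * \<bar>X (Suc n) s - X n s\<bar>" by (rule lip[OF s])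
      also have "\<dots> \<le> K * (M * (1 / 2) ^ n * exp (2 * K * s))" using Suc.IH[OF s] K by (intro mult_left_mono) auto
      finally show "norm (f s (X (Suc n) s) - f s (X n s)) \<le> M * (1 / 2) ^ n * (K * exp (2 * K * s))"
        by (simp add: mult_ac)
    qed
    also have "\<dots> = M * (1 / 2) ^ n * (exp (2 * K * t) / 2 - 1 / 2)" by (rule integral_unique[OF ei])
    also have "\<dots> \<le> M * (1 / 2) ^ n * (exp (2 * K * t) / 2)" by (intro mult_left_mono) (auto simp: M_def)
    finally show ?case unfolding eq by simp
  qed
  define B where "B = (\<lambda>n. M * exp (2 * K) * (1 / 2) ^ n)"
  have unif: "uniform_limit {0..1} (\<lambda>n t. \<Sum>i<n. X (Suc i) t - X i t) (\<lambda>t. \<Sum>i. X (Suc i) t - X i t) sequentially"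
  proof (rule Weierstrass_m_test)
    show "summable B" unfolding B_def by (intro summable_mult summable_geometric) simp
    fix n :: nat and t :: real assume t: "t \<in> {0..1}"
    have "exp (2 * K * t) \<le> exp (2 * K)" using t K by simp
    then have "M * (1 / 2) ^ n * exp (2 * K * t) \<le> M * (1 / 2) ^ n * exp (2 * K)"
      by (intro mult_left_mono) (auto simp: M_def)
    with step[OF t, of n] show "norm (X (Suc n) t - X n t) \<le> B n" unfolding B_def by (simp add: mult_ac)
  qed
  define x where "x = (\<lambda>t. x0 + (\<Sum>i. X (Suc i) t - X i t))"
  have tel: "X n t = x0 + (\<Sum>i<n. X (Suc i) t - X i t)" for n t
    using sum_lessThan_telescope[of "\<lambda>i. X i t" n] by (simp add: X0)
  have ul: "uniform_limit {0..1} X x sequentially"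
  proof -
    have "uniform_limit {0..1} (\<lambda>n t. x0 + (\<Sum>i<n. X (Suc i) t - X i t)) x sequentially"
      unfolding x_def by (intro uniform_limit_add unif uniform_limit_const)
    then show ?thesis unfolding tel[symmetric] .
  qed
  have cx: "continuous_on {0..1} x"
    by (rule uniform_limit_theorem[OF _ ul]) (simp_all add: cX)
  have eq: "x t = x0 + integral {0..t} (\<lambda>s. f s (x s))" if t: "t \<in> {0..1}" for t
  proof -
    have "uniform_limit {0..1} (\<lambda>n s. f s (X n s)) (\<lambda>s. f s (x s)) sequentially"
    proof (rule uniform_limitI)
      fix e :: real assume e: "e > 0"
      have "\<forall>\<^sub>F n in sequentially. \<forall>s\<in>{0..1}. dist (X n s) (x s) < e / K"
        using uniform_limitD[OF ul, of "e / K"] e K by simp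
      then show "\<forall>\<^sub>F n in sequentially. \<forall>s\<in>{0..1}. dist (f s (X n s)) (f s (x s)) < e"
      proof eventually_elim
        case (elim n)
        show ?case
        proof
          fix s :: real assume s: "s \<in> {0..1}"
          have "dist (f s (X n s)) (f s (x s)) \<le> K * dist (X n s) (x s)" using lip[OF s] by (simp add: dist_real_def)
          also have "\<dots> < e" using elim s K by (simp add: pos_less_divide_eq mult.commute)
          finally show "dist (f s (X n s)) (f s (x s)) < e" .
        qed
      qed
    qed
    then have "uniform_limit {0..t} (\<lambda>n s. f s (X n s)) (\<lambda>s. f s (x s)) sequentially"
      by (rule uniform_limit_on_subset) (use t in auto)
    then have ul_t: "uniform_limit (cbox 0 t) (\<lambda>n s. f s (X n s)) (\<lambda>s. f s (x s)) sequentially"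
      by (simp only: cbox_interval)
    have "(\<lambda>n. integral {0..t} (\<lambda>s. f s (X n s))) \<longlonglongrightarrow> integral {0..t} (\<lambda>s. f s (x s))"
    proof (rule uniform_limit_integral_cbox[OF ul_t])
      show "continuous_on (cbox 0 t) (\<lambda>s. f s (X n s))" for n
        by (rule continuous_on_subset[OF cf[OF cX]]) (use t in auto)
      fix I J
      assume I: "\<And>n. ((\<lambda>s. f s (X n s)) has_integral I n) (cbox 0 t)"
        and J: "((\<lambda>s. f s (x s)) has_integral J) (cbox 0 t)" and IJ: "I \<longlonglongrightarrow> J"
      have "(\<lambda>n. integral {0..t} (\<lambda>s. f s (X n s))) = I" "integral {0..t} (\<lambda>s. f s (x s)) = J"
        using integral_unique[OF I] integral_unique[OF J] by auto
      then show "(\<lambda>n. integral {0..t} (\<lambda>s. f s (X n s))) \<longlonglongrightarrow> integral {0..t} (\<lambda>s. f s (x s))"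
        using IJ by simp
    qed simp
    from tendsto_add[OF tendsto_const[of x0] this]
    have "(\<lambda>n. X (Suc n) t) \<longlonglongrightarrow> x0 + integral {0..t} (\<lambda>s. f s (x s))" by (simp only: XS)
    moreover have "(\<lambda>n. X (Suc n) t) \<longlonglongrightarrow> x t"
      by (rule LIMSEQ_Suc[OF tendsto_uniform_limitI[OF ul t]])
    ultimately show ?thesis using LIMSEQ_unique by metis
  qed
  have "(x has_vector_derivative f t (x t)) (at t within {0..1})" if t: "t \<in> {0..1}" for t
  proof -
    have "((\<lambda>t. x0 + integral {0..t} (\<lambda>s. f s (x s))) has_vector_derivative 0 + f t (x t)) (at t within {0..1})"
      by (intro has_vector_derivative_add has_vector_derivative_const integral_has_vector_derivative cf cx t)
    then have "((\<lambda>t. x0 + integral {0..t} (\<lambda>s. f s (x s))) has_vector_derivative f t (x t)) (at t within {0..1})" by simp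
    from has_vector_derivative_transform[of t "{0..1}" x, OF t eq this] show ?thesis .
  qed
  moreover have "x 0 = x0" using eq[of 0] by simp
  ultimately show ?thesis by blast
qed

text \<open>For the difference \<open>D\<close> of two solutions, \<open>exp (2 * K * t) * D\<^sup>2\<close> is nondecreasing and
  \<open>exp (- 2 * K * t) * D\<^sup>2\<close> is nonincreasing. The lower bound is what later excludes critical points of the flow.\<close>

lemma ode_distance:
  fixes f :: "real \<Rightarrow> real \<Rightarrow> real" and x y :: "real \<Rightarrow> real"
  assumes lip: "\<And>t x y. t \<in> {0..1} \<Longrightarrow> \<bar>f t x - f t y\<bar> \<le> K * \<bar>x - y\<bar>"
    and x: "\<And>t. t \<in> {0..1} \<Longrightarrow> (x has_vector_derivative f t (x t)) (at t within {0..1})"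
    and y: "\<And>t. t \<in> {0..1} \<Longrightarrow> (y has_vector_derivative f t (y t)) (at t within {0..1})"
    and t: "t \<in> {0..1}"
  shows "exp (- K * t) * \<bar>x 0 - y 0\<bar> \<le> \<bar>x t - y t\<bar>" and "\<bar>x t - y t\<bar> \<le> exp (K * t) * \<bar>x 0 - y 0\<bar>"
proof -
  let ?D = "\<lambda>t. x t - y t" and ?F = "\<lambda>t. f t (x t) - f t (y t)"
  have DF: "\<bar>?D s * ?F s\<bar> \<le> K * (?D s)\<^sup>2" if "s \<in> {0..1}" for s
  proof -
    have "\<bar>?D s\<bar> * \<bar>?F s\<bar> \<le> \<bar>?D s\<bar> * (K * \<bar>?D s\<bar>)" by (intro mult_left_mono lip[OF that]) simp
    then show ?thesis by (simp add: abs_mult power2_eq_square mult_ac)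
  qed
  have deriv: "((\<lambda>s. exp (2 * k * s) * (?D s)\<^sup>2) has_vector_derivative
      exp (2 * k * s) * (2 * (k * (?D s)\<^sup>2 + ?D s * ?F s))) (at s within {0..1})" if s: "s \<in> {0..1}" for s k
  proof -
    have "(?D has_real_derivative ?F s) (at s within {0..1})"
      using has_vector_derivative_diff[OF x[OF s] y[OF s]] by (simp add: has_real_derivative_iff_has_vector_derivative)
    moreover have "((\<lambda>s. exp (2 * k * s) * (D s)\<^sup>2) has_real_derivative
      exp (2 * k * s) * (2 * (k * (D s)\<^sup>2 + D s * F))) (at s within {0..1})"
      if "(D has_real_derivative F) (at s within {0..1})" for D F
      by (auto intro!: derivative_eq_intros that simp: algebra_simps power2_eq_square)
    ultimately have "((\<lambda>s. exp (2 * k * s) * (?D s)\<^sup>2) has_real_derivative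
      exp (2 * k * s) * (2 * (k * (?D s)\<^sup>2 + ?D s * ?F s))) (at s within {0..1})" by blast
    then show ?thesis by (simp add: has_real_derivative_iff_has_vector_derivative)
  qed
  have FTC: "((\<lambda>s. exp (2 * k * s) * (2 * (k * (?D s)\<^sup>2 + ?D s * ?F s))) has_integral
      exp (2 * k * t) * (?D t)\<^sup>2 - (?D 0)\<^sup>2) {0..t}" for k
  proof -
    have "((\<lambda>s. exp (2 * k * s) * (2 * (k * (?D s)\<^sup>2 + ?D s * ?F s))) has_integral
      exp (2 * k * t) * (?D t)\<^sup>2 - exp (2 * k * 0) * (?D 0)\<^sup>2) {0..t}"
    proof (rule fundamental_theorem_of_calculus)
      fix s assume "s \<in> {0..t}"
      then have s: "s \<in> {0..1}" and sub: "{0..t} \<subseteq> {0..1}" using t by auto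
      show "((\<lambda>s. exp (2 * k * s) * (?D s)\<^sup>2) has_vector_derivative
          exp (2 * k * s) * (2 * (k * (?D s)\<^sup>2 + ?D s * ?F s))) (at s within {0..t})"
        by (rule has_vector_derivative_within_subset[OF deriv[OF s] sub])
    qed (use t in simp)
    then show ?thesis by simp
  qed
  have e: "exp (2 * k * t) * (?D t)\<^sup>2 = (exp (k * t) * \<bar>?D t\<bar>)\<^sup>2" for k
    by (simp add: power_mult_distrib exp_double[symmetric] mult.assoc)
  have "0 \<le> exp (2 * K * t) * (?D t)\<^sup>2 - (?D 0)\<^sup>2"
  proof (rule has_integral_nonneg[OF FTC])
    fix s assume "s \<in> {0..t}"
    then have "s \<in> {0..1}" using t by auto
    from DF[OF this] have "0 \<le> K * (?D s)\<^sup>2 + ?D s * ?F s" by linarith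
    then show "0 \<le> exp (2 * K * s) * (2 * (K * (?D s)\<^sup>2 + ?D s * ?F s))" by simp
  qed
  then have "\<bar>?D 0\<bar>\<^sup>2 \<le> (exp (K * t) * \<bar>?D t\<bar>)\<^sup>2" unfolding e by simp
  then have "\<bar>?D 0\<bar> \<le> exp (K * t) * \<bar>?D t\<bar>" by (rule power2_le_imp_le) simp
  then have "exp (- K * t) * \<bar>?D 0\<bar> \<le> exp (- K * t) * (exp (K * t) * \<bar>?D t\<bar>)" by (rule mult_left_mono) simp
  also have "exp (- K * t) * (exp (K * t) * \<bar>?D t\<bar>) = \<bar>?D t\<bar>" by (simp add: mult.assoc[symmetric] exp_add[symmetric])
  finally show "exp (- K * t) * \<bar>x 0 - y 0\<bar> \<le> \<bar>x t - y t\<bar>" .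
  have "0 \<le> - (exp (2 * (- K) * t) * (?D t)\<^sup>2 - (?D 0)\<^sup>2)"
  proof (rule has_integral_nonneg[OF has_integral_neg[OF FTC]])
    fix s assume "s \<in> {0..t}"
    then have "s \<in> {0..1}" using t by auto
    from DF[OF this] have "- K * (?D s)\<^sup>2 + ?D s * ?F s \<le> 0" by linarith
    then show "0 \<le> - (exp (2 * (- K) * s) * (2 * ((- K) * (?D s)\<^sup>2 + ?D s * ?F s)))"
      by (simp add: mult_le_0_iff)
  qed
  then have "(exp (- K * t) * \<bar>?D t\<bar>)\<^sup>2 \<le> \<bar>?D 0\<bar>\<^sup>2" unfolding e by simp
  then have "exp (- K * t) * \<bar>?D t\<bar> \<le> \<bar>?D 0\<bar>" by (rule power2_le_imp_le) simp
  then have "exp (K * t) * (exp (- K * t) * \<bar>?D t\<bar>) \<le> exp (K * t) * \<bar>?D 0\<bar>" by (rule mult_left_mono) simp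
  moreover have ee: "exp (K * t) * exp (- K * t) = 1" by (simp add: exp_add[symmetric])
  have "exp (K * t) * (exp (- K * t) * \<bar>?D t\<bar>) = \<bar>?D t\<bar>"
    by (simp only: mult.assoc[symmetric] ee mult_1_left)
  ultimately show "\<bar>x t - y t\<bar> \<le> exp (K * t) * \<bar>x 0 - y 0\<bar>" by (simp only:)
qed

section \<open>Smooth change of parameter\<close>

lemma DERIV_of_composition:
  fixes f \<psi> :: "real \<Rightarrow> real"
  assumes f: "(f has_real_derivative m) (at (\<psi> x))" and m: "m \<noteq> 0"
    and f\<psi>: "((\<lambda>x. f (\<psi> x)) has_real_derivative l) (at x)" and \<psi>: "isCont \<psi> x"
  shows "(\<psi> has_real_derivative l / m) (at x)"
proof -
  obtain g where g: "\<forall>z. f z - f (\<psi> x) = g z * (z - \<psi> x)" "isCont g (\<psi> x)" "g (\<psi> x) = m"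
    using f unfolding CARAT_DERIV by auto
  have g\<psi>: "isCont (\<lambda>z. g (\<psi> z)) x" using isCont_o2[OF \<psi> g(2)] .
  then have "((\<lambda>z. g (\<psi> z)) \<longlongrightarrow> m) (at x)" using g(3) by (simp add: isCont_def)
  moreover have "((\<lambda>z. (f (\<psi> z) - f (\<psi> x)) / (z - x)) \<longlongrightarrow> l) (at x)"
    using f\<psi> by (simp add: has_field_derivative_iff)
  ultimately have "((\<lambda>z. ((f (\<psi> z) - f (\<psi> x)) / (z - x)) / g (\<psi> z)) \<longlongrightarrow> l / m) (at x)"
    using m by (intro tendsto_divide) auto
  moreover have "\<forall>\<^sub>F z in at x. g (\<psi> z) \<noteq> 0"
    using tendsto_imp_eventually_ne[OF \<open>((\<lambda>z. g (\<psi> z)) \<longlongrightarrow> m) (at x)\<close> m] .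
  then have "\<forall>\<^sub>F z in at x. ((f (\<psi> z) - f (\<psi> x)) / (z - x)) / g (\<psi> z) = (\<psi> z - \<psi> x) / (z - x)"
    by eventually_elim (use g(1) in simp)
  ultimately have "((\<lambda>z. (\<psi> z - \<psi> x) / (z - x)) \<longlongrightarrow> l / m) (at x)"
    by (rule Lim_transform_eventually)
  then show ?thesis by (simp add: has_field_derivative_iff)
qed

text \<open>The derivative of \<open>\<psi>\<close> is a smooth expression in \<open>\<psi>\<close> itself, in the derivative of \<open>d\<close> and in that of \<open>c\<close> at
  \<open>\<psi>\<close>, so every degree of differentiability of \<open>\<psi>\<close> yields the next one.\<close>

lemma smooth_parameter_change:
  fixes c d :: "real \<Rightarrow> complex"
  assumes c: "smooth_in UNIV c" and c': "\<And>x. vector_derivative c (at x) \<noteq> 0"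
    and d: "smooth_in UNIV d" and \<psi>: "continuous_on UNIV \<psi>" and eq: "\<And>x. c (\<psi> x) = d x"
  shows "smooth_in UNIV \<psi>" and "vector_derivative d (at x) = deriv \<psi> x *\<^sub>R vector_derivative c (at (\<psi> x))"
proof -
  let ?c' = "\<lambda>x. vector_derivative c (at x)" and ?d' = "\<lambda>x. vector_derivative d (at x)"
  define \<psi>' where "\<psi>' = (\<lambda>x. (?d' x \<bullet> ?c' (\<psi> x)) * (?c' (\<psi> x) \<bullet> ?c' (\<psi> x)) powr (-1))"
  have dc: "(c has_vector_derivative ?c' x) (at x)" and dd: "(d has_vector_derivative ?d' x) (at x)" for x
    using smooth_in_vector_derivative(1)[OF c] smooth_in_vector_derivative(1)[OF d] by auto
  have inner: "((\<lambda>x. h x \<bullet> w) has_real_derivative h' \<bullet> w) (at x)" if "(h has_vector_derivative h') (at x)"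
    for h :: "real \<Rightarrow> complex" and h' w x
    using bounded_linear.has_vector_derivative[OF bounded_linear_inner_left that]
    by (simp add: has_real_derivative_iff_has_vector_derivative)
  have d\<psi>: "(\<psi> has_real_derivative \<psi>' x) (at x)" for x
  proof -
    have "(\<psi> has_real_derivative (?d' x \<bullet> ?c' (\<psi> x)) / (?c' (\<psi> x) \<bullet> ?c' (\<psi> x))) (at x)"
    proof (rule DERIV_of_composition[where f="\<lambda>y. c y \<bullet> ?c' (\<psi> x)"])
      show "isCont \<psi> x" using \<psi> by (simp add: continuous_on_eq_continuous_at)
      show "((\<lambda>y. c (\<psi> y) \<bullet> ?c' (\<psi> x)) has_real_derivative ?d' x \<bullet> ?c' (\<psi> x)) (at x)"
        unfolding eq by (rule inner[OF dd])
    qed (use c' inner[OF dc] in auto)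
    then show ?thesis unfolding \<psi>'_def using c'[of "\<psi> x"] by (simp add: powr_minus divide_inverse)
  qed
  have c'_up: "differentiable_upto n UNIV ?c'" and d'_up: "differentiable_upto n UNIV ?d'" for n
    using smooth_in_vector_derivative(2)[OF c] smooth_in_vector_derivative(2)[OF d] by (auto simp: smooth_in_def)
  have powr_up: "differentiable_upto n {0<..} (\<lambda>x::real. x powr (-1))" for n
    using smooth_in_powr[of "-1"] unfolding smooth_in_def by blast
  have "differentiable_upto n UNIV \<psi>" for n
  proof (induction n)
    case 0 then show ?case using \<psi> by simp
  next
    case (Suc n)
    have 1: "differentiable_upto n UNIV (\<lambda>x. ?c' (\<psi> x))"
      by (rule differentiable_upto_compose_real[OF open_UNIV open_UNIV UNIV_I Suc c'_up])
    have 2: "differentiable_upto n UNIV (\<lambda>x. ?c' (\<psi> x) \<bullet> ?c' (\<psi> x))"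
      by (rule differentiable_upto_bilinear[OF bounded_bilinear_inner open_UNIV 1 1])
    have "differentiable_upto n UNIV (\<lambda>x. (?c' (\<psi> x) \<bullet> ?c' (\<psi> x)) powr (-1))"
      by (rule differentiable_upto_compose_real[OF open_UNIV _ _ 2 powr_up]) (use c' in auto)
    then have "differentiable_upto n UNIV \<psi>'" unfolding \<psi>'_def
      by (intro differentiable_upto_bilinear[OF bounded_bilinear_mult open_UNIV] differentiable_upto_bilinear[OF bounded_bilinear_inner open_UNIV d'_up 1])
    then show ?case
      by (intro differentiable_upto_Suc_real[OF open_UNIV, of _ \<psi>']) (use d\<psi> in \<open>simp_all add: has_real_derivative_iff_has_vector_derivative\<close>)
  qed
  then show "smooth_in UNIV \<psi>" by (simp add: smooth_in_def)
  have "((c \<circ> \<psi>) has_vector_derivative \<psi>' x *\<^sub>R ?c' (\<psi> x)) (at x)"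
    using vector_diff_chain_at[OF _ dc] d\<psi> by (simp add: has_real_derivative_iff_has_vector_derivative)
  moreover have "c \<circ> \<psi> = d" using eq by auto
  ultimately show "?d' x = deriv \<psi> x *\<^sub>R ?c' (\<psi> x)"
    using vector_derivative_at DERIV_imp_deriv[OF d\<psi>] by auto
qed

section \<open>Constant normal speed yields parallel curves\<close>

lemma has_derivative_norm_complex:
  fixes P :: "real \<Rightarrow> complex"
  assumes P: "(P has_vector_derivative P') (at t within S)" and nz: "P t \<noteq> 0"
  shows "((\<lambda>t. cmod (P t)) has_real_derivative cmod (P t) * Re (P' / P t)) (at t within S)"
proof -
  have "((\<lambda>t. P t \<bullet> P t) has_derivative (\<lambda>s. P t \<bullet> (s *\<^sub>R P') + (s *\<^sub>R P') \<bullet> P t)) (at t within S)"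
    by (rule has_derivative_inner[OF P[unfolded has_vector_derivative_def] P[unfolded has_vector_derivative_def]])
  then have i: "((\<lambda>t. P t \<bullet> P t) has_real_derivative 2 * (P t \<bullet> P')) (at t within S)"
    unfolding has_field_derivative_def
    by (rule back_subst[where P="\<lambda>F. (_ has_derivative F) _"]) (auto simp: inner_commute)
  have pos: "0 < P t \<bullet> P t" using nz by simp
  have "((\<lambda>t. sqrt (P t \<bullet> P t)) has_real_derivative (inverse (sqrt (P t \<bullet> P t)) / 2) * (2 * (P t \<bullet> P'))) (at t within S)"
    by (rule DERIV_chain2[OF DERIV_real_sqrt[OF pos] i])
  moreover have "(inverse (sqrt (P t \<bullet> P t)) / 2) * (2 * (P t \<bullet> P')) = cmod (P t) * Re (P' / P t)"
  proof -
    have "P' / P t = P' * cnj (P t) / of_real ((cmod (P t))\<^sup>2)"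
      using nz unfolding complex_norm_square by (simp add: field_simps)
    then have "Re (P' / P t) = Re (P' * cnj (P t)) / (cmod (P t))\<^sup>2" by (simp only: Re_divide_of_real)
    moreover have "Re (P' * cnj (P t)) = P t \<bullet> P'" by (simp add: inner_complex_def mult.commute)
    ultimately show ?thesis using nz by (simp add: norm_eq_sqrt_inner[symmetric] power2_eq_square field_simps)
  qed
  ultimately show ?thesis by (simp add: norm_eq_sqrt_inner)
qed

lemma has_vector_derivative_along:
  fixes F :: "real \<Rightarrow> real \<Rightarrow> complex" and X :: "real \<Rightarrow> real"
  assumes F: "((\<lambda>z. F (fst z) (snd z)) has_derivative (\<lambda>v. fst v *\<^sub>R A + snd v *\<^sub>R B)) (at (t, X t) within {0..1} \<times> UNIV)"
    and X: "(X has_vector_derivative X') (at t within {0..1})"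
  shows "((\<lambda>t. F t (X t)) has_vector_derivative A + X' *\<^sub>R B) (at t within {0..1})"
proof -
  have g: "((\<lambda>t. (t, X t)) has_derivative (\<lambda>s. (s, s *\<^sub>R X'))) (at t within {0..1})"
    by (intro has_derivative_Pair has_derivative_ident X[unfolded has_vector_derivative_def])
  have "((\<lambda>z. F (fst z) (snd z)) has_derivative (\<lambda>v. fst v *\<^sub>R A + snd v *\<^sub>R B)) (at (t, X t) within (\<lambda>t. (t, X t)) ` {0..1})"
    by (rule has_derivative_subset[OF F]) auto
  from has_derivative_in_compose[OF g this]
  have "((\<lambda>t. F t (X t)) has_derivative (\<lambda>s. s *\<^sub>R A + (s *\<^sub>R X') *\<^sub>R B)) (at t within {0..1})" by simp
  then show ?thesis unfolding has_vector_derivative_def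
    by (rule back_subst[where P="\<lambda>F. (_ has_derivative F) _"]) (auto simp: scaleR_add_right)
qed

lemma smooth_in_const_scale: "smooth_in U f \<Longrightarrow> smooth_in U (\<lambda>x. s *\<^sub>R f x)"
  by (rule smooth_in_bounded_linear[OF bounded_linear_scaleR_right])

lemma smooth_in_speed_powr:
  assumes c: "c \<in> Imm"
  shows "smooth_in UNIV (\<lambda>x. (cmod (vector_derivative c (at x))) powr a)"
proof -
  let ?c' = "\<lambda>x. vector_derivative c (at x)"
  have "smooth_in UNIV (\<lambda>x. (?c' x \<bullet> ?c' x) powr (a / 2))"
    by (rule smooth_in_compose_real[OF smooth_in_powr smooth_in_inner])
      (use ImmD(4)[OF c] smooth_in_vector_derivative(2)[OF ImmD(1)[OF c]] in auto)
  moreover have "(?c' x \<bullet> ?c' x) powr (a / 2) = (cmod (?c' x)) powr a" for x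
  proof -
    have "?c' x \<bullet> ?c' x = cmod (?c' x) powr 2" using ImmD(4)[OF c, of x] by (simp add: dot_square_norm)
    then show ?thesis by (simp only: powr_powr) simp
  qed
  ultimately show ?thesis by simp
qed

lemma smooth_in_unit_normal:
  assumes c: "c \<in> Imm"
  shows "smooth_in UNIV (unit_normal c)"
proof -
  have "smooth_in UNIV (\<lambda>x. cmod (vector_derivative c (at x)) powr (-1) *\<^sub>R (\<i> * vector_derivative c (at x)))"
    by (intro smooth_in_scaleR smooth_in_speed_powr c smooth_in_mult smooth_in_const
        smooth_in_vector_derivative(2) ImmD(1) open_UNIV)
  moreover have "cmod (vector_derivative c (at x)) powr (-1) *\<^sub>R (\<i> * vector_derivative c (at x)) = unit_normal c x" for x
    using ImmD(4)[OF c, of x] by (simp add: unit_normal_def scaleR_conv_of_real powr_minus divide_inverse mult.commute)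
  ultimately show ?thesis by simp
qed

lemma smooth_in_parallel:
  assumes c: "c \<in> Imm"
  shows "smooth_in UNIV (\<lambda>x. c x + s *\<^sub>R unit_normal c x)"
  by (intro smooth_in_add smooth_in_const_scale smooth_in_unit_normal c ImmD(1))

context loop_homotopy
begin

text \<open>The real part is the tangential velocity in units of the parameter, the imaginary part the signed normal
  velocity divided by the speed of the parametrization.\<close>

definition slope :: "real \<Rightarrow> real \<Rightarrow> complex" where
  "slope t x = pt t x / px t x"

definition slope_x :: "real \<Rightarrow> real \<Rightarrow> complex" where
  "slope_x t x = (ptx t x * px t x - pt t x * pxx t x) / (px t x)\<^sup>2"

lemma slope_deriv:
  assumes t: "t \<in> {0..1}"
  shows "(slope t has_vector_derivative slope_x t x) (at x)"
proof -
  have i: "((\<lambda>x. inverse (px t x)) has_vector_derivative - (inverse (px t x) * pxx t x * inverse (px t x))) (at x)"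
  proof -
    have "((\<lambda>x. inverse (px t x)) has_derivative (\<lambda>s. - (inverse (px t x) * (s *\<^sub>R pxx t x) * inverse (px t x)))) (at x)"
      by (rule Deriv.has_derivative_inverse[OF immersed[OF t] deriv_x_x[OF t, unfolded has_vector_derivative_def]])
    then show ?thesis unfolding has_vector_derivative_def
      by (rule back_subst[where P="\<lambda>F. (_ has_derivative F) _"]) auto
  qed
  have "((\<lambda>x. pt t x * inverse (px t x)) has_vector_derivative
      pt t x * - (inverse (px t x) * pxx t x * inverse (px t x)) + ptx t x * inverse (px t x)) (at x)"
    by (rule has_vector_derivative_mult[OF deriv_t_x[OF t] i])
  moreover have "pt t x * - (inverse (px t x) * pxx t x * inverse (px t x)) + ptx t x * inverse (px t x) = slope_x t x"
    using immersed[OF t, of x] by (simp add: slope_x_def field_simps power2_eq_square)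
  ultimately show ?thesis unfolding slope_def[abs_def] divide_inverse by simp
qed

lemma Im_slope: "t \<in> {0..1} \<Longrightarrow> Im (slope t x) = - J t x / (cmod (px t x))\<^sup>2"
  unfolding slope_def J_def by (simp add: Im_divide cmod_power2 algebra_simps)

lemma slope_lipschitz:
  "\<exists>K>0. \<forall>t\<in>{0..1}. \<forall>x y. \<bar>Re (slope t x) - Re (slope t y)\<bar> \<le> K * \<bar>x - y\<bar>"
proof -
  have c: "continuous_on ({0..1} \<times> {0..2 * pi}) (\<lambda>z. slope_x (fst z) (snd z))"
    unfolding slope_x_def
    by (intro continuous_intros continuous_box) (use immersed in \<open>auto simp: mem_Times_iff\<close>)
  have "compact ((\<lambda>z. slope_x (fst z) (snd z)) ` ({0..1} \<times> {0..2 * pi}))"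
    by (intro compact_continuous_image c compact_Times compact_Icc)
  from compact_imp_bounded[OF this]
  obtain B where B': "\<forall>w\<in>(\<lambda>z. slope_x (fst z) (snd z)) ` ({0..1} \<times> {0..2 * pi}). cmod w \<le> B"
    unfolding bounded_iff by (elim exE)
  have B: "cmod (slope_x (fst z) (snd z)) \<le> B" if "z \<in> {0..1} \<times> {0..2 * pi}" for z
    by (rule bspec[OF B' imageI[OF that]])
  have bd: "cmod (slope_x t x) \<le> B" if t: "t \<in> {0..1}" for t x
  proof -
    have "slope_x t (x + 2 * pi) = slope_x t x" for x unfolding slope_x_def by (simp add: periodic_derivs[OF t])
    from range_periodic[of "slope_x t", OF this] have "slope_x t x \<in> slope_x t ` {0..2 * pi}" by blast
    then obtain y where "y \<in> {0..2 * pi}" "slope_x t x = slope_x t y" by blast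
    then show ?thesis using B[of "(t, y)"] t by simp
  qed
  have "\<bar>Re (slope t x) - Re (slope t y)\<bar> \<le> (\<bar>B\<bar> + 1) * \<bar>x - y\<bar>" if t: "t \<in> {0..1}" for t x y
  proof -
    have "cmod (slope t x - slope t y) \<le> (\<bar>B\<bar> + 1) * norm (x - y)"
    proof (rule differentiable_bound[OF convex_UNIV])
      fix z :: real
      show "(slope t has_derivative (\<lambda>s. s *\<^sub>R slope_x t z)) (at z within UNIV)"
        using slope_deriv[OF t, of z] by (simp add: has_vector_derivative_def)
      show "onorm (\<lambda>s. s *\<^sub>R slope_x t z) \<le> \<bar>B\<bar> + 1"
      proof (rule onorm_le)
        fix s :: real
        have "cmod (slope_x t z) \<le> \<bar>B\<bar> + 1" using bd[OF t, of z] by linarith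
        from mult_right_mono[OF this, of "\<bar>s\<bar>"]
        show "norm (s *\<^sub>R slope_x t z) \<le> (\<bar>B\<bar> + 1) * norm s" by (simp add: mult.commute)
      qed
    qed auto
    moreover have "\<bar>Re (slope t x) - Re (slope t y)\<bar> \<le> cmod (slope t x - slope t y)"
      using abs_Re_le_cmod[of "slope t x - slope t y"] by simp
    ultimately show ?thesis by simp
  qed
  then show ?thesis by (intro exI[of _ "\<bar>B\<bar> + 1"]) simp
qed

text \<open>A continuous function of constant modulus on a connected set is constant: it could change its sign only
  through a zero, and then it vanishes everywhere.\<close>

lemma signed_normal_speed:
  assumes const: "\<And>x y. \<bar>J t x\<bar> / cmod (px t x) = \<bar>J t y\<bar> / cmod (px t y)" and t: "t \<in> {0..1}"
  shows "J t x / cmod (px t x) = J t y / cmod (px t y)"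
proof -
  let ?w = "\<lambda>x. J t x / cmod (px t x)"
  have c: "continuous_on UNIV ?w"
    by (intro continuous_intros continuous_slice_J continuous_slices t) (use immersed[OF t] in simp)
  have conn: "connected (range ?w)" by (rule connected_continuous_image[OF c connected_UNIV])
  have abs_w: "\<bar>?w x\<bar> = \<bar>?w y\<bar>" for x y using const by simp
  show ?thesis
  proof (rule ccontr)
    assume ne: "?w x \<noteq> ?w y"
    then have opp: "?w x = - ?w y" using abs_w[of x y] by linarith
    have r: "?w x \<in> range ?w" "?w y \<in> range ?w" by (rule rangeI)+
    have "0 \<in> range ?w"
    proof (cases "?w x \<le> 0")
      case True
      then show ?thesis using opp by - (rule connectedD_interval[OF conn r(1,2)], auto)
    next
      case False
      then show ?thesis using opp by - (rule connectedD_interval[OF conn r(2,1)], auto)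
    qed
    then obtain z where "?w z = 0" by force
    then have "?w x = 0" "?w y = 0" using abs_w[of x z] abs_w[of y z] by auto
    with ne show False by simp
  qed
qed

text \<open>A point that moves with parameter velocity \<open>- Re slope\<close> has no tangential velocity. Because the normal
  speed is the same all along the curve, the tangent does not turn either: the normal velocity \<open>w\<close>
  satisfies \<open>Im slope = w / \<bar>px\<bar>\<close>, and the dependence of this quotient on the angle is that of \<open>1 / \<bar>px\<bar>\<close>, which
  cancels the turning. Hence the point travels on a fixed normal line.\<close>

lemma characteristic:
  assumes const: "\<And>t x y. t \<in> {0..1} \<Longrightarrow> \<bar>J t x\<bar> / cmod (px t x) = \<bar>J t y\<bar> / cmod (px t y)"
    and X: "\<And>t. t \<in> {0..1} \<Longrightarrow> (X has_vector_derivative - Re (slope t (X t))) (at t within {0..1})"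
  shows "p 1 (X 1) = p 0 (X 0) + integral {0..1} (\<lambda>t. - J t 0 / cmod (px t 0)) *\<^sub>R unit_normal (p 0) (X 0)"
    and "unit_normal (p 1) (X 1) = unit_normal (p 0) (X 0)"
proof -
  define a where "a = (\<lambda>t. - J t 0 / cmod (px t 0))"
  have speed: "- J t x / cmod (px t x) = a t" if t: "t \<in> {0..1}" for t x
    using signed_normal_speed[OF const[OF t] t, of x 0] by (simp add: a_def)
  have Im_s: "Im (slope t x) = a t / cmod (px t x)" if t: "t \<in> {0..1}" for t x
    unfolding Im_slope[OF t] speed[OF t, of x, symmetric] by (simp add: power2_eq_square)
  have Im_sx: "Im (slope_x t x) = - (a t / cmod (px t x)) * Re (pxx t x / px t x)" if t: "t \<in> {0..1}" for t x
  proof -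
    have "((\<lambda>x. Im (slope t x)) has_vector_derivative Im (slope_x t x)) (at x)"
      by (rule bounded_linear.has_vector_derivative[OF bounded_linear_Im slope_deriv[OF t]])
    then have 1: "((\<lambda>x. a t / cmod (px t x)) has_real_derivative Im (slope_x t x)) (at x)"
      by (simp add: Im_s[OF t] has_real_derivative_iff_has_vector_derivative)
    have nz: "cmod (px t x) \<noteq> 0" using immersed[OF t] by simp
    have "((\<lambda>x. cmod (px t x)) has_real_derivative cmod (px t x) * Re (pxx t x / px t x)) (at x)"
      by (rule has_derivative_norm_complex[OF deriv_x_x[OF t] immersed[OF t]])
    from DERIV_divide[OF DERIV_const[of "a t"] this nz]
    have 2: "((\<lambda>x. a t / cmod (px t x)) has_real_derivative
      (0 * cmod (px t x) - a t * (cmod (px t x) * Re (pxx t x / px t x))) / (cmod (px t x) * cmod (px t x))) (at x)" .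
    have "Im (slope_x t x) = (0 * cmod (px t x) - a t * (cmod (px t x) * Re (pxx t x / px t x))) / (cmod (px t x) * cmod (px t x))"
      by (rule DERIV_unique[OF 1 2])
    then show ?thesis using nz by simp
  qed
  let ?P = "\<lambda>t. px t (X t)"
  define P' where "P' = (\<lambda>t. ptx t (X t) + (- Re (slope t (X t))) *\<^sub>R pxx t (X t))"
  have P': "(?P has_vector_derivative P' t) (at t within {0..1})" if t: "t \<in> {0..1}" for t
    unfolding P'_def by (rule has_vector_derivative_along[OF deriv_total_x[OF t] X[OF t]])
  \<comment> \<open>The logarithmic derivative of the tangent vector is real: its direction is preserved.\<close>
  have Im0: "Im (P' t / ?P t) = 0" if t: "t \<in> {0..1}" for t
  proof -
    let ?x = "X t"
    have nz: "px t ?x \<noteq> 0" by (rule immersed[OF t])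
    have "P' t / ?P t = slope_x t ?x + \<i> * of_real (Im (slope t ?x)) * (pxx t ?x / px t ?x)"
    proof -
      have 1: "slope_x t ?x = ptx t ?x / px t ?x - slope t ?x * (pxx t ?x / px t ?x)"
        using nz by (simp add: slope_x_def slope_def field_simps power2_eq_square)
      have 2: "\<i> * of_real (Im (slope t ?x)) = slope t ?x - of_real (Re (slope t ?x))"
        by (simp add: complex_eq_iff)
      have 3: "P' t / ?P t = ptx t ?x / px t ?x + (- of_real (Re (slope t ?x))) * (pxx t ?x / px t ?x)"
        unfolding P'_def scaleR_conv_of_real of_real_minus by (simp only: add_divide_distrib times_divide_eq_right)
      show ?thesis unfolding 1 2 3 by (simp only: left_diff_distrib) simp
    qed
    also have "Im \<dots> = Im (slope_x t ?x) + Im (slope t ?x) * Re (pxx t ?x / px t ?x)"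
      by (simp only: plus_complex.sel times_complex.sel Re_complex_of_real Im_complex_of_real imaginary_unit.sel) simp
    also have "\<dots> = 0" unfolding Im_s[OF t] Im_sx[OF t] by simp
    finally show ?thesis .
  qed
  let ?T = "\<lambda>t. ?P t * of_real (1 / cmod (?P t))"
  have T': "(?T has_vector_derivative 0) (at t within {0..1})" if t: "t \<in> {0..1}" for t
  proof -
    have nz: "?P t \<noteq> 0" "cmod (?P t) \<noteq> 0" using immersed[OF t] by auto
    have "((\<lambda>t. 1 / cmod (?P t)) has_real_derivative
        (0 * cmod (?P t) - 1 * (cmod (?P t) * Re (P' t / ?P t))) / (cmod (?P t) * cmod (?P t))) (at t within {0..1})"
      by (rule DERIV_divide[OF DERIV_const has_derivative_norm_complex[OF P'[OF t] nz(1)] nz(2)])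
    then have "((\<lambda>t. 1 / cmod (?P t)) has_real_derivative - Re (P' t / ?P t) / cmod (?P t)) (at t within {0..1})"
      using nz(2) by simp
    then have "((\<lambda>t. complex_of_real (1 / cmod (?P t))) has_vector_derivative of_real (- Re (P' t / ?P t) / cmod (?P t))) (at t within {0..1})"
      by (rule has_vector_derivative_of_real)
    from has_vector_derivative_mult[OF P'[OF t] this]
    have d: "(?T has_vector_derivative ?P t * of_real (- Re (P' t / ?P t) / cmod (?P t)) + P' t * of_real (1 / cmod (?P t))) (at t within {0..1})" .
    have "P' t / ?P t = of_real (Re (P' t / ?P t))" using Im0[OF t] by (simp add: complex_eq_iff)
    then have "P' t = of_real (Re (P' t / ?P t)) * ?P t" using nz(1)
      by (simp only: nonzero_divide_eq_eq[OF nz(1)])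
    then have "?P t * of_real (- Re (P' t / ?P t) / cmod (?P t)) + P' t * of_real (1 / cmod (?P t)) =
       ?P t * of_real (- Re (P' t / ?P t) / cmod (?P t)) + (of_real (Re (P' t / ?P t)) * ?P t) * of_real (1 / cmod (?P t))"
      by (rule arg_cong)
    also have "\<dots> = 0" by simp
    finally have z: "?P t * of_real (- Re (P' t / ?P t) / cmod (?P t)) + P' t * of_real (1 / cmod (?P t)) = 0" .
    show ?thesis using d unfolding z .
  qed
  obtain T0 where T0: "\<And>t. t \<in> {0..1} \<Longrightarrow> ?T t = T0"
    by (rule has_vector_derivative_zero_constant[of "{0..1}" ?T, OF convex_real_interval(5) T']) (assumption, erule that)
  define S where "S = (\<lambda>t. integral {0..t} a)"
  have ca: "continuous_on {0..1} a"
  proof -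
    have "continuous_on {0..1} (\<lambda>t. (\<lambda>z. - J (fst z) (snd z) / cmod (px (fst z) (snd z))) (t, 0))"
      by (rule continuous_on_compose2[of "{0..1} \<times> UNIV" "\<lambda>z. - J (fst z) (snd z) / cmod (px (fst z) (snd z))"])
        (auto intro!: continuous_intros continuous_box continuous_box_J simp: immersed mem_Times_iff)
    then show ?thesis by (simp add: a_def)
  qed
  have S': "(S has_vector_derivative a t) (at t within {0..1})" if "t \<in> {0..1}" for t
    unfolding S_def by (rule integral_has_vector_derivative[OF ca that])
  let ?E = "\<lambda>t. p t (X t) - S t *\<^sub>R (\<i> * T0)"
  have E': "(?E has_vector_derivative 0) (at t within {0..1})" if t: "t \<in> {0..1}" for t
  proof -
    let ?x = "X t"
    have nz: "px t ?x \<noteq> 0" by (rule immersed[OF t])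
    have "((\<lambda>t. p t (X t)) has_vector_derivative pt t ?x + (- Re (slope t ?x)) *\<^sub>R px t ?x) (at t within {0..1})"
      by (rule has_vector_derivative_along[OF deriv_total[OF t] X[OF t]])
    moreover have "((\<lambda>t. S t *\<^sub>R (\<i> * T0)) has_vector_derivative a t *\<^sub>R (\<i> * T0)) (at t within {0..1})"
      by (rule has_vector_derivative_scaleR[OF _ has_vector_derivative_const, of S "a t" _ _ "\<i> * T0", simplified])
        (use S'[OF t] in \<open>simp add: has_real_derivative_iff_has_vector_derivative\<close>)
    ultimately have d: "(?E has_vector_derivative pt t ?x + (- Re (slope t ?x)) *\<^sub>R px t ?x - a t *\<^sub>R (\<i> * T0)) (at t within {0..1})"
      by (rule has_vector_derivative_diff)
    have "pt t ?x = slope t ?x * px t ?x" using nz by (simp add: slope_def)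
    also have "slope t ?x = of_real (Re (slope t ?x)) + \<i> * of_real (Im (slope t ?x))" by (rule complex_eq)
    finally have "pt t ?x + (- Re (slope t ?x)) *\<^sub>R px t ?x = \<i> * of_real (Im (slope t ?x)) * px t ?x"
      by (simp add: scaleR_conv_of_real ring_distribs)
    also have "\<dots> = a t *\<^sub>R (\<i> * ?T t)" unfolding Im_s[OF t] by (simp add: scaleR_conv_of_real)
    finally have z: "pt t ?x + (- Re (slope t ?x)) *\<^sub>R px t ?x = a t *\<^sub>R (\<i> * T0)" unfolding T0[OF t] .
    show ?thesis using d unfolding z by simp
  qed
  obtain E0 where E0: "\<And>t. t \<in> {0..1} \<Longrightarrow> ?E t = E0"
    by (rule has_vector_derivative_zero_constant[of "{0..1}" ?E, OF convex_real_interval(5) E']) (assumption, erule that)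
  have "p 1 (X 1) - S 1 *\<^sub>R (\<i> * T0) = p 0 (X 0) - S 0 *\<^sub>R (\<i> * T0)"
    using E0[of 1] E0[of 0] by simp
  moreover have "S 0 = 0" by (simp add: S_def)
  moreover have "\<i> * T0 = unit_normal (p 0) (X 0)"
    using T0[of 0] vector_derivative_at[OF deriv_x[of 0 "X 0"]] by (auto simp: unit_normal_def)
  moreover have "\<i> * T0 = unit_normal (p 1) (X 1)"
    using T0[of 1] vector_derivative_at[OF deriv_x[of 1 "X 1"]] by (auto simp: unit_normal_def)
  ultimately show "p 1 (X 1) = p 0 (X 0) + integral {0..1} (\<lambda>t. - J t 0 / cmod (px t 0)) *\<^sub>R unit_normal (p 0) (X 0)"
    "unit_normal (p 1) (X 1) = unit_normal (p 0) (X 0)"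
    by (simp_all add: S_def a_def algebra_simps)
qed

text \<open>The change of parameter is the flow of \<open>- Re slope\<close> up to time \<open>1\<close>. The flow is continuous by the upper
  distance estimate, hence smooth by \<open>smooth_parameter_change\<close>, and the lower estimate keeps its derivative
  away from \<open>0\<close>.\<close>

lemma parallel_endpoint:
  assumes const: "\<And>t x y. t \<in> {0..1} \<Longrightarrow> \<bar>J t x\<bar> / cmod (px t x) = \<bar>J t y\<bar> / cmod (px t y)"
    and imm: "p 0 \<in> Imm" "p 1 \<in> Imm"
  shows "\<exists>s \<psi>. \<psi> \<in> circle_diffeos_pos \<and> (\<forall>x. p 1 (\<psi> x) = p 0 x + s *\<^sub>R unit_normal (p 0) x \<and>
    unit_normal (p 1) (\<psi> x) = unit_normal (p 0) x)"
proof -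
  define f where "f = (\<lambda>t x. - Re (slope t x))"
  obtain K where K: "K > 0" and lip0: "\<And>t x y. t \<in> {0..1} \<Longrightarrow> \<bar>Re (slope t x) - Re (slope t y)\<bar> \<le> K * \<bar>x - y\<bar>"
    using slope_lipschitz by blast
  have lip: "\<bar>f t x - f t y\<bar> \<le> K * \<bar>x - y\<bar>" if "t \<in> {0..1}" for t x y
    using lip0[OF that, of x y] unfolding f_def by linarith
  have cf: "continuous_on ({0..1} \<times> UNIV) (\<lambda>z. f (fst z) (snd z))"
    unfolding f_def slope_def by (intro continuous_intros continuous_box) (auto simp: immersed)
  have per: "f t (x + 2 * pi) = f t x" if "t \<in> {0..1}" for t x
    unfolding f_def slope_def periodic_derivs[OF that] ..
  define X where "X = (\<lambda>x0. SOME X. X 0 = x0 \<and> (\<forall>t\<in>{0..1}. (X has_vector_derivative f t (X t)) (at t within {0..1})))"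
  have X: "X x0 0 = x0 \<and> (\<forall>t\<in>{0..1}. (X x0 has_vector_derivative f t (X x0 t)) (at t within {0..1}))" for x0
    unfolding X_def by (rule someI_ex[OF ode_global_solution[OF cf lip K]])
  have X0: "X x0 0 = x0" and X': "(X x0 has_vector_derivative f t (X x0 t)) (at t within {0..1})" if "t \<in> {0..1}" for x0 t
    using X that by auto
  define \<psi> where "\<psi> = (\<lambda>x0. X x0 1)"
  define s where "s = integral {0..1} (\<lambda>t. - J t 0 / cmod (px t 0))"
  have eq: "p 1 (\<psi> x) = p 0 x + s *\<^sub>R unit_normal (p 0) x" and eqn: "unit_normal (p 1) (\<psi> x) = unit_normal (p 0) x" for x
    using characteristic[OF const X'[unfolded f_def, of _ x]] X0[of 0 x] by (simp_all add: \<psi>_def s_def)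
  have low: "exp (- K) * \<bar>x - y\<bar> \<le> \<bar>\<psi> x - \<psi> y\<bar>" and up: "\<bar>\<psi> x - \<psi> y\<bar> \<le> exp K * \<bar>x - y\<bar>" for x y
    using ode_distance[of f K "X x" "X y" 1, OF lip X' X'] X0[of 0] by (simp_all add: \<psi>_def)
  have c\<psi>: "continuous_on UNIV \<psi>"
  proof (rule lipschitz_on_continuous_on)
    show "(exp K)-lipschitz_on UNIV \<psi>" using up by (intro lipschitz_onI) (auto simp: dist_real_def)
  qed
  have shift: "\<psi> (x + 2 * pi) = \<psi> x + 2 * pi" for x
  proof -
    have Y: "((\<lambda>t. X x t + 2 * pi) has_vector_derivative f t (X x t + 2 * pi)) (at t within {0..1})" if t: "t \<in> {0..1}" for t
      using has_vector_derivative_add[OF X'[OF t] has_vector_derivative_const[of "2 * pi"]] by (simp add: per[OF t])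
    have "\<bar>X (x + 2 * pi) 1 - (X x 1 + 2 * pi)\<bar> \<le> exp (K * 1) * \<bar>X (x + 2 * pi) 0 - (X x 0 + 2 * pi)\<bar>"
      by (rule ode_distance(2)[OF lip X' Y]) auto
    then show ?thesis using X0[of 0] by (simp add: \<psi>_def)
  qed
  let ?o = "\<lambda>x. p 0 x + s *\<^sub>R unit_normal (p 0) x"
  have sm_o: "smooth_in UNIV ?o" by (rule smooth_in_parallel[OF imm(1)])
  have sm\<psi>: "smooth_in UNIV \<psi>"
    by (rule smooth_parameter_change(1)[OF ImmD(1)[OF imm(2)] ImmD(4)[OF imm(2)] sm_o c\<psi> eq])
  have d\<psi>: "(\<psi> has_real_derivative vector_derivative \<psi> (at x)) (at x)" for x
    using smooth_in_vector_derivative(1)[OF sm\<psi>, of x] by (simp add: has_real_derivative_iff_has_vector_derivative)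
  then have d\<psi>': "deriv \<psi> = (\<lambda>x. vector_derivative \<psi> (at x))" by (auto intro: DERIV_imp_deriv)
  have cderiv: "continuous_on UNIV (deriv \<psi>)"
    unfolding d\<psi>' by (rule smooth_in_continuous_on[OF smooth_in_vector_derivative(2)[OF sm\<psi>]])
  have nz: "deriv \<psi> x \<noteq> 0" for x
  proof
    assume "deriv \<psi> x = 0"
    then have "((\<lambda>z. (\<psi> z - \<psi> x) / (z - x)) \<longlongrightarrow> 0) (at x)"
      using d\<psi>[of x] unfolding d\<psi>' by (simp add: has_field_derivative_iff)
    then have "\<forall>\<^sub>F z in at x. dist ((\<psi> z - \<psi> x) / (z - x)) 0 < exp (- K)"
      by (rule tendstoD) simp
    moreover have "\<forall>\<^sub>F z in at x. z \<noteq> x" by (simp add: eventually_at_filter)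
    ultimately have "\<forall>\<^sub>F z in at x. False"
    proof eventually_elim
      case (elim z)
      then have "\<bar>\<psi> z - \<psi> x\<bar> < exp (- K) * \<bar>z - x\<bar>" by (simp add: field_simps)
      with low[of z x] show ?case by linarith
    qed
    then show False by simp
  qed
  \<comment> \<open>The derivative is positive somewhere because \<open>\<psi>\<close> gains \<open>2 * pi\<close> over a period.\<close>
  obtain z where z: "0 < z" "z < 2 * pi" "\<psi> (2 * pi) - \<psi> 0 = (2 * pi - 0) * deriv \<psi> z"
    using MVT2[of 0 "2 * pi" \<psi> "deriv \<psi>"] d\<psi> unfolding d\<psi>' by auto
  then have "0 < deriv \<psi> z" using shift[of 0] by simp
  have pos: "0 < deriv \<psi> x" for x
  proof (rule ccontr)
    assume "\<not> 0 < deriv \<psi> x"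
    have conn: "connected (range (deriv \<psi>))" by (rule connected_continuous_image[OF cderiv connected_UNIV])
    have "0 \<in> range (deriv \<psi>)"
      by (rule connectedD_interval[OF conn rangeI[of "deriv \<psi>" x] rangeI[of "deriv \<psi>" z]])
        (use \<open>\<not> 0 < deriv \<psi> x\<close> \<open>0 < deriv \<psi> z\<close> in auto)
    then show False using nz by auto
  qed
  have "\<psi> \<in> circle_diffeos_pos"
    using sm\<psi> pos shift by (simp add: circle_diffeos_pos_def smooth_on_UNIV_iff)
  with eq eqn show ?thesis by blast
qed

end

section \<open>Normal graphs over an immersed curve\<close>

locale immersed_curve =
  fixes c :: "real \<Rightarrow> complex"
  assumes imm: "c \<in> Imm"
begin

abbreviation c' :: "real \<Rightarrow> complex" where "c' x \<equiv> vector_derivative c (at x)"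

definition c'' :: "real \<Rightarrow> complex" where "c'' x = vector_derivative (\<lambda>x. vector_derivative c (at x)) (at x)"

definition v :: "real \<Rightarrow> real" where "v x = cmod (c' x)"

text \<open>The rate at which the tangent turns, per unit of the parameter and not of arc length.\<close>

definition k :: "real \<Rightarrow> real" where "k x = Im (c'' x / c' x)"

definition T :: "real \<Rightarrow> complex" where "T x = c' x / of_real (v x)"

abbreviation n :: "real \<Rightarrow> complex" where "n \<equiv> unit_normal c"

lemma nT: "n x = \<i> * T x"
  by (simp add: unit_normal_def T_def v_def)

lemma v_pos: "0 < v x"
  using ImmD(4)[OF imm, of x] by (simp add: v_def)

lemma norm_T: "cmod (T x) = 1"
  using v_pos[of x] by (simp add: T_def norm_divide v_def)

lemma vT: "c' x = v x *\<^sub>R T x"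
  using v_pos[of x] by (simp add: T_def scaleR_conv_of_real)

lemma c''_deriv: "(c' has_vector_derivative c'' x) (at x)"
  unfolding c''_def by (rule smooth_in_vector_derivative(1)[OF smooth_in_vector_derivative(2)[OF ImmD(1)[OF imm]]]) simp

lemma n_deriv: "(n has_vector_derivative - k x *\<^sub>R T x) (at x)"
proof -
  have nz: "c' x \<noteq> 0" "v x \<noteq> 0" "cmod (c' x) \<noteq> 0" using ImmD(4)[OF imm] v_pos[of x] by auto
  have "((\<lambda>x. 1 / cmod (c' x)) has_real_derivative
      (0 * cmod (c' x) - 1 * (cmod (c' x) * Re (c'' x / c' x))) / (cmod (c' x) * cmod (c' x))) (at x)"
    by (rule DERIV_divide[OF DERIV_const has_derivative_norm_complex[OF c''_deriv nz(1)] nz(3)])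
  then have "((\<lambda>x. 1 / v x) has_real_derivative - Re (c'' x / c' x) / v x) (at x)"
    using nz by (simp add: v_def)
  then have "((\<lambda>x. complex_of_real (1 / v x)) has_vector_derivative of_real (- Re (c'' x / c' x) / v x)) (at x)"
    by (rule has_vector_derivative_of_real)
  from has_vector_derivative_mult[OF c''_deriv this]
  have d: "((\<lambda>x. c' x * of_real (1 / v x)) has_vector_derivative
      c' x * of_real (- Re (c'' x / c' x) / v x) + c'' x * of_real (1 / v x)) (at x)" .
  have "c'' x / c' x = of_real (Re (c'' x / c' x)) + \<i> * of_real (k x)"
    unfolding k_def by (rule complex_eq)
  then have "c'' x = (of_real (Re (c'' x / c' x)) + \<i> * of_real (k x)) * c' x"
    by (simp only: nonzero_divide_eq_eq[OF nz(1)])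
  then have "c' x * of_real (- Re (c'' x / c' x) / v x) + c'' x * of_real (1 / v x) =
      c' x * of_real (- Re (c'' x / c' x) / v x) + ((of_real (Re (c'' x / c' x)) + \<i> * of_real (k x)) * c' x) * of_real (1 / v x)"
    by (rule arg_cong)
  also have "\<dots> = \<i> * of_real (k x) * T x" by (simp add: T_def ring_distribs add_divide_distrib)
  finally have z: "c' x * of_real (- Re (c'' x / c' x) / v x) + c'' x * of_real (1 / v x) = \<i> * of_real (k x) * T x" .
  have "((\<lambda>x. \<i> * (c' x * of_real (1 / v x))) has_vector_derivative \<i> * (\<i> * of_real (k x) * T x)) (at x)"
    using has_vector_derivative_mult_right[OF d, of \<i>] unfolding z .
  moreover have "(\<lambda>x. \<i> * (c' x * of_real (1 / v x))) = n" by (auto simp: nT T_def)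
  moreover have "\<i> * (\<i> * of_real (k x) * T x) = - k x *\<^sub>R T x"
    by (simp add: scaleR_conv_of_real mult.assoc[symmetric])
  ultimately show ?thesis by simp
qed

lemma smooth_v: "smooth_in UNIV v"
  using smooth_in_speed_powr[OF imm, of 1] ImmD(4)[OF imm] by (simp add: v_def[abs_def])

lemma smooth_k: "smooth_in UNIV k"
proof -
  have c': "smooth_in UNIV c'" by (rule smooth_in_vector_derivative(2)[OF ImmD(1)[OF imm]])
  have c'': "smooth_in UNIV c''" unfolding c''_def[abs_def] by (rule smooth_in_vector_derivative(2)[OF c'])
  have "smooth_in UNIV (\<lambda>x. (c'' x \<bullet> (\<i> * c' x)) * v x powr (-2))"
    unfolding v_def by (intro smooth_in_mult smooth_in_inner c'' c' smooth_in_const smooth_in_speed_powr imm open_UNIV)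
  moreover have "(c'' x \<bullet> (\<i> * c' x)) * v x powr (-2) = k x" for x
  proof -
    have "k x = Im (c'' x * cnj (c' x) / of_real ((cmod (c' x))\<^sup>2))"
      unfolding k_def complex_norm_square using ImmD(4)[OF imm, of x] by (simp add: field_simps)
    also have "\<dots> = Im (c'' x * cnj (c' x)) / (v x)\<^sup>2" by (simp only: Im_divide_of_real v_def)
    also have "Im (c'' x * cnj (c' x)) = c'' x \<bullet> (\<i> * c' x)" by (simp add: inner_complex_def)
    finally show ?thesis using v_pos[of x] by (simp add: powr_minus divide_inverse)
  qed
  ultimately show ?thesis by simp
qed

lemma continuous_vk: "continuous_on X v" "continuous_on X k"
  using smooth_in_continuous_on[OF smooth_v] smooth_in_continuous_on[OF smooth_k] continuous_on_subset by blast+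

lemma periodic_geometry: "v (x + 2 * pi) = v x" "k (x + 2 * pi) = k x" "T (x + 2 * pi) = T x" "n (x + 2 * pi) = n x"
proof -
  have c': "c' (x + 2 * pi) = c' x" for x by (rule ImmD(6)[OF imm])
  have "((\<lambda>x. x + 2 * pi) has_vector_derivative 1) (at x)" by (auto intro!: derivative_eq_intros)
  from vector_diff_chain_at[OF this c''_deriv[of "x + 2 * pi"]]
  have "(c' has_vector_derivative c'' (x + 2 * pi)) (at x)" by (simp add: o_def c')
  from vector_derivative_unique_at[OF this c''_deriv] have "c'' (x + 2 * pi) = c'' x" .
  then show "v (x + 2 * pi) = v x" "k (x + 2 * pi) = k x" "T (x + 2 * pi) = T x" "n (x + 2 * pi) = n x"
    by (simp_all add: v_def k_def T_def nT c')
qed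

definition graph :: "(real \<Rightarrow> real \<Rightarrow> real) \<Rightarrow> real \<Rightarrow> real \<Rightarrow> complex" where
  "graph h t x = c x + h t x *\<^sub>R n x"

lemma graph_deriv_x:
  assumes "(h t has_real_derivative hx) (at x)"
  shows "(graph h t has_vector_derivative (of_real (v x - h t x * k x) + \<i> * of_real hx) * T x) (at x)"
proof -
  have "((\<lambda>x. c x + h t x *\<^sub>R n x) has_vector_derivative c' x + (h t x *\<^sub>R (- k x *\<^sub>R T x) + hx *\<^sub>R n x)) (at x)"
    by (intro has_vector_derivative_add ImmD(2)[OF imm] has_vector_derivative_scaleR assms n_deriv)
  moreover have "c' x + (h t x *\<^sub>R (- k x *\<^sub>R T x) + hx *\<^sub>R n x) = (of_real (v x - h t x * k x) + \<i> * of_real hx) * T x"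
    unfolding vT nT by (simp add: scaleR_conv_of_real ring_distribs)
  ultimately show ?thesis unfolding graph_def[abs_def] by simp
qed

lemma norm_graph_deriv: "cmod ((of_real a + \<i> * of_real b) * T x) = sqrt (a\<^sup>2 + b\<^sup>2)"
  unfolding norm_mult norm_T by (simp add: cmod_def)

text \<open>The condition \<open>pos\<close> keeps the curves from passing the centres of curvature of \<open>c\<close>. The Jacobian is negative
  for motion in the direction of the normal, since the unit normal is \<open>\<i>\<close> times the unit tangent.\<close>

lemma graph_homotopy:
  assumes U: "open U" "{0..1} \<subseteq> U" and h: "smooth_in (U \<times> UNIV) (\<lambda>z. h (fst z) (snd z))"
    and per: "\<And>t x. t \<in> {0..1} \<Longrightarrow> h t (x + 2 * pi) = h t x"
    and pos: "\<And>t x. t \<in> {0..1} \<Longrightarrow> 0 < v x - h t x * k x"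
    and ht: "\<And>t x. t \<in> {0..1} \<Longrightarrow> ((\<lambda>s. h s x) has_real_derivative ht t x) (at t within {0..1})"
    and hx: "\<And>t x. t \<in> {0..1} \<Longrightarrow> (h t has_real_derivative hx t x) (at x)"
  shows "imm_path (graph h)"
    and "\<exists>pt px ptx pxx. loop_homotopy (graph h) pt px ptx pxx \<and>
      (\<forall>t\<in>{0..1}. \<forall>x. cmod (px t x) = sqrt ((v x - h t x * k x)\<^sup>2 + (hx t x)\<^sup>2) \<and>
        Im (cnj (pt t x) * px t x) = - (ht t x * (v x - h t x * k x)))"
proof -
  have open_U: "open (U \<times> (UNIV :: real set))" using U(1) by (simp add: open_Times)
  have snd: "smooth_in (U \<times> UNIV) (\<lambda>z. f (snd z))" if "smooth_in UNIV f" for f :: "real \<Rightarrow> complex"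
    by (rule smooth_in_compose_real[OF that smooth_in_snd[OF open_U]]) simp
  have sm: "smooth_in (U \<times> UNIV) (\<lambda>z. graph h (fst z) (snd z))"
    unfolding graph_def
    by (intro smooth_in_add smooth_in_scaleR h snd ImmD(1)[OF imm] smooth_in_unit_normal[OF imm])
  have imm_t: "graph h t \<in> Imm" if t: "t \<in> {0..1}" for t
  proof -
    have "smooth_in UNIV (\<lambda>x. (\<lambda>z. graph h (fst z) (snd z)) (t, x))"
      by (rule smooth_in_slice[OF sm]) (use t U in auto)
    then have s: "smooth_in UNIV (graph h t)" by simp
    have "vector_derivative (graph h t) (at x) \<noteq> 0" for x
    proof -
      have "of_real (v x - h t x * k x) + \<i> * of_real (hx t x) \<noteq> 0"
        using pos[OF t, of x] by (simp add: complex_eq_iff)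
      moreover have "T x \<noteq> 0" using norm_T[of x] by auto
      ultimately show ?thesis using         vector_derivative_at[OF graph_deriv_x[where h=h, OF hx[OF t, of x]]] by (simp del: of_real_diff of_real_mult)
    qed
    then show ?thesis using s
      by (simp add: Imm_def smooth_on_UNIV_iff) (simp add: graph_def per[OF t] ImmD(3)[OF imm] periodic_geometry)
  qed
  show ip: "imm_path (graph h)"
    unfolding imm_path_def
  proof (intro conjI ballI imm_t)
    show "smooth_on ({0..1} \<times> UNIV) (\<lambda>(t, x). graph h t x)"
      using smooth_in_imp_smooth_on[OF sm, of "{0..1} \<times> UNIV"] U(2) by (auto simp: case_prod_unfold)
  qed
  obtain pt px ptx pxx where lh: "loop_homotopy (graph h) pt px ptx pxx"
    using imm_path_loop_homotopy[OF ip] .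
  interpret loop_homotopy "graph h" pt px ptx pxx by (rule lh)
  have "cmod (px t x) = sqrt ((v x - h t x * k x)\<^sup>2 + (hx t x)\<^sup>2) \<and>
        Im (cnj (pt t x) * px t x) = - (ht t x * (v x - h t x * k x))" if t: "t \<in> {0..1}" for t x
  proof -
    have px: "px t x = (of_real (v x - h t x * k x) + \<i> * of_real (hx t x)) * T x"
      by (rule vector_derivative_unique_at[OF deriv_x[OF t] graph_deriv_x[where h=h, OF hx[OF t]]])
    have "((\<lambda>s. c x + h s x *\<^sub>R n x) has_vector_derivative 0 + (h t x *\<^sub>R 0 + ht t x *\<^sub>R n x)) (at t within {0..1})"
      by (intro has_vector_derivative_add has_vector_derivative_scaleR has_vector_derivative_const ht t)
    then have g: "((\<lambda>s. graph h s x) has_vector_derivative ht t x *\<^sub>R n x) (at t within {0..1})"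
      by (simp add: graph_def)
    have "at t within {0..1} \<noteq> bot" using t by (auto simp: trivial_limit_within islimpt_Icc)
    from vector_derivative_unique_within[OF this deriv_t[OF t] g]
    have pt: "pt t x = ht t x *\<^sub>R (\<i> * T x)" by (simp add: nT)
    have TT: "(Re (T x))\<^sup>2 + (Im (T x))\<^sup>2 = 1" using norm_T[of x] by (simp add: cmod_power2[symmetric])
    have "cnj (pt t x) * px t x = (- \<i> * of_real (ht t x) * (of_real (v x - h t x * k x) + \<i> * of_real (hx t x))) * (T x * cnj (T x))"
      unfolding pt px by (simp add: scaleR_conv_of_real)
    also have "T x * cnj (T x) = 1" unfolding complex_norm_square[symmetric] norm_T by simp
    finally have "Im (cnj (pt t x) * px t x) = - (ht t x * (v x - h t x * k x))" by simp
    then show ?thesis unfolding px norm_graph_deriv by simp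
  qed
  with lh show "\<exists>pt px ptx pxx. loop_homotopy (graph h) pt px ptx pxx \<and>
      (\<forall>t\<in>{0..1}. \<forall>x. cmod (px t x) = sqrt ((v x - h t x * k x)\<^sup>2 + (hx t x)\<^sup>2) \<and>
        Im (cnj (pt t x) * px t x) = - (ht t x * (v x - h t x * k x)))" by blast
qed

end

section \<open>Smoothed triangle waves of high frequency\<close>

lemma dominated_convergence_negligible:
  fixes f :: "nat \<Rightarrow> real \<Rightarrow> real"
  assumes c: "\<And>j. continuous_on {a..b} (f j)" and bd: "\<And>j x. x \<in> {a..b} \<Longrightarrow> \<bar>f j x\<bar> \<le> B"
    and N: "negligible N" and lim: "\<And>x. x \<in> {a..b} \<Longrightarrow> x \<notin> N \<Longrightarrow> (\<lambda>j. f j x) \<longlonglongrightarrow> g x"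
  shows "(\<lambda>j. integral {a..b} (f j)) \<longlonglongrightarrow> integral {a..b} g"
proof -
  let ?f = "\<lambda>j x. if x \<in> N then 0 else f j x" and ?g = "\<lambda>x. if x \<in> N then 0 else g x"
  have "(\<lambda>j. integral {a..b} (?f j)) \<longlonglongrightarrow> integral {a..b} ?g"
  proof (rule dominated_convergence(2))
    show "?f j integrable_on {a..b}" for j
      by (rule integrable_spike[OF integrable_continuous_real[OF c[of j]] N]) auto
    show "(\<lambda>x. \<bar>B\<bar>) integrable_on {a..b}" by (rule integrable_const_ivl)
    show "norm (?f j x) \<le> \<bar>B\<bar>" if "x \<in> {a..b}" for j x using bd[OF that, of j] by auto
    show "(\<lambda>j. ?f j x) \<longlonglongrightarrow> ?g x" if "x \<in> {a..b}" for x using lim[OF that] by auto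
  qed
  moreover have "integral {a..b} (?f j) = integral {a..b} (f j)" for j
    by (rule integral_spike[OF N]) simp
  moreover have "integral {a..b} ?g = integral {a..b} g"
    by (rule integral_spike[OF N]) simp
  ultimately show ?thesis by simp
qed

lemma integral_frequency:
  fixes f :: "real \<Rightarrow> real"
  assumes c: "continuous_on UNIV f" and per: "\<And>x. f (x + 2 * pi) = f x"
  shows "integral {0..2 * pi} (\<lambda>x. f (real (Suc M) * x)) = integral {0..2 * pi} f"
proof -
  have int: "f integrable_on {x..y}" for x y
    by (intro integrable_continuous_real continuous_on_subset[OF c]) simp
  have mult: "integral {0..real j * (2 * pi)} f = real j * integral {0..2 * pi} f" for j
  proof (induction j)
    case (Suc j)
    have "integral {0..real (Suc j) * (2 * pi)} f =
        integral {0..real j * (2 * pi)} f + integral {real j * (2 * pi)..real (Suc j) * (2 * pi)} f"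
      by (intro Henstock_Kurzweil_Integration.integral_combine[symmetric] int) auto
    also have "integral {real j * (2 * pi)..real (Suc j) * (2 * pi)} f = integral {0..2 * pi} f"
      using integral_period_shift[OF c per, of "real j * (2 * pi)"] by (simp add: algebra_simps)
    finally show ?case using Suc by (simp add: algebra_simps)
  qed simp
  have img: "(\<lambda>x. x / real (Suc M)) ` {0..real (Suc M) * (2 * pi)} = {0..2 * pi}"
    using image_divide_atLeastAtMost[of "real (Suc M)" 0 "real (Suc M) * (2 * pi)"] by simp
  show ?thesis
    using integral_stretch_real[of "real (Suc M)" 0 "real (Suc M) * (2 * pi)" f] mult[of "Suc M"]
    unfolding img by simp
qed

text \<open>For \<open>\<kappa> = 1\<close> this is the triangle wave; for \<open>\<kappa> < 1\<close> its corners are rounded off.\<close>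

definition zig :: "real \<Rightarrow> real \<Rightarrow> real" where
  "zig \<kappa> y = arcsin (\<kappa> * sin y)"

definition zig' :: "real \<Rightarrow> real \<Rightarrow> real" where
  "zig' \<kappa> y = \<kappa> * cos y / sqrt (1 - (\<kappa> * sin y)\<^sup>2)"

context
  fixes \<kappa> :: real
  assumes \<kappa>: "0 \<le> \<kappa>" "\<kappa> < 1"
begin

lemma kappa_sin: "-1 < \<kappa> * sin y" "\<kappa> * sin y < 1" "(\<kappa> * sin y)\<^sup>2 < 1"
proof -
  have "\<bar>\<kappa> * sin y\<bar> \<le> \<kappa> * 1" unfolding abs_mult using \<kappa> by (intro mult_mono) auto
  then have "\<bar>\<kappa> * sin y\<bar> < 1" using \<kappa> by linarith
  then show "-1 < \<kappa> * sin y" "\<kappa> * sin y < 1" "(\<kappa> * sin y)\<^sup>2 < 1" by (auto simp: abs_square_less_1)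
qed

lemma smooth_zig: "smooth_in UNIV (zig \<kappa>)"
  unfolding zig_def[abs_def]
proof (rule smooth_in_compose_real[OF smooth_in_arcsin])
  show "smooth_in UNIV (\<lambda>y. \<kappa> * sin y)"
    by (intro smooth_in_mult smooth_in_const smooth_in_sin_cos open_UNIV)
qed (use kappa_sin in auto)

lemma zig_deriv: "(zig \<kappa> has_real_derivative zig' \<kappa> y) (at y)"
proof -
  have "((\<lambda>y. \<kappa> * sin y) has_real_derivative \<kappa> * cos y) (at y)"
    by (auto intro!: derivative_eq_intros)
  from DERIV_chain2[OF DERIV_arcsin[OF kappa_sin(1,2)] this]
  show ?thesis by (simp add: zig_def[abs_def] zig'_def divide_inverse mult_ac)
qed

lemma continuous_zig': "continuous_on UNIV (zig' \<kappa>)"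
  unfolding zig'_def[abs_def] by (intro continuous_intros) (use kappa_sin(3) in \<open>auto simp: less_imp_neq[THEN not_sym]\<close>)

lemma zig_bounds: "\<bar>zig \<kappa> y\<bar> \<le> 2" "\<bar>zig' \<kappa> y\<bar> \<le> 1"
proof -
  have "\<bar>zig \<kappa> y\<bar> \<le> pi / 2"
    using arcsin_bounded[of "\<kappa> * sin y"] kappa_sin(1,2)[of y] by (auto simp: zig_def)
  then show "\<bar>zig \<kappa> y\<bar> \<le> 2" using pi_less_4 by simp
  have "(\<kappa> * cos y)\<^sup>2 = \<kappa>\<^sup>2 - (\<kappa> * sin y)\<^sup>2"
    unfolding power_mult_distrib by (simp add: cos_squared_eq algebra_simps)
  moreover have "\<kappa>\<^sup>2 \<le> 1" using \<kappa> by (simp add: power_le_one)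
  ultimately have "(\<kappa> * cos y)\<^sup>2 \<le> 1 - (\<kappa> * sin y)\<^sup>2" by linarith
  then have "sqrt ((\<kappa> * cos y)\<^sup>2) \<le> sqrt (1 - (\<kappa> * sin y)\<^sup>2)" by (rule real_sqrt_le_mono)
  then have "\<bar>\<kappa> * cos y\<bar> \<le> sqrt (1 - (\<kappa> * sin y)\<^sup>2)" by simp
  moreover have "0 < sqrt (1 - (\<kappa> * sin y)\<^sup>2)" using kappa_sin(3) by simp
  ultimately show "\<bar>zig' \<kappa> y\<bar> \<le> 1" unfolding zig'_def by (simp add: abs_divide)
qed

end

lemma zig_periodic: "zig \<kappa> (real (Suc M) * (x + 2 * pi)) = zig \<kappa> (real (Suc M) * x)"
proof -
  have "sin (real (Suc M) * (x + 2 * pi)) = sin (real (Suc M) * x)"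
    using sin.plus_of_nat[of "real (Suc M) * x" "Suc M"] by (simp add: ring_distribs)
  then show ?thesis by (simp only: zig_def)
qed

definition kappa :: "nat \<Rightarrow> real" where
  "kappa j = real j / real (Suc j)"

lemma kappa: "0 \<le> kappa j" "kappa j < 1" "kappa \<longlonglongrightarrow> 1"
  using LIMSEQ_n_over_Suc_n by (simp_all add: kappa_def[abs_def])

text \<open>The mean deviation of the slope from \<open>\<plusminus>1\<close> does not depend on the frequency; it tends to \<open>0\<close> as the corners
  sharpen. Convergence in the mean gives convergence almost everywhere along a subsequence, and so the limits
  of the integrals below follow by dominated convergence.\<close>

lemma zigzag_subsequence:
  "\<exists>r N. strict_mono r \<and> negligible N \<and>
    (\<forall>x\<in>{0..2 * pi} - N. (\<lambda>j. \<bar>zig' (kappa (r j)) (real (Suc (r j)) * x)\<bar>) \<longlonglongrightarrow> 1)"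
proof -
  define u where "u = (\<lambda>j x. 1 - \<bar>zig' (kappa j) (real (Suc j) * x)\<bar>)"
  have cz: "continuous_on X (\<lambda>x. zig' (kappa j) (f x))" if "continuous_on X f" for f X and j
    by (rule continuous_on_compose2[OF continuous_zig'[OF kappa(1,2)] that]) simp
  have cu: "continuous_on {0..2 * pi} (u j)" for j
    unfolding u_def by (intro continuous_intros cz)
  have u01: "0 \<le> u j x" "u j x \<le> 1" for j x
    using zig_bounds(2)[OF kappa(1,2)] by (simp_all add: u_def)
  have "integral {0..2 * pi} (u j) = integral {0..2 * pi} (\<lambda>y. 1 - \<bar>zig' (kappa j) y\<bar>)" for j
    unfolding u_def
  proof (rule integral_frequency)
    show "continuous_on UNIV (\<lambda>y. 1 - \<bar>zig' (kappa j) y\<bar>)" by (intro continuous_intros cz)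
  qed (simp add: zig'_def)
  moreover have "(\<lambda>j. integral {0..2 * pi} (\<lambda>y. 1 - \<bar>zig' (kappa j) y\<bar>)) \<longlonglongrightarrow> integral {0..2 * pi} (\<lambda>y. 0)"
  proof (rule dominated_convergence_negligible)
    show "continuous_on {0..2 * pi} (\<lambda>y. 1 - \<bar>zig' (kappa j) y\<bar>)" for j by (intro continuous_intros cz)
    show "\<bar>1 - \<bar>zig' (kappa j) y\<bar>\<bar> \<le> 1" for j y using zig_bounds(2)[OF kappa(1,2), of j y] by simp
    have "{y. cos y = (0::real)} \<subseteq> range (\<lambda>i::int. of_int i * (pi / 2))" by (auto simp: cos_zero_iff_int)
    then show "negligible {y. cos y = (0::real)}"
      unfolding negligible_iff_null_sets
      by (intro null_sets_completionI countable_imp_null_set_lborel) (erule countable_subset, simp)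
    fix y :: real assume "y \<notin> {y. cos y = 0}"
    then have y: "cos y \<noteq> 0" by simp
    have "1 - (1 * sin y)\<^sup>2 = (cos y)\<^sup>2" by (simp add: cos_squared_eq)
    then have s: "sqrt (1 - (1 * sin y)\<^sup>2) = \<bar>cos y\<bar>" by simp
    have "(\<lambda>j. 1 - \<bar>kappa j * cos y / sqrt (1 - (kappa j * sin y)\<^sup>2)\<bar>) \<longlonglongrightarrow>
        1 - \<bar>1 * cos y / sqrt (1 - (1 * sin y)\<^sup>2)\<bar>"
      by (intro tendsto_intros kappa(3)) (use s y in simp)
    then show "(\<lambda>j. 1 - \<bar>zig' (kappa j) y\<bar>) \<longlonglongrightarrow> 0" using y s by (simp add: zig'_def abs_divide)
  qed
  ultimately have I0: "(\<lambda>j. integral {0..2 * pi} (u j)) \<longlonglongrightarrow> 0" by simp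
  let ?w = "\<lambda>j x. indicator {0..2 * pi} x *\<^sub>R u j x"
  have si: "set_integrable lebesgue {0..2 * pi} (u j)" for j
    by (rule absolutely_integrable_continuous_real[OF cu])
  then have wi: "integrable lebesgue (?w j)" for j by (simp add: set_integrable_def)
  have "(\<integral>x. norm (?w j x) \<partial>lebesgue) = integral {0..2 * pi} (u j)" for j
  proof -
    have "(\<integral>x. norm (?w j x) \<partial>lebesgue) = (\<integral>x. ?w j x \<partial>lebesgue)"
      using u01(1) by (intro Bochner_Integration.integral_cong) auto
    then show ?thesis using set_lebesgue_integral_eq_integral(2)[OF si] by (simp add: set_lebesgue_integral_def)
  qed
  then have "(\<lambda>j. \<integral>x. norm (?w j x) \<partial>lebesgue) \<longlonglongrightarrow> 0" using I0 by simp
  from tendsto_L1_AE_subseq[OF wi this]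
  obtain r where r: "strict_mono r" "AE x in lebesgue. (\<lambda>j. ?w (r j) x) \<longlonglongrightarrow> 0" by blast
  from AE_E[OF r(2)] obtain N where N: "{x \<in> space lebesgue. \<not> (\<lambda>j. ?w (r j) x) \<longlonglongrightarrow> 0} \<subseteq> N"
    "emeasure lebesgue N = 0" "N \<in> sets lebesgue" .
  have "negligible N" using N(2,3) by (simp add: negligible_iff_null_sets null_sets_def)
  moreover have "(\<lambda>j. \<bar>zig' (kappa (r j)) (real (Suc (r j)) * x)\<bar>) \<longlonglongrightarrow> 1" if "x \<in> {0..2 * pi} - N" for x
  proof -
    have "x \<notin> {x \<in> space lebesgue. \<not> (\<lambda>j. ?w (r j) x) \<longlonglongrightarrow> 0}" using N(1) that by blast
    then have "(\<lambda>j. ?w (r j) x) \<longlonglongrightarrow> 0"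
      by (simp only: mem_Collect_eq space_completion space_lborel space_borel UNIV_I simp_thms)
    then have "(\<lambda>j. u (r j) x) \<longlonglongrightarrow> 0" using that by simp
    from tendsto_diff[OF tendsto_const[of 1] this] show ?thesis by (simp add: u_def)
  qed
  ultimately show ?thesis using r(1) by blast
qed

lemma periodic_bounded:
  fixes f :: "real \<Rightarrow> real"
  assumes c: "continuous_on UNIV f" and per: "\<And>x. f (x + 2 * pi) = f x"
  shows "\<exists>B. \<forall>x. \<bar>f x\<bar> \<le> B"
proof -
  have "bounded (f ` {0..2 * pi})"
    by (intro compact_imp_bounded compact_continuous_image continuous_on_subset[OF c]) auto
  then have "bounded (range f)" unfolding range_periodic[of f, OF per] .
  then show ?thesis by (auto simp: bounded_iff)
qed

lemma periodic_pos_lower_bound: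
  fixes f :: "real \<Rightarrow> real"
  assumes c: "continuous_on UNIV f" and per: "\<And>x. f (x + 2 * pi) = f x" and pos: "\<And>x. 0 < f x"
  shows "\<exists>\<delta>>0. \<forall>x. \<delta> \<le> f x"
proof -
  have "continuous_on {0..2 * pi} f" by (rule continuous_on_subset[OF c]) simp
  from continuous_attains_inf[OF compact_Icc _ this]
  obtain z where z: "z \<in> {0..2 * pi}" "\<forall>y\<in>{0..2 * pi}. f z \<le> f y" by auto
  have "f z \<le> f x" for x
  proof -
    have "f x \<in> f ` {0..2 * pi}" using range_periodic[of f, OF per] by blast
    then show ?thesis using z(2) by auto
  qed
  then show ?thesis using pos by blast
qed

section \<open>Zigzag paths between parallel curves\<close>

text \<open>By the assumptions on \<open>s\<close> the normal segments of signed length \<open>s\<close> run through immersed parallel curves; the first and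
  the last of these curves are shorter than \<open>1 / A\<close>.\<close>

locale parallel_strip = immersed_curve +
  fixes s A :: real
  assumes A: "A > 0" and strip: "\<And>x. 0 < v x - s * k x"
    and short: "integral {0..2 * pi} v < 1 / A" "integral {0..2 * pi} (\<lambda>x. v x - s * k x) < 1 / A"
begin

text \<open>\<open>V t\<close> is the speed and \<open>ell t\<close> the length of the parallel curve at signed distance \<open>t * s\<close>. Both are affine in \<open>t\<close>, so the
  bounds at the two ends hold in between.\<close>

definition V :: "real \<Rightarrow> real \<Rightarrow> real" where
  "V t x = v x - t * s * k x"

definition ell :: "real \<Rightarrow> real" where
  "ell t = (1 - t) * integral {0..2 * pi} v + t * integral {0..2 * pi} (\<lambda>x. v x - s * k x)"

lemma V_convex: "V t x = (1 - t) * v x + t * (v x - s * k x)"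
  by (simp add: V_def algebra_simps)

lemma V_lower: "\<exists>\<delta>>0. \<forall>t\<in>{0..1}. \<forall>x. \<delta> \<le> V t x"
proof -
  obtain d1 where d1: "d1 > 0" "\<forall>x. d1 \<le> v x"
    using periodic_pos_lower_bound[OF continuous_vk(1) periodic_geometry(1) v_pos] by blast
  have "continuous_on UNIV (\<lambda>x. v x - s * k x)" by (intro continuous_intros continuous_vk)
  then obtain d2 where d2: "d2 > 0" "\<forall>x. d2 \<le> v x - s * k x"
    using periodic_pos_lower_bound[of "\<lambda>x. v x - s * k x", OF _ _ strip] periodic_geometry by auto
  have "min d1 d2 \<le> V t x" if t: "t \<in> {0..1}" for t x
  proof -
    have "min d1 d2 = (1 - t) * min d1 d2 + t * min d1 d2" by (simp add: algebra_simps)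
    also have "\<dots> \<le> (1 - t) * v x + t * (v x - s * k x)"
      using t d1(2) d2(2) by (intro add_mono mult_left_mono) (auto simp: min_le_iff_disj)
    finally show ?thesis by (simp add: V_convex)
  qed
  then show ?thesis using d1(1) d2(1) by (intro exI[of _ "min d1 d2"]) auto
qed

lemma V_pos: "t \<in> {0..1} \<Longrightarrow> 0 < V t x"
  using V_lower by (metis less_le_trans)

lemma integral_V: "integral {0..2 * pi} (V t) = ell t"
proof -
  have 1: "(v has_integral integral {0..2 * pi} v) {0..2 * pi}"
    "((\<lambda>x. v x - s * k x) has_integral integral {0..2 * pi} (\<lambda>x. v x - s * k x)) {0..2 * pi}"
    by (auto intro!: integrable_integral integrable_continuous_real continuous_intros continuous_vk)
  have "(V t has_integral ell t) {0..2 * pi}"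
    unfolding V_convex[abs_def] ell_def by (intro has_integral_add has_integral_mult_right 1)
  then show ?thesis by (rule integral_unique)
qed

lemma integral_pos_strip: "0 < integral {0..2 * pi} v" "0 < integral {0..2 * pi} (\<lambda>x. v x - s * k x)"
proof -
  have "0 < integral {0..2 * pi} f" if c: "continuous_on {0..2 * pi} f" and p: "\<And>x. 0 < f x" for f :: "real \<Rightarrow> real"
  proof -
    have "integral {0..2 * pi} f \<noteq> 0"
      using integral_eq_0_iff[OF c] p[of 0] less_imp_le[OF p] by fastforce
    moreover have "0 \<le> integral {0..2 * pi} f"
      by (rule integral_nonneg[OF integrable_continuous_real[OF c] less_imp_le[OF p]])
    ultimately show ?thesis by simp
  qed
  note pos = this
  show "0 < integral {0..2 * pi} v" by (rule pos[OF continuous_vk(1) v_pos])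
  show "0 < integral {0..2 * pi} (\<lambda>x. v x - s * k x)"
    by (rule pos) (use strip in \<open>auto intro!: continuous_intros continuous_vk\<close>)
qed

text \<open>A path is smooth if it extends smoothly beyond \<open>[0, 1]\<close>; the zigzag extends as long as the length stays
  between \<open>0\<close> and \<open>1 / A\<close>.\<close>

definition U :: "real set" where
  "U = {t. 0 < A * ell t \<and> A * ell t < 1}"

lemma open_U: "open U"
  unfolding U_def ell_def by (intro open_Collect_conj open_Collect_less continuous_intros)

lemma unit_U: "{0..1} \<subseteq> U"
proof
  fix t :: real assume t: "t \<in> {0..1}"
  let ?a = "integral {0..2 * pi} v" and ?b = "integral {0..2 * pi} (\<lambda>x. v x - s * k x)"
  have m: "min ?a ?b \<le> ell t" "ell t \<le> max ?a ?b"
  proof -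
    have "min ?a ?b = (1 - t) * min ?a ?b + t * min ?a ?b" by (simp add: algebra_simps)
    also have "\<dots> \<le> ell t" unfolding ell_def using t by (intro add_mono mult_left_mono) auto
    finally show "min ?a ?b \<le> ell t" .
    have "ell t \<le> (1 - t) * max ?a ?b + t * max ?a ?b" unfolding ell_def using t by (intro add_mono mult_left_mono) auto
    also have "\<dots> = max ?a ?b" by (simp add: algebra_simps)
    finally show "ell t \<le> max ?a ?b" .
  qed
  have "0 < ell t" "ell t < 1 / A" using m integral_pos_strip short by linarith+
  then show "t \<in> U" using A by (simp add: U_def field_simps)
qed

text \<open>The slope that stretches a curve of length \<open>ell t\<close> to length \<open>1 / A\<close>.\<close>

definition steep :: "real \<Rightarrow> real" where
  "steep t = ((A * ell t) powr (-2) - 1) powr (1 / 2)"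

lemma smooth_steep: "smooth_in U steep"
proof -
  have ell: "smooth_in U (\<lambda>t. A * ell t)"
    unfolding ell_def by (intro smooth_in_mult smooth_in_add smooth_in_diff smooth_in_const smooth_in_ident open_U)
  have 1: "smooth_in U (\<lambda>t. (A * ell t) powr (-2))"
    by (rule smooth_in_compose_real[OF smooth_in_powr ell]) (simp add: U_def)
  show ?thesis
    unfolding steep_def
  proof (rule smooth_in_compose_real[OF smooth_in_powr])
    show "smooth_in U (\<lambda>t. (A * ell t) powr - 2 - 1)" by (intro smooth_in_diff 1 smooth_in_const open_U)
    fix t assume "t \<in> U"
    then have "0 < A * ell t" "A * ell t < 1" by (auto simp: U_def)
    then have "(A * ell t)\<^sup>2 < 1" "0 < (A * ell t)\<^sup>2" by (auto simp: power_less_one_iff)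
    then have "1 < inverse ((A * ell t)\<^sup>2)" by (simp add: one_less_inverse)
    then show "(A * ell t) powr - 2 - 1 \<in> {0<..}" using \<open>0 < A * ell t\<close> by (simp add: powr_minus)
  qed
qed

lemma steep_eq:
  assumes "t \<in> {0..1}"
  shows "sqrt (1 + (steep t)\<^sup>2) = 1 / (A * ell t)"
proof -
  have t: "0 < A * ell t" "A * ell t < 1" using assms unit_U by (auto simp: U_def)
  then have "(A * ell t)\<^sup>2 \<le> 1" "0 < (A * ell t)\<^sup>2" by (auto simp: power_le_one)
  then have "1 \<le> inverse ((A * ell t)\<^sup>2)" by (simp add: one_le_inverse)
  then have "(steep t)\<^sup>2 = inverse ((A * ell t)\<^sup>2) - 1"
    using t(1) by (simp add: steep_def powr_half_sqrt powr_minus)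
  then have "1 + (steep t)\<^sup>2 = (1 / (A * ell t))\<^sup>2" by (simp add: power_divide inverse_eq_divide)
  then show ?thesis using t(1) by (simp only: real_sqrt_abs) simp
qed

text \<open>The cutoff vanishes at both ends, where the curves are prescribed, and tends to \<open>1\<close> in between.\<close>

definition cutoff :: "nat \<Rightarrow> real \<Rightarrow> real" where
  "cutoff m t = 1 - ((1 - 2 * t)\<^sup>2) ^ Suc m"

definition b :: "nat \<Rightarrow> real \<Rightarrow> real" where
  "b m t = cutoff m t * steep t"

definition b' :: "nat \<Rightarrow> real \<Rightarrow> real" where
  "b' m t = vector_derivative (b m) (at t)"

lemma smooth_b: "smooth_in U (b m)"
  unfolding b_def[abs_def] cutoff_def
  by (intro smooth_in_mult smooth_in_diff smooth_in_power smooth_in_const smooth_in_ident smooth_steep open_U)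

lemma b_deriv: "t \<in> U \<Longrightarrow> (b m has_real_derivative b' m t) (at t)"
  using smooth_in_vector_derivative(1)[OF smooth_b] by (simp add: b'_def has_real_derivative_iff_has_vector_derivative)

lemma continuous_b: "continuous_on {0..1} (b m)" "continuous_on {0..1} (b' m)"
  unfolding b'_def[abs_def]
  by (rule continuous_on_subset[OF smooth_in_continuous_on[OF smooth_b] unit_U]
      continuous_on_subset[OF smooth_in_continuous_on[OF smooth_in_vector_derivative(2)[OF smooth_b]] unit_U])+

lemma cutoff_bounds: "t \<in> {0..1} \<Longrightarrow> 0 \<le> cutoff m t \<and> cutoff m t \<le> 1"
proof -
  assume t: "t \<in> {0..1}"
  then have "(1 - 2 * t)\<^sup>2 \<le> 1" by (simp add: abs_square_le_1 abs_le_iff)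
  from power_le_one[OF zero_le_power2 this, of "Suc m"] show ?thesis by (simp add: cutoff_def del: power_Suc)
qed

lemma b_ends: "b m 0 = 0" "b m 1 = 0"
  by (simp_all add: b_def cutoff_def)

lemma b_limit:
  assumes "0 < t" "t < 1"
  shows "(\<lambda>m. b m t) \<longlonglongrightarrow> steep t"
proof -
  have "\<bar>1 - 2 * t\<bar> < 1" using assms by (simp add: abs_less_iff)
  then have "norm ((1 - 2 * t)\<^sup>2) < 1" by (simp add: abs_square_less_1)
  then have "(\<lambda>m. ((1 - 2 * t)\<^sup>2) ^ Suc m) \<longlonglongrightarrow> 0"
    by (intro LIMSEQ_Suc LIMSEQ_power_zero)
  from tendsto_mult[OF tendsto_diff[OF tendsto_const[of 1] this] tendsto_const[of "steep t"]]
  show ?thesis unfolding b_def cutoff_def by simp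
qed

definition v' :: "real \<Rightarrow> real" where "v' x = vector_derivative v (at x)"
definition k' :: "real \<Rightarrow> real" where "k' x = vector_derivative k (at x)"

lemma vk_deriv: "(v has_real_derivative v' x) (at x)" "(k has_real_derivative k' x) (at x)"
  using smooth_in_vector_derivative(1)[OF smooth_v, of x] smooth_in_vector_derivative(1)[OF smooth_k, of x]
  by (simp_all add: v'_def k'_def has_real_derivative_iff_has_vector_derivative)

lemma continuous_vk': "continuous_on X v'" "continuous_on X k'"
  unfolding v'_def[abs_def] k'_def[abs_def]
  by (rule continuous_on_subset[OF smooth_in_continuous_on[OF smooth_in_vector_derivative(2)[OF smooth_v]] subset_UNIV]
      continuous_on_subset[OF smooth_in_continuous_on[OF smooth_in_vector_derivative(2)[OF smooth_k]] subset_UNIV])+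

text \<open>The straight motion \<open>t * s\<close> with a zigzag of frequency \<open>Suc N\<close>. Its amplitude is of the order of
  \<open>1 / Suc N\<close>, but its slope relative to the parallel curve is \<open>b m t\<close> up to sign. The functions \<open>ht\<close> and \<open>hx\<close> are the
  partial derivatives of \<open>h\<close>, and \<open>W\<close> is the component of the angular derivative of the graph along the tangent of \<open>c\<close>.\<close>

definition h :: "nat \<Rightarrow> nat \<Rightarrow> real \<Rightarrow> real \<Rightarrow> real" where
  "h m N t x = t * s + b m t * V t x * zig (kappa N) (real (Suc N) * x) / real (Suc N)"

definition ht :: "nat \<Rightarrow> nat \<Rightarrow> real \<Rightarrow> real \<Rightarrow> real" where
  "ht m N t x = s + (b' m t * V t x - b m t * (s * k x)) * zig (kappa N) (real (Suc N) * x) / real (Suc N)"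

definition hx :: "nat \<Rightarrow> nat \<Rightarrow> real \<Rightarrow> real \<Rightarrow> real" where
  "hx m N t x = b m t * (v' x - t * s * k' x) * zig (kappa N) (real (Suc N) * x) / real (Suc N) +
     b m t * V t x * zig' (kappa N) (real (Suc N) * x)"

definition W :: "nat \<Rightarrow> nat \<Rightarrow> real \<Rightarrow> real \<Rightarrow> real" where
  "W m N t x = v x - h m N t x * k x"

lemma W_eq: "W m N t x = V t x - b m t * V t x * k x * zig (kappa N) (real (Suc N) * x) / real (Suc N)"
  by (simp add: W_def h_def V_def algebra_simps)

lemma h_deriv_t:
  assumes "t \<in> {0..1}"
  shows "((\<lambda>t. h m N t x) has_real_derivative ht m N t x) (at t within {0..1})"
proof -
  have 1: "(b m has_real_derivative b' m t) (at t within {0..1})"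
    using b_deriv[of t m] assms unit_U by (blast intro: has_field_derivative_at_within)
  show ?thesis unfolding h_def ht_def V_def
    by (rule derivative_eq_intros 1 refl | simp)+
qed

lemma h_deriv_x: "(h m N t has_real_derivative hx m N t x) (at x)"
proof -
  have z: "((\<lambda>x. zig (kappa N) (real (Suc N) * x)) has_real_derivative zig' (kappa N) (real (Suc N) * x) * real (Suc N)) (at x)"
    by (rule DERIV_chain2[OF zig_deriv[OF kappa(1,2)]]) (auto intro!: derivative_eq_intros)
  have V: "(V t has_real_derivative v' x - t * s * k' x) (at x)"
    unfolding V_def[abs_def] by (auto intro!: derivative_eq_intros vk_deriv)
  have "((\<lambda>x. t * s + b m t * (V t x * zig (kappa N) (real (Suc N) * x)) * (1 / real (Suc N))) has_real_derivative
      0 + b m t * ((v' x - t * s * k' x) * zig (kappa N) (real (Suc N) * x) +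
        (zig' (kappa N) (real (Suc N) * x) * real (Suc N)) * V t x) * (1 / real (Suc N))) (at x)"
    by (intro DERIV_add DERIV_const DERIV_cmult_right DERIV_cmult DERIV_mult V z)
  moreover have "0 + b m t * ((v' x - t * s * k' x) * zig (kappa N) (real (Suc N) * x) +
        (zig' (kappa N) (real (Suc N) * x) * real (Suc N)) * V t x) * (1 / real (Suc N)) = hx m N t x"
    unfolding hx_def by (simp add: field_simps del: of_nat_Suc)
  moreover have "(\<lambda>x. t * s + b m t * (V t x * zig (kappa N) (real (Suc N) * x)) * (1 / real (Suc N))) = h m N t"
    unfolding h_def[abs_def] by (simp add: field_simps del: of_nat_Suc)
  ultimately show ?thesis by simp
qed

lemma smooth_h: "smooth_in (U \<times> UNIV) (\<lambda>z. h m N (fst z) (snd z))"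
proof -
  have op: "open (U \<times> (UNIV::real set))" by (intro open_Times open_U open_UNIV)
  have snd: "smooth_in (U \<times> UNIV) (\<lambda>z. f (snd z))" if "smooth_in UNIV f" for f :: "real \<Rightarrow> real"
    by (rule smooth_in_compose_real[OF that smooth_in_snd[OF op]]) simp
  have b: "smooth_in (U \<times> (UNIV::real set)) (\<lambda>z. b m (fst z))"
    by (rule smooth_in_compose_real[where f=fst, OF smooth_b smooth_in_fst[OF op]]) auto
  have "smooth_in UNIV (\<lambda>x. zig (kappa N) (real (Suc N) * x))"
    by (rule smooth_in_compose_real[OF smooth_zig[OF kappa(1,2)]])
      (auto intro!: smooth_in_mult smooth_in_const smooth_in_ident)
  note z = snd[OF this]
  show ?thesis unfolding h_def V_def divide_inverse
    by (intro smooth_in_add smooth_in_mult smooth_in_diff smooth_in_const smooth_in_fst[OF op] b z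
        snd[OF smooth_v] snd[OF smooth_k] op)
qed

lemma h_periodic: "h m N t (x + 2 * pi) = h m N t x"
  unfolding h_def V_def zig_periodic periodic_geometry ..

lemma h_ends: "h m N 0 x = 0" "h m N 1 x = s"
  by (simp_all add: h_def b_ends)

lemma bounds:
  "\<exists>B\<ge>0. (\<forall>t\<in>{0..1}. \<forall>x. \<bar>b m t\<bar> \<le> B \<and> \<bar>b' m t\<bar> \<le> B \<and> \<bar>V t x\<bar> \<le> B \<and> \<bar>s * k x\<bar> \<le> B \<and> \<bar>k x\<bar> \<le> B) \<and>
     (\<forall>t\<in>{0..1}. \<forall>x\<in>{0..2 * pi}. \<bar>v' x - t * s * k' x\<bar> \<le> B)"
proof -
  have "bounded (b m ` {0..1})" "bounded (b' m ` {0..1})"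
    by (intro compact_imp_bounded compact_continuous_image continuous_b compact_Icc)+
  then obtain B1 B2 where B12: "\<forall>t\<in>{0..1}. \<bar>b m t\<bar> \<le> B1" "\<forall>t\<in>{0..1}. \<bar>b' m t\<bar> \<le> B2"
    unfolding bounded_iff by (auto simp del: atLeastAtMost_iff)
  have "bounded (v' ` {0..2 * pi})" "bounded (k' ` {0..2 * pi})"
    by (intro compact_imp_bounded compact_continuous_image continuous_vk' compact_Icc)+
  then obtain B3 B4 where B34: "\<forall>x\<in>{0..2 * pi}. \<bar>v' x\<bar> \<le> B3" "\<forall>x\<in>{0..2 * pi}. \<bar>k' x\<bar> \<le> B4"
    unfolding bounded_iff by (auto simp del: atLeastAtMost_iff)
  obtain B5 B6 where B56: "\<forall>x. \<bar>v x\<bar> \<le> B5" "\<forall>x. \<bar>k x\<bar> \<le> B6"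
    using periodic_bounded[of v, OF continuous_vk(1) periodic_geometry(1)]
      periodic_bounded[of k, OF continuous_vk(2) periodic_geometry(2)] by blast
  define P4 P6 where "P4 = \<bar>s\<bar> * \<bar>B4\<bar>" and "P6 = \<bar>s\<bar> * \<bar>B6\<bar>"
  have nn: "0 \<le> B1" "0 \<le> B2" "0 \<le> B3" "0 \<le> B5" "0 \<le> B6" "0 \<le> P4" "0 \<le> P6"
  proof -
    show "0 \<le> B1" by (rule order_trans[OF abs_ge_zero bspec[OF B12(1), of 0]]) simp
    show "0 \<le> B2" by (rule order_trans[OF abs_ge_zero bspec[OF B12(2), of 0]]) simp
    show "0 \<le> B3" by (rule order_trans[OF abs_ge_zero bspec[OF B34(1), of 0]]) simp
    show "0 \<le> B5" "0 \<le> B6"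
      by (rule order_trans[OF abs_ge_zero spec[OF B56(1), of 0]], rule order_trans[OF abs_ge_zero spec[OF B56(2), of 0]])
  qed (simp_all add: P4_def P6_def)
  define B where "B = B1 + B2 + B3 + P4 + B5 + P6 + B6"
  have le: "B1 \<le> B" "B2 \<le> B" "B3 + P4 \<le> B" "B5 + P6 \<le> B" "P6 \<le> B" "B6 \<le> B"
    unfolding B_def using nn by linarith+
  have tsk: "\<bar>t * s * y\<bar> \<le> \<bar>s\<bar> * \<bar>Y\<bar>" if "t \<in> {0..1}" "\<bar>y\<bar> \<le> Y" for t y Y
  proof -
    have "\<bar>t\<bar> * (\<bar>s\<bar> * \<bar>y\<bar>) \<le> 1 * (\<bar>s\<bar> * \<bar>Y\<bar>)" using that by (intro mult_mono) auto
    then show ?thesis by (simp add: abs_mult mult.assoc)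
  qed
  have "\<bar>b m t\<bar> \<le> B \<and> \<bar>b' m t\<bar> \<le> B \<and> \<bar>V t x\<bar> \<le> B \<and> \<bar>s * k x\<bar> \<le> B \<and> \<bar>k x\<bar> \<le> B" if t: "t \<in> {0..1}" for t x
  proof (intro conjI)
    show "\<bar>b m t\<bar> \<le> B" by (rule order_trans[OF bspec[OF B12(1) t] le(1)])
    show "\<bar>b' m t\<bar> \<le> B" by (rule order_trans[OF bspec[OF B12(2) t] le(2)])
    show "\<bar>k x\<bar> \<le> B" by (rule order_trans[OF spec[OF B56(2)] le(6)])
    have "\<bar>V t x\<bar> \<le> \<bar>v x\<bar> + \<bar>t * s * k x\<bar>" unfolding V_def by (rule abs_triangle_ineq4)
    also have "\<dots> \<le> B5 + P6" unfolding P6_def by (intro add_mono tsk t spec[OF B56(1)] spec[OF B56(2)])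
    finally show "\<bar>V t x\<bar> \<le> B" using le(4) by (rule order_trans)
    have "\<bar>1 * s * k x\<bar> \<le> P6" unfolding P6_def by (rule tsk[OF _ spec[OF B56(2)]]) simp
    then show "\<bar>s * k x\<bar> \<le> B" using le(5) by simp
  qed
  moreover have "\<bar>v' x - t * s * k' x\<bar> \<le> B" if t: "t \<in> {0..1}" and x: "x \<in> {0..2 * pi}" for t x
  proof -
    have "\<bar>v' x - t * s * k' x\<bar> \<le> \<bar>v' x\<bar> + \<bar>t * s * k' x\<bar>" by (rule abs_triangle_ineq4)
    also have "\<dots> \<le> B3 + P4" unfolding P4_def by (intro add_mono tsk t bspec[OF B34(1) x] bspec[OF B34(2) x])
    finally show ?thesis using le(3) by (rule order_trans)
  qed
  moreover have "0 \<le> B" unfolding B_def using nn by linarith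
  ultimately show ?thesis by (intro exI[of _ B]) simp
qed

end

context parallel_strip
begin

lemma abs_sqrt: "\<bar>sqrt y\<bar> = sqrt \<bar>y\<bar>"
  by (simp add: abs_if real_sqrt_minus)

definition Len :: "nat \<Rightarrow> nat \<Rightarrow> real \<Rightarrow> real" where
  "Len m N t = integral {0..2 * pi} (\<lambda>x. sqrt ((W m N t x)\<^sup>2 + (hx m N t x)\<^sup>2))"

definition En :: "nat \<Rightarrow> nat \<Rightarrow> real \<Rightarrow> real" where
  "En m N t = integral {0..2 * pi} (\<lambda>x. (ht m N t x * W m N t x)\<^sup>2 / sqrt ((W m N t x)\<^sup>2 + (hx m N t x)\<^sup>2))"

lemma zigzag_path:
  assumes pos: "\<And>t x. t \<in> {0..1} \<Longrightarrow> 0 < W m N t x"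
  shows "imm_path (graph (h m N))"
    and "path_cost (\<lambda>l. exp (A * l)) (graph (h m N)) = integral {0..1} (\<lambda>t. sqrt (exp (A * Len m N t) * En m N t))"
    and "continuous_on {0..1} (\<lambda>t. sqrt (exp (A * Len m N t) * En m N t))"
proof -
  note gh = graph_homotopy[of U "h m N" "ht m N" "hx m N", OF open_U unit_U smooth_h h_periodic pos[unfolded W_def] h_deriv_t h_deriv_x]
  show "imm_path (graph (h m N))" by (rule gh(1))
  obtain pt px ptx pxx where lh: "loop_homotopy (graph (h m N)) pt px ptx pxx"
    and px: "\<And>t x. t \<in> {0..1} \<Longrightarrow> cmod (px t x) = sqrt ((W m N t x)\<^sup>2 + (hx m N t x)\<^sup>2)"
    and J: "\<And>t x. t \<in> {0..1} \<Longrightarrow> Im (cnj (pt t x) * px t x) = - (ht m N t x * W m N t x)"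
    using gh(2) unfolding W_def[symmetric] by blast
  interpret loop_homotopy "graph (h m N)" pt px ptx pxx by (rule lh)
  have len: "len t = Len m N t" if "t \<in> {0..1}" for t
    unfolding len_def Len_def px[OF that] ..
  have en: "energy t = En m N t" if "t \<in> {0..1}" for t
    unfolding energy_def En_def J_def px[OF that] J[OF that] by simp
  show "path_cost (\<lambda>l. exp (A * l)) (graph (h m N)) = integral {0..1} (\<lambda>t. sqrt (exp (A * Len m N t) * En m N t))"
    unfolding path_cost_eq by (rule integral_cong) (simp add: len en)
  have "continuous_on {0..1} (\<lambda>t. sqrt (exp (A * len t) * energy t))"
    by (intro continuous_intros continuous_len_energy_sweep)
  then show "continuous_on {0..1} (\<lambda>t. sqrt (exp (A * Len m N t) * En m N t))"
    by (rule continuous_on_eq) (simp add: len en)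
qed

lemma continuous_zigzag:
  assumes t: "t \<in> {0..1}"
  shows "continuous_on X (W m N t)" "continuous_on X (hx m N t)" "continuous_on X (ht m N t)"
proof -
  have z: "continuous_on X (\<lambda>x. zig (kappa N) (real (Suc N) * x))"
    by (rule continuous_on_compose2[OF smooth_in_continuous_on[OF smooth_zig[OF kappa(1,2)]]])
      (auto intro!: continuous_intros)
  have z': "continuous_on X (\<lambda>x. zig' (kappa N) (real (Suc N) * x))"
    by (rule continuous_on_compose2[OF continuous_zig'[OF kappa(1,2)]]) (auto intro!: continuous_intros)
  have V: "continuous_on X (V t)" unfolding V_def[abs_def] by (intro continuous_intros continuous_vk)
  show "continuous_on X (W m N t)" unfolding W_eq[abs_def] by (intro continuous_intros V z continuous_vk) simp
  show "continuous_on X (hx m N t)" unfolding hx_def[abs_def] by (intro continuous_intros V z z' continuous_vk') simp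
  show "continuous_on X (ht m N t)" unfolding ht_def[abs_def] by (intro continuous_intros V z continuous_vk) simp
qed

definition stretch :: "nat \<Rightarrow> real \<Rightarrow> real" where
  "stretch m t = sqrt (1 + (b m t)\<^sup>2)"

lemma stretch_ge_1: "1 \<le> stretch m t"
  by (simp add: stretch_def)

text \<open>In the limit of high frequency the zigzag multiplies the length by \<open>stretch\<close> and divides the integral of the squared
  normal speed by it: the normal makes an angle with the direction of motion whose cosine is
  \<open>1 / stretch\<close>.\<close>

definition limit_cost :: "nat \<Rightarrow> real" where
  "limit_cost m = integral {0..1} (\<lambda>t. sqrt (exp (A * (stretch m t * ell t)) * (s\<^sup>2 * ell t / stretch m t)))"

lemma zig_term_bound: "\<bar>zig (kappa N) (real (Suc N) * x) / real (Suc N)\<bar> \<le> 2 / real (Suc N)"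
  using zig_bounds(1)[OF kappa(1,2)] by (simp add: abs_divide divide_right_mono del: of_nat_Suc)

lemma zigzag_bounds:
  "\<exists>C\<ge>0. \<forall>t\<in>{0..1}. \<forall>x\<in>{0..2 * pi}. \<forall>N. \<bar>W m N t x\<bar> \<le> C \<and> \<bar>hx m N t x\<bar> \<le> C \<and> \<bar>ht m N t x\<bar> \<le> C"
proof -
  obtain B where B0: "0 \<le> B"
    and B1: "\<forall>t\<in>{0..1}. \<forall>x. \<bar>b m t\<bar> \<le> B \<and> \<bar>b' m t\<bar> \<le> B \<and> \<bar>V t x\<bar> \<le> B \<and> \<bar>s * k x\<bar> \<le> B \<and> \<bar>k x\<bar> \<le> B"
    and B2: "\<forall>t\<in>{0..1}. \<forall>x\<in>{0..2 * pi}. \<bar>v' x - t * s * k' x\<bar> \<le> B"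
    using bounds[of m] by blast
  define C where "C = B + B * B * B * 2 + (B * B * 2 + B * B * 1) + (\<bar>s\<bar> + (B * B + B * B) * 2)"
  have parts: "0 \<le> B * B * B * 2" "0 \<le> B * B * 2" "0 \<le> B * B" using B0 by auto
  have "\<bar>W m N t x\<bar> \<le> C \<and> \<bar>hx m N t x\<bar> \<le> C \<and> \<bar>ht m N t x\<bar> \<le> C" if t: "t \<in> {0..1}" and x: "x \<in> {0..2 * pi}" for t x N
  proof -
    define z where "z = zig (kappa N) (real (Suc N) * x) / real (Suc N)"
    define z' where "z' = zig' (kappa N) (real (Suc N) * x)"
    have "2 / real (Suc N) \<le> 2" by (simp add: field_simps)
    then have z: "\<bar>z\<bar> \<le> 2" using zig_term_bound[of N x] unfolding z_def by linarith
    have z': "\<bar>z'\<bar> \<le> 1" unfolding z'_def by (rule zig_bounds(2)[OF kappa(1,2)])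
    have bd: "\<bar>b m t\<bar> \<le> B" "\<bar>b' m t\<bar> \<le> B" "\<bar>V t x\<bar> \<le> B" "\<bar>s * k x\<bar> \<le> B" "\<bar>k x\<bar> \<le> B" "\<bar>v' x - t * s * k' x\<bar> \<le> B"
      using B1 B2 t x by blast+
    have mult: "\<bar>a * c\<bar> \<le> X * Y" if "\<bar>a\<bar> \<le> X" "\<bar>c\<bar> \<le> Y" for a c X Y :: real
      unfolding abs_mult using that by (intro mult_mono) auto
    have "\<bar>W m N t x\<bar> \<le> \<bar>V t x\<bar> + \<bar>b m t * V t x * k x * z\<bar>"
      unfolding W_eq z_def times_divide_eq_right[symmetric] by (rule abs_triangle_ineq4)
    also have "\<dots> \<le> B + B * B * B * 2" by (intro add_mono mult bd z)
    finally have W: "\<bar>W m N t x\<bar> \<le> B + B * B * B * 2" .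
    have "\<bar>hx m N t x\<bar> \<le> \<bar>b m t * (v' x - t * s * k' x) * z\<bar> + \<bar>b m t * V t x * z'\<bar>"
      unfolding hx_def z_def z'_def times_divide_eq_right[symmetric] by (rule abs_triangle_ineq)
    also have "\<dots> \<le> B * B * 2 + B * B * 1" by (intro add_mono mult bd z z')
    finally have hx: "\<bar>hx m N t x\<bar> \<le> B * B * 2 + B * B * 1" .
    have "\<bar>b' m t * V t x - b m t * (s * k x)\<bar> \<le> \<bar>b' m t * V t x\<bar> + \<bar>b m t * (s * k x)\<bar>" by (rule abs_triangle_ineq4)
    also have "\<dots> \<le> B * B + B * B" by (intro add_mono mult bd)
    finally have d: "\<bar>b' m t * V t x - b m t * (s * k x)\<bar> \<le> B * B + B * B" .
    have "\<bar>ht m N t x\<bar> \<le> \<bar>s\<bar> + \<bar>(b' m t * V t x - b m t * (s * k x)) * z\<bar>"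
      unfolding ht_def z_def times_divide_eq_right[symmetric] by (rule abs_triangle_ineq)
    also have "\<dots> \<le> \<bar>s\<bar> + (B * B + B * B) * 2" by (intro add_mono mult d z order_refl)
    finally have ht: "\<bar>ht m N t x\<bar> \<le> \<bar>s\<bar> + (B * B + B * B) * 2" .
    show ?thesis
      using W hx ht B0 parts abs_ge_zero[of s] unfolding C_def by (intro conjI) linarith+
  qed
  moreover have "0 \<le> C" unfolding C_def
    by (intro add_nonneg_nonneg mult_nonneg_nonneg B0 abs_ge_zero) auto
  ultimately show ?thesis by blast
qed

lemma zigzag_positive: "\<exists>N0. \<forall>N\<ge>N0. \<forall>t\<in>{0..1}. \<forall>x. 0 < W m N t x"
proof -
  obtain B where B0: "0 \<le> B"
    and B1: "\<forall>t\<in>{0..1}. \<forall>x. \<bar>b m t\<bar> \<le> B \<and> \<bar>b' m t\<bar> \<le> B \<and> \<bar>V t x\<bar> \<le> B \<and> \<bar>s * k x\<bar> \<le> B \<and> \<bar>k x\<bar> \<le> B"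
    using bounds[of m] by blast
  obtain \<delta> where \<delta>: "\<delta> > 0" "\<forall>t\<in>{0..1}. \<forall>x. \<delta> \<le> V t x" using V_lower by blast
  obtain N0 :: nat where N0: "B * B * B * 2 / \<delta> < real N0" using reals_Archimedean2 by blast
  have "0 < W m N t x" if N: "N \<ge> N0" and t: "t \<in> {0..1}" for N t x
  proof -
    define z where "z = zig (kappa N) (real (Suc N) * x) / real (Suc N)"
    have bd: "\<bar>b m t\<bar> \<le> B" "\<bar>V t x\<bar> \<le> B" "\<bar>k x\<bar> \<le> B" using B1 t by blast+
    have mult: "\<bar>a * c\<bar> \<le> X * Y" if "\<bar>a\<bar> \<le> X" "\<bar>c\<bar> \<le> Y" for a c X Y :: real
      unfolding abs_mult using that by (intro mult_mono) auto
    have "\<bar>b m t * V t x * k x * z\<bar> \<le> B * B * B * (2 / real (Suc N))"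
      by (intro mult bd) (use zig_term_bound[of N x] in \<open>simp only: z_def\<close>)
    also have "\<dots> < \<delta>"
    proof -
      have "B * B * B * 2 < \<delta> * real N0" using N0 \<delta>(1) by (simp add: field_simps)
      also have "\<dots> \<le> \<delta> * real (Suc N)" using N \<delta>(1) by (intro mult_left_mono) auto
      finally show ?thesis by (simp add: pos_divide_less_eq del: of_nat_Suc)
    qed
    finally have "\<bar>b m t * V t x * k x * z\<bar> < \<delta>" .
    moreover have "\<delta> \<le> V t x" using \<delta>(2) t by blast
    moreover have "W m N t x = V t x - b m t * V t x * k x * z"
      unfolding W_eq z_def times_divide_eq_right[symmetric] ..
    ultimately show ?thesis by linarith
  qed
  then show ?thesis by blast
qed

text \<open>Off a null set of angles the speed of the zigzag curve tends to \<open>stretch m t * V t x\<close> and its normal speed to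
  \<open>\<bar>s\<bar> / stretch m t\<close>, since the amplitude tends to \<open>0\<close> and the square of the slope of the wave to \<open>1\<close>.
  Dominated convergence, first in the angle and then in time, yields the limit of the costs.\<close>

lemma zigzag_paths:
  "\<exists>R. (\<forall>j. \<forall>t\<in>{0..1}. \<forall>x. 0 < W m (R j) t x) \<and>
     (\<lambda>j. path_cost (\<lambda>l. exp (A * l)) (graph (h m (R j)))) \<longlonglongrightarrow> limit_cost m"
proof -
  obtain N0 where N0: "\<forall>N\<ge>N0. \<forall>t\<in>{0..1}. \<forall>x. 0 < W m N t x" using zigzag_positive by blast
  obtain r Z where r: "strict_mono r" and Z: "negligible Z"
    and z1: "\<forall>x\<in>{0..2 * pi} - Z. (\<lambda>j. \<bar>zig' (kappa (r j)) (real (Suc (r j)) * x)\<bar>) \<longlonglongrightarrow> 1"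
    using zigzag_subsequence by blast
  obtain C where C0: "0 \<le> C" and C: "\<forall>t\<in>{0..1}. \<forall>x\<in>{0..2 * pi}. \<forall>N. \<bar>W m N t x\<bar> \<le> C \<and> \<bar>hx m N t x\<bar> \<le> C \<and> \<bar>ht m N t x\<bar> \<le> C"
    using zigzag_bounds by blast
  \<comment> \<open>The first terms are dropped, as their curves need not be immersed.\<close>
  define R where "R = (\<lambda>j. r (j + N0))"
  have R_ge: "j + N0 \<le> R j" for j unfolding R_def by (rule seq_suble[OF r])
  have pos: "0 < W m (R j) t x" if "t \<in> {0..1}" for j t x
    using N0 R_ge[of j] that by auto
  have cost: "path_cost (\<lambda>l. exp (A * l)) (graph (h m (R j))) =
      integral {0..1} (\<lambda>t. sqrt (exp (A * Len m (R j) t) * En m (R j) t))"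
    and cont: "continuous_on {0..1} (\<lambda>t. sqrt (exp (A * Len m (R j) t) * En m (R j) t))" for j
    using zigzag_path(2,3)[of m "R j"] pos by blast+
  let ?Q = "\<lambda>j t x. sqrt ((W m (R j) t x)\<^sup>2 + (hx m (R j) t x)\<^sup>2)"
  let ?E = "\<lambda>j t x. (ht m (R j) t x * W m (R j) t x)\<^sup>2 / ?Q j t x"
  have Qge: "W m (R j) t x \<le> ?Q j t x" for j t x by (rule real_le_rsqrt) simp
  have Qpos: "0 < ?Q j t x" if "t \<in> {0..1}" for j t x using pos[OF that] Qge by (rule less_le_trans)
  have cQ: "continuous_on {0..2 * pi} (?Q j t)" if t: "t \<in> {0..1}" for j t
    by (intro continuous_intros continuous_zigzag t)
  have cE: "continuous_on {0..2 * pi} (?E j t)" if t: "t \<in> {0..1}" for j t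
  proof -
    have "?Q j t x \<noteq> 0" for x using Qpos[OF t, of j x] by linarith
    then show ?thesis by (intro continuous_on_divide continuous_intros continuous_zigzag t ballI)
  qed
  have bQ: "\<bar>?Q j t x\<bar> \<le> C + C" if t: "t \<in> {0..1}" and x: "x \<in> {0..2 * pi}" for j t x
  proof -
    have "?Q j t x \<le> \<bar>W m (R j) t x\<bar> + \<bar>hx m (R j) t x\<bar>" by (rule sqrt_sum_squares_le_sum_abs)
    also have "\<dots> \<le> C + C" using C t x by (intro add_mono) blast+
    finally show ?thesis by simp
  qed
  have bE: "\<bar>?E j t x\<bar> \<le> C * C * C" if t: "t \<in> {0..1}" and x: "x \<in> {0..2 * pi}" for j t x
  proof -
    let ?w = "W m (R j) t x" and ?g = "ht m (R j) t x"
    have w: "0 < ?w" by (rule pos[OF t])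
    have "?E j t x \<le> (?g * ?w)\<^sup>2 / ?w"
      by (intro divide_left_mono Qge mult_pos_pos w Qpos[OF t]) simp
    also have "\<dots> = \<bar>?g\<bar> * \<bar>?g\<bar> * ?w" using w by (simp add: power2_eq_square)
    also have "\<dots> \<le> C * C * C" using C t x w C0 by (intro mult_mono) (auto simp: abs_le_iff)
    finally have "?E j t x \<le> C * C * C" .
    moreover have "0 \<le> ?E j t x" by simp
    ultimately show ?thesis by simp
  qed
  have lim_x: "(\<lambda>j. ?Q j t x) \<longlonglongrightarrow> stretch m t * V t x" "(\<lambda>j. ?E j t x) \<longlonglongrightarrow> s\<^sup>2 / stretch m t * V t x"
    if t: "t \<in> {0..1}" and x: "x \<in> {0..2 * pi}" "x \<notin> Z" for t x
  proof -
    define z where "z = (\<lambda>j. zig (kappa (R j)) (real (Suc (R j)) * x) / real (Suc (R j)))"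
    define z' where "z' = (\<lambda>j. zig' (kappa (R j)) (real (Suc (R j)) * x))"
    have z0: "z \<longlonglongrightarrow> 0"
    proof (rule Lim_null_comparison)
      have "\<bar>z j\<bar> \<le> 2 * (1 / real (Suc j))" for j
      proof -
        have "\<bar>z j\<bar> \<le> 2 / real (Suc (R j))" unfolding z_def by (rule zig_term_bound)
        also have "\<dots> \<le> 2 / real (Suc j)" using R_ge[of j] by (intro divide_left_mono) auto
        finally show ?thesis by simp
      qed
      then show "\<forall>\<^sub>F j in sequentially. norm (z j) \<le> 2 * (1 / real (Suc j))" by simp
      show "(\<lambda>j. 2 * (1 / real (Suc j))) \<longlonglongrightarrow> 0"
        using tendsto_mult_right_zero[OF LIMSEQ_inverse_real_of_nat, of 2] by (simp add: inverse_eq_divide)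
    qed
    have "(\<lambda>j. \<bar>z' j\<bar>) \<longlonglongrightarrow> 1"
      using LIMSEQ_ignore_initial_segment[OF bspec[OF z1], of x N0] x unfolding z'_def R_def by simp
    from tendsto_power[OF this, of 2] have z'2: "(\<lambda>j. (z' j)\<^sup>2) \<longlonglongrightarrow> 1" by simp
    have zz': "(\<lambda>j. z j * z' j) \<longlonglongrightarrow> 0"
    proof (rule Lim_null_comparison)
      have "norm (z j * z' j) \<le> \<bar>z j\<bar>" for j
        using mult_left_mono[OF zig_bounds(2)[OF kappa(1,2), of "R j" "real (Suc (R j)) * x"], of "\<bar>z j\<bar>"]
        by (simp add: abs_mult z'_def)
      then show "\<forall>\<^sub>F j in sequentially. norm (z j * z' j) \<le> \<bar>z j\<bar>" by simp
      show "(\<lambda>j. \<bar>z j\<bar>) \<longlonglongrightarrow> 0" using tendsto_rabs_zero[OF z0] .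
    qed
    have W: "(\<lambda>j. W m (R j) t x) \<longlonglongrightarrow> V t x"
    proof -
      have "(\<lambda>j. V t x - b m t * V t x * k x * z j) \<longlonglongrightarrow> V t x - b m t * V t x * k x * 0"
        by (intro tendsto_intros z0)
      then show ?thesis unfolding W_eq z_def times_divide_eq_right[symmetric] by simp
    qed
    have ht: "(\<lambda>j. ht m (R j) t x) \<longlonglongrightarrow> s"
    proof -
      have "(\<lambda>j. s + (b' m t * V t x - b m t * (s * k x)) * z j) \<longlonglongrightarrow> s + (b' m t * V t x - b m t * (s * k x)) * 0"
        by (intro tendsto_intros z0)
      then show ?thesis unfolding ht_def z_def times_divide_eq_right[symmetric] by simp
    qed
    have hx: "(\<lambda>j. (hx m (R j) t x)\<^sup>2) \<longlonglongrightarrow> (b m t * V t x)\<^sup>2"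
    proof -
      let ?d = "b m t * (v' x - t * s * k' x)" and ?e = "b m t * V t x"
      have "(\<lambda>j. ?d\<^sup>2 * (z j)\<^sup>2 + 2 * ?d * ?e * (z j * z' j) + ?e\<^sup>2 * (z' j)\<^sup>2) \<longlonglongrightarrow> ?d\<^sup>2 * 0\<^sup>2 + 2 * ?d * ?e * 0 + ?e\<^sup>2 * 1"
        by (intro tendsto_intros z0 zz' z'2)
      moreover have "(hx m (R j) t x)\<^sup>2 = ?d\<^sup>2 * (z j)\<^sup>2 + 2 * ?d * ?e * (z j * z' j) + ?e\<^sup>2 * (z' j)\<^sup>2" for j
      proof -
        have "hx m (R j) t x = ?d * z j + ?e * z' j"
          unfolding hx_def z_def z'_def times_divide_eq_right[symmetric] ..
        moreover have "(d * zz + e * ww)\<^sup>2 = d\<^sup>2 * zz\<^sup>2 + 2 * d * e * (zz * ww) + e\<^sup>2 * ww\<^sup>2" for d e zz ww :: real by algebra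
        ultimately show ?thesis by simp
      qed
      ultimately show ?thesis by simp
    qed
    have VQ: "sqrt ((V t x)\<^sup>2 + (b m t * V t x)\<^sup>2) = stretch m t * V t x"
    proof -
      have "(V t x)\<^sup>2 + (b m t * V t x)\<^sup>2 = (1 + (b m t)\<^sup>2) * (V t x)\<^sup>2" by algebra
      then show ?thesis using V_pos[OF t, of x] by (simp add: stretch_def real_sqrt_mult)
    qed
    have "(\<lambda>j. ?Q j t x) \<longlonglongrightarrow> sqrt ((V t x)\<^sup>2 + (b m t * V t x)\<^sup>2)"
      by (intro tendsto_intros W hx)
    then show Q: "(\<lambda>j. ?Q j t x) \<longlonglongrightarrow> stretch m t * V t x" unfolding VQ .
    have nz: "stretch m t * V t x \<noteq> 0" using stretch_ge_1[of m t] V_pos[OF t, of x] by auto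
    have "(\<lambda>j. ?E j t x) \<longlonglongrightarrow> (s * V t x)\<^sup>2 / (stretch m t * V t x)"
      by (intro tendsto_divide tendsto_power tendsto_mult ht W Q nz)
    moreover have "(s * V t x)\<^sup>2 / (stretch m t * V t x) = s\<^sup>2 / stretch m t * V t x"
      using nz by (simp add: power2_eq_square)
    ultimately show "(\<lambda>j. ?E j t x) \<longlonglongrightarrow> s\<^sup>2 / stretch m t * V t x" by simp
  qed
  have lenlim: "(\<lambda>j. Len m (R j) t) \<longlonglongrightarrow> stretch m t * ell t" if t: "t \<in> {0..1}" for t
  proof -
    have "(\<lambda>j. integral {0..2 * pi} (?Q j t)) \<longlonglongrightarrow> integral {0..2 * pi} (\<lambda>x. stretch m t * V t x)"
      by (rule dominated_convergence_negligible[OF cQ[OF t] bQ[OF t] Z lim_x(1)[OF t]])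
    then show ?thesis unfolding Len_def by (simp add: integral_V)
  qed
  have enlim: "(\<lambda>j. En m (R j) t) \<longlonglongrightarrow> s\<^sup>2 * ell t / stretch m t" if t: "t \<in> {0..1}" for t
  proof -
    have "(\<lambda>j. integral {0..2 * pi} (?E j t)) \<longlonglongrightarrow> integral {0..2 * pi} (\<lambda>x. s\<^sup>2 / stretch m t * V t x)"
      by (rule dominated_convergence_negligible[OF cE[OF t] bE[OF t] Z lim_x(2)[OF t]])
    then show ?thesis unfolding En_def by (simp add: integral_V)
  qed
  have bound_int: "\<bar>integral {0..2 * pi} f\<bar> \<le> X * (2 * pi)"
    if "continuous_on {0..2 * pi} f" "\<And>x. x \<in> {0..2 * pi} \<Longrightarrow> \<bar>f x\<bar> \<le> X" for f :: "real \<Rightarrow> real" and X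
    using integral_bound[of 0 "2 * pi" f X] that by simp
  have "(\<lambda>j. integral {0..1} (\<lambda>t. sqrt (exp (A * Len m (R j) t) * En m (R j) t))) \<longlonglongrightarrow> limit_cost m"
    unfolding limit_cost_def
  proof (rule dominated_convergence_negligible[OF cont _ negligible_empty])
    fix j :: nat and t :: real assume t: "t \<in> {0..1}"
    have L: "\<bar>Len m (R j) t\<bar> \<le> (C + C) * (2 * pi)" unfolding Len_def by (rule bound_int[OF cQ[OF t] bQ[OF t]])
    have E: "\<bar>En m (R j) t\<bar> \<le> (C * C * C) * (2 * pi)" unfolding En_def by (rule bound_int[OF cE[OF t] bE[OF t]])
    have "A * Len m (R j) t \<le> A * ((C + C) * (2 * pi))" using L A by (intro mult_left_mono) auto
    then have "\<bar>exp (A * Len m (R j) t) * En m (R j) t\<bar> \<le> exp (A * ((C + C) * (2 * pi))) * ((C * C * C) * (2 * pi))"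
      unfolding abs_mult using E by (intro mult_mono) auto
    then show "\<bar>sqrt (exp (A * Len m (R j) t) * En m (R j) t)\<bar> \<le> sqrt (exp (A * ((C + C) * (2 * pi))) * ((C * C * C) * (2 * pi)))"
      unfolding abs_sqrt by (rule real_sqrt_le_mono)
  next
    fix t :: real assume "t \<in> {0..1}"
    then show "(\<lambda>j. sqrt (exp (A * Len m (R j) t) * En m (R j) t)) \<longlonglongrightarrow>
        sqrt (exp (A * (stretch m t * ell t)) * (s\<^sup>2 * ell t / stretch m t))"
      by (intro tendsto_intros lenlim enlim)
  qed
  then have "(\<lambda>j. path_cost (\<lambda>l. exp (A * l)) (graph (h m (R j)))) \<longlonglongrightarrow> limit_cost m"
    unfolding cost .
  then show ?thesis using pos by (intro exI[of _ R] conjI) auto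
qed

text \<open>For \<open>0 < t < 1\<close> the stretched length tends to \<open>1 / A\<close>, where \<open>exp (A * \<ell>) / \<ell>\<close> takes its minimum
  \<open>A * exp 1\<close>.\<close>

lemma limit_cost_limit: "limit_cost \<longlonglongrightarrow> sqrt (A * exp 1) * (\<bar>s\<bar> * integral {0..1} ell)"
proof -
  have cell: "continuous_on {0..1} ell" unfolding ell_def[abs_def] by (intro continuous_intros)
  have cstr: "continuous_on {0..1} (stretch m)" for m
    unfolding stretch_def[abs_def] by (intro continuous_intros continuous_b)
  have ell: "0 < A * ell t" "A * ell t < 1" "0 < ell t" if "t \<in> {0..1}" for t
    using unit_U that A by (auto simp: U_def zero_less_mult_iff)
  have "limit_cost \<longlonglongrightarrow> integral {0..1} (\<lambda>t. sqrt (A * exp 1) * \<bar>s\<bar> * ell t)"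
    unfolding limit_cost_def[abs_def]
  proof (rule dominated_convergence_negligible[where N="{0, 1}"])
    show "continuous_on {0..1} (\<lambda>t. sqrt (exp (A * (stretch m t * ell t)) * (s\<^sup>2 * ell t / stretch m t)))" for m
      by (intro continuous_intros cell cstr) (metis not_one_le_zero stretch_ge_1)
    show "negligible {0, 1 :: real}" by (intro negligible_finite) simp
  next
    fix m t assume t: "t \<in> {0..1::real}"
    have "(b m t)\<^sup>2 \<le> (steep t)\<^sup>2"
      unfolding b_def power_mult_distrib using cutoff_bounds[OF t, of m]
      by (intro mult_left_le_one_le) (auto simp: power_le_one)
    then have "stretch m t \<le> sqrt (1 + (steep t)\<^sup>2)" unfolding stretch_def by simp
    then have "stretch m t \<le> 1 / (A * ell t)" unfolding steep_eq[OF t] .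
    then have 1: "A * (stretch m t * ell t) \<le> 1" using ell[OF t] A by (simp add: field_simps)
    have s0: "0 < stretch m t" using stretch_ge_1[of m t] by linarith
    have "ell t \<le> 1 / A" using ell[OF t] A by (simp add: field_simps)
    moreover have "ell t / stretch m t \<le> ell t"
      using stretch_ge_1[of m t] ell(3)[OF t] s0 by (simp add: divide_le_eq)
    ultimately have "ell t / stretch m t \<le> 1 / A" by linarith
    then have 2: "s\<^sup>2 * ell t / stretch m t \<le> s\<^sup>2 * (1 / A)"
      unfolding times_divide_eq_right[symmetric] by (intro mult_left_mono) auto
    have 3: "0 \<le> s\<^sup>2 * ell t / stretch m t" using ell(3)[OF t] s0 by simp
    have "exp (A * (stretch m t * ell t)) * (s\<^sup>2 * ell t / stretch m t) \<le> exp 1 * (s\<^sup>2 * (1 / A))"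
      using 1 2 3 by (intro mult_mono) auto
    then have "sqrt (exp (A * (stretch m t * ell t)) * (s\<^sup>2 * ell t / stretch m t)) \<le> sqrt (exp 1 * (s\<^sup>2 * (1 / A)))"
      by (rule real_sqrt_le_mono)
    moreover have "0 \<le> exp (A * (stretch m t * ell t)) * (s\<^sup>2 * ell t / stretch m t)"
      by (intro mult_nonneg_nonneg 3) simp
    ultimately show "\<bar>sqrt (exp (A * (stretch m t * ell t)) * (s\<^sup>2 * ell t / stretch m t))\<bar> \<le> sqrt (exp 1 * (s\<^sup>2 * (1 / A)))"
      by (simp only: abs_of_nonneg real_sqrt_ge_zero)
  next
    fix t :: real assume t: "t \<in> {0..1}" "t \<notin> {0, 1}"
    then have t01: "0 < t" "t < 1" by auto
    have "(\<lambda>m. sqrt (1 + (b m t)\<^sup>2)) \<longlonglongrightarrow> sqrt (1 + (steep t)\<^sup>2)"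
      by (intro tendsto_intros b_limit t01)
    then have st: "(\<lambda>m. stretch m t) \<longlonglongrightarrow> 1 / (A * ell t)" unfolding stretch_def steep_eq[OF t(1)] .
    have "(\<lambda>m. sqrt (exp (A * (stretch m t * ell t)) * (s\<^sup>2 * ell t / stretch m t))) \<longlonglongrightarrow>
      sqrt (exp (A * (1 / (A * ell t) * ell t)) * (s\<^sup>2 * ell t / (1 / (A * ell t))))"
      by (intro tendsto_intros st) (use ell[OF t(1)] in auto)
    also have "A * (1 / (A * ell t) * ell t) = 1" using ell[OF t(1)] A by simp
    also have "exp 1 * (s\<^sup>2 * ell t / (1 / (A * ell t))) = (A * exp 1) * (\<bar>s\<bar> * ell t)\<^sup>2"
      by (simp add: power_mult_distrib power2_eq_square)
    also have "sqrt ((A * exp 1) * (\<bar>s\<bar> * ell t)\<^sup>2) = sqrt (A * exp 1) * \<bar>s\<bar> * ell t"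
      using ell(3)[OF t(1)] by (simp add: real_sqrt_mult abs_mult)
    finally show "(\<lambda>m. sqrt (exp (A * (stretch m t * ell t)) * (s\<^sup>2 * ell t / stretch m t))) \<longlonglongrightarrow>
      sqrt (A * exp 1) * \<bar>s\<bar> * ell t" .
  qed
  then show ?thesis by (simp add: mult.assoc)
qed

lemma cheap_path:
  assumes e: "e > 0"
  shows "\<exists>P. imm_path P \<and> P 0 = c \<and> P 1 = (\<lambda>x. c x + s *\<^sub>R n x) \<and>
    path_cost (\<lambda>l. exp (A * l)) P < sqrt (A * exp 1) * (\<bar>s\<bar> * integral {0..1} ell) + e"
proof -
  let ?L = "sqrt (A * exp 1) * (\<bar>s\<bar> * integral {0..1} ell)"
  have "\<forall>\<^sub>F m in sequentially. limit_cost m < ?L + e / 2"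
    by (rule order_tendstoD(2)[OF limit_cost_limit]) (use e in simp)
  from eventually_happens'[OF sequentially_bot this]
  obtain m where m: "limit_cost m < ?L + e / 2" by blast
  obtain R where R: "\<forall>j. \<forall>t\<in>{0..1}. \<forall>x. 0 < W m (R j) t x"
    "(\<lambda>j. path_cost (\<lambda>l. exp (A * l)) (graph (h m (R j)))) \<longlonglongrightarrow> limit_cost m"
    using zigzag_paths by blast
  have "\<forall>\<^sub>F j in sequentially. path_cost (\<lambda>l. exp (A * l)) (graph (h m (R j))) < ?L + e / 2"
    by (rule order_tendstoD(2)[OF R(2) m])
  from eventually_happens'[OF sequentially_bot this]
  obtain j where j: "path_cost (\<lambda>l. exp (A * l)) (graph (h m (R j))) < ?L + e / 2" by blast
  have "imm_path (graph (h m (R j)))" by (rule zigzag_path(1)) (use R(1) in blast)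
  moreover have "graph (h m (R j)) 0 = c" "graph (h m (R j)) 1 = (\<lambda>x. c x + s *\<^sub>R n x)"
    by (auto simp: graph_def h_ends)
  moreover have "path_cost (\<lambda>l. exp (A * l)) (graph (h m (R j))) < ?L + e" using j e by simp
  ultimately show ?thesis by blast
qed

text \<open>The straight motion along the normals has a Jacobian of constant sign, so that the area it sweeps
  is the flat distance. Without motion (\<open>s = 0\<close>) there is nothing to sweep.\<close>

lemma swept_area_le_d_flat:
  assumes c0: "c \<in> oriented_curve c0" and c1: "(\<lambda>x. c x + s *\<^sub>R n x) \<in> oriented_curve c1"
  shows "\<bar>s\<bar> * integral {0..1} ell \<le> d_flat (oriented_curve c0) (oriented_curve c1)"
proof (cases "s = 0")
  case True
  then show ?thesis by (simp add: d_flat_def)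
next
  case False
  let ?h = "\<lambda>t x. t * s :: real"
  have sm: "smooth_in (UNIV \<times> UNIV) (\<lambda>z::real \<times> real. fst z * s)"
    by (intro smooth_in_mult smooth_in_const smooth_in_fst) simp_all
  have pos: "0 < v x - t * s * k x" if "t \<in> {0..1}" for t x using V_pos[OF that, of x] by (simp add: V_def)
  have dt: "((\<lambda>t. t * s) has_real_derivative s) (at t within {0..1})" for t
    by (auto intro!: derivative_eq_intros)
  have dx: "((\<lambda>x. t * s) has_real_derivative 0) (at x)" for t x :: real by simp
  obtain pt px ptx pxx where lh: "loop_homotopy (graph ?h) pt px ptx pxx"
    and J: "\<And>t x. t \<in> {0..1} \<Longrightarrow> Im (cnj (pt t x) * px t x) = - (s * V t x)"
    using graph_homotopy(2)[of UNIV ?h "\<lambda>t x. s" "\<lambda>t x. 0", OF open_UNIV subset_UNIV sm _ pos dt dx]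
    unfolding V_def by blast
  interpret loop_homotopy "graph ?h" pt px ptx pxx by (rule lh)
  have ends: "graph ?h 0 = c" "graph ?h 1 = (\<lambda>x. c x + s *\<^sub>R n x)" by (auto simp: graph_def)
  have "d_flat (oriented_curve c0) (oriented_curve c1) = swept_area"
  proof (rule d_flat_eq_swept_area[where \<sigma>="- sgn s"])
    fix t x :: real assume t: "t \<in> {0..1}"
    have "- sgn s * J t x = \<bar>s\<bar> * V t x" unfolding J_def J[OF t] by (simp add: abs_sgn)
    then show "0 < - sgn s * J t x" using V_pos[OF t] False by simp
  qed (use c0 c1 ends False in \<open>simp_all add: abs_sgn_eq\<close>)
  moreover have "swept_area = integral {0..1} (\<lambda>t. \<bar>s\<bar> * ell t)"
    unfolding swept_area_def
  proof (rule integral_cong)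
    fix t :: real assume t: "t \<in> {0..1}"
    have "\<bar>J t x\<bar> = \<bar>s\<bar> * V t x" for x
      unfolding J_def J[OF t] using V_pos[OF t, of x] by (simp add: abs_mult)
    then show "integral {0..2 * pi} (\<lambda>x. \<bar>J t x\<bar>) = \<bar>s\<bar> * ell t" by (simp add: integral_V)
  qed
  ultimately show ?thesis by simp
qed

end

section \<open>The distance\<close>

lemma path_cost_ge_d_flat:
  assumes A: "A > 0" and \<phi>: "\<And>l. \<phi> l = exp (A * l)"
    and q: "imm_path q" "q 0 \<in> oriented_curve c0" "q 1 \<in> oriented_curve c1"
  shows "sqrt (A * exp 1) * d_flat (oriented_curve c0) (oriented_curve c1) \<le> path_cost \<phi> q"
proof -
  obtain pt px ptx pxx where "loop_homotopy q pt px ptx pxx" using imm_path_loop_homotopy[OF q(1)] .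
  then interpret loop_homotopy q pt px ptx pxx .
  have "sqrt (A * exp 1) * d_flat (oriented_curve c0) (oriented_curve c1) \<le> sqrt (A * exp 1) * swept_area"
    using A by (intro mult_left_mono d_flat_le_swept_area q(2,3)) simp
  also have "\<dots> \<le> path_cost \<phi> q" by (rule path_cost_lower(1)[OF A \<phi>])
  finally show ?thesis .
qed

context loop_homotopy
begin

text \<open>The tangents of the two end curves agree at corresponding points. Therefore the parallel curve
  \<open>c + s n\<close> is traversed in the direction of the tangent of \<open>c\<close>, which gives the positivity required of a strip; its
  length is that of the final curve.\<close>

lemma endpoints_parallel_strip:
  assumes const: "\<And>t x y. t \<in> {0..1} \<Longrightarrow> \<bar>J t x\<bar> / cmod (px t x) = \<bar>J t y\<bar> / cmod (px t y)"
    and imms: "p 0 \<in> Imm" "p 1 \<in> Imm" and A: "A > 0"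
    and short: "curve_length (p 0) < 1 / A" "curve_length (p 1) < 1 / A"
  shows "\<exists>s. parallel_strip (p 0) s A \<and> (\<lambda>x. p 0 x + s *\<^sub>R unit_normal (p 0) x) \<in> oriented_curve (p 1)"
proof -
  obtain s \<psi> where \<psi>: "\<psi> \<in> circle_diffeos_pos"
    and eq: "\<forall>x. p 1 (\<psi> x) = p 0 x + s *\<^sub>R unit_normal (p 0) x \<and> unit_normal (p 1) (\<psi> x) = unit_normal (p 0) x"
    using parallel_endpoint[OF const imms] by blast
  interpret immersed_curve "p 0" by unfold_locales (rule imms(1))
  let ?o = "\<lambda>x. p 0 x + s *\<^sub>R unit_normal (p 0) x"
  have o_eq: "?o = p 1 \<circ> \<psi>" using eq by auto
  let ?d = "\<lambda>x. vector_derivative (p 1) (at (\<psi> x))"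
  have d1: "(?o has_vector_derivative deriv \<psi> x *\<^sub>R ?d x) (at x)" for x
    unfolding o_eq by (rule vector_derivative_reparam[OF imms(2) \<psi>])
  have d2: "(?o has_vector_derivative of_real (v x - s * k x) * T x) (at x)" for x
    using graph_deriv_x[of "\<lambda>t x. s" 0 0 x] by (simp add: graph_def[abs_def])
  have dT: "?d x = of_real (cmod (?d x)) * T x" for x
  proof -
    have "\<i> * ?d x / of_real (cmod (?d x)) = \<i> * T x"
      using eq unfolding nT[symmetric] by (simp add: unit_normal_def)
    then have "\<i> * (?d x / of_real (cmod (?d x))) = \<i> * T x" unfolding times_divide_eq_right .
    then have "?d x / of_real (cmod (?d x)) = T x" by (rule mult_left_cancel[THEN iffD1, rotated]) simp
    then show ?thesis using ImmD(4)[OF imms(2), of "\<psi> x"] by (auto simp: field_simps)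
  qed
  have speed: "v x - s * k x = deriv \<psi> x * cmod (?d x)" for x
  proof -
    have T0: "T x \<noteq> 0" using norm_T[of x] by auto
    have "of_real (v x - s * k x) * T x = deriv \<psi> x *\<^sub>R ?d x"
      by (rule vector_derivative_unique_at[OF d2 d1])
    also have "\<dots> = of_real (deriv \<psi> x * cmod (?d x)) * T x"
      by (subst dT) (simp add: scaleR_conv_of_real)
    finally have "complex_of_real (v x - s * k x) = of_real (deriv \<psi> x * cmod (?d x))"
      by (rule mult_right_cancel[OF T0, THEN iffD1])
    then show ?thesis by (simp only: of_real_eq_iff)
  qed
  have pos: "0 < v x - s * k x" for x
    unfolding speed using circle_diffeos_posD(2)[OF \<psi>] ImmD(4)[OF imms(2), of "\<psi> x"] by simp
  have o_imm: "?o \<in> Imm"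
    unfolding Imm_def
  proof (intro CollectI conjI allI)
    show "smooth_on UNIV ?o" unfolding smooth_on_UNIV_iff by (rule smooth_in_parallel[OF imms(1)])
    show "?o (x + 2 * pi) = ?o x" for x unfolding periodic_geometry ImmD(3)[OF imms(1)] ..
    show "vector_derivative ?o (at x) \<noteq> 0" for x
      unfolding vector_derivative_at[OF d1] using circle_diffeos_posD(2)[OF \<psi>, of x] ImmD(4)[OF imms(2), of "\<psi> x"] by simp
  qed
  have "curve_length ?o = integral {0..2 * pi} (\<lambda>x. v x - s * k x)"
    unfolding curve_length_def vector_derivative_at[OF d2]
    by (rule integral_cong) (use pos in \<open>simp add: norm_mult norm_T less_imp_le del: of_real_diff of_real_mult\<close>)
  then have "integral {0..2 * pi} (\<lambda>x. v x - s * k x) < 1 / A"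
    using curve_length_reparam[OF imms(2) \<psi>] short(2) unfolding o_eq by simp
  moreover have "integral {0..2 * pi} v < 1 / A"
    using short(1) unfolding curve_length_def v_def[abs_def] .
  ultimately have "parallel_strip (p 0) s A" using A pos by unfold_locales
  moreover have "?o \<in> oriented_curve (p 1)" by (rule oriented_curveI[OF imms(2) o_imm \<psi> o_eq])
  ultimately show ?thesis by blast
qed

end

theorem corollary6:
  fixes A :: real
    and \<phi> :: "real \<Rightarrow> real"
    and c :: "real \<Rightarrow> real \<Rightarrow> complex"
    and C1 C2 C1or C2or :: "(real \<Rightarrow> complex) set"
  assumes "A > 0"
    and "\<And>l. \<phi> l = exp (A * l)"
    and "C1 \<in> B_i" and "C2 \<in> B_i"
    and "connects c C1 C2"
    and "C1or = oriented_curve (c 0)" and "C2or = oriented_curve (c 1)"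
    and "\<forall>t\<in>{0..1}. \<forall>\<theta> \<theta>'. norm (normal_velocity c t \<theta>) = norm (normal_velocity c t \<theta>')"
    and "\<forall>t\<in>{0..1}. curve_length (c t) < 1 / A"
  shows "dist_G \<phi> C1or C2or = sqrt (A * exp 1) * d_flat C1or C2or \<and>
    ((\<exists>t\<in>{0..1}. \<exists>\<theta>. normal_velocity c t \<theta> \<noteq> 0) \<longrightarrow> \<not> minimal_path \<phi> c)"
proof -
  note A = assms(1) and \<phi> = assms(2) and short = assms(9)
  have path: "imm_path c" using assms(5) by (simp add: connects_def)
  then have imm: "c t \<in> Imm" if "t \<in> {0..1}" for t using that by (simp add: imm_path_def)
  let ?d = "d_flat C1or C2or" and ?costs = "{path_cost \<phi> q |q. imm_path q \<and> q 0 \<in> C1or \<and> q 1 \<in> C2or}"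
  have ends: "c 0 \<in> C1or" "c 1 \<in> C2or"
    unfolding assms(6,7) by (rule oriented_curve_self[OF imm], simp)+
  have lower: "sqrt (A * exp 1) * ?d \<le> x" if "x \<in> ?costs" for x
    using that path_cost_ge_d_flat[OF A \<phi>] unfolding assms(6,7) by blast
  obtain pt px ptx pxx where lh: "loop_homotopy c pt px ptx pxx" using imm_path_loop_homotopy[OF path] .
  interpret loop_homotopy c pt px ptx pxx by (rule lh)
  have speed: "\<bar>J t x\<bar> / cmod (px t x) = \<bar>J t y\<bar> / cmod (px t y)" if "t \<in> {0..1}" for t x y
    using assms(8) that unfolding normal_velocity_eq(3)[OF that, symmetric] by blast
  obtain s where strip: "parallel_strip (c 0) s A"
    and o: "(\<lambda>x. c 0 x + s *\<^sub>R unit_normal (c 0) x) \<in> oriented_curve (c 1)"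
    using endpoints_parallel_strip[OF speed imm imm A] short by auto
  interpret S: parallel_strip "c 0" s A by (rule strip)
  have dist: "dist_G \<phi> C1or C2or = sqrt (A * exp 1) * ?d"
  proof (rule antisym)
    have bdd: "bdd_below ?costs" by (rule bdd_belowI[OF lower])
    show "dist_G \<phi> C1or C2or \<le> sqrt (A * exp 1) * ?d"
    proof (rule field_le_epsilon)
      fix e :: real assume "e > 0"
      from S.cheap_path[OF this] obtain P where P: "imm_path P" "P 0 = c 0"
        "P 1 = (\<lambda>x. c 0 x + s *\<^sub>R unit_normal (c 0) x)"
        "path_cost (\<lambda>l. exp (A * l)) P < sqrt (A * exp 1) * (\<bar>s\<bar> * integral {0..1} S.ell) + e" by blast
      have \<phi>_eq: "\<phi> = (\<lambda>l. exp (A * l))" using \<phi> by auto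
      have "path_cost \<phi> P \<in> ?costs" using P(1,2,3) ends(1) o assms(7) by auto
      then have "dist_G \<phi> C1or C2or \<le> path_cost \<phi> P" unfolding dist_G_def by (rule cInf_lower[OF _ bdd])
      also have "\<dots> \<le> sqrt (A * exp 1) * (\<bar>s\<bar> * integral {0..1} S.ell) + e" using P(4) unfolding \<phi>_eq by simp
      also have "\<bar>s\<bar> * integral {0..1} S.ell \<le> ?d"
        using S.swept_area_le_d_flat[of "c 0" "c 1"] ends(1) o unfolding assms(6,7) by blast
      finally show "dist_G \<phi> C1or C2or \<le> sqrt (A * exp 1) * ?d + e"
        using A by (simp add: mult_left_mono)
    qed
    show "sqrt (A * exp 1) * ?d \<le> dist_G \<phi> C1or C2or"
      unfolding dist_G_def
    proof (rule cInf_greatest)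
      show "?costs \<noteq> {}" using path ends by blast
    qed (rule lower)
  qed
  moreover have "\<not> minimal_path \<phi> c" if "t \<in> {0..1}" "normal_velocity c t \<theta> \<noteq> 0" for t \<theta>
  proof -
    have "J t \<theta> \<noteq> 0" using normal_velocity_eq(3)[OF that(1), of \<theta>] that(2) by auto
    moreover have "len t < 1 / A" using bspec[OF short that(1)] curve_length_eq[OF that(1)] by simp
    ultimately have "sqrt (A * exp 1) * swept_area < path_cost \<phi> c"
      using path_cost_lower(2)[OF A \<phi> that(1)] by blast
    moreover have "sqrt (A * exp 1) * ?d \<le> sqrt (A * exp 1) * swept_area"
      using A d_flat_le_swept_area[of "c 0" "c 1"] ends unfolding assms(6,7) by (intro mult_left_mono) auto
    ultimately show ?thesis using dist unfolding minimal_path_def assms(6,7) by linarith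
  qed
  ultimately show ?thesis by blast
qed

end
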